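(* (i) Let $p>1$ and let $M^n\subset\mathbb{R}^{n+1}$ be a closed, smooth, strictly convex hypersurface with support function $h$ and Gauss curvature $\mathcal{K}$. If $h>0$ and, for some constant $c$, $$h^{p-1}e^{\frac12|Dh|^2}\mathcal{K}=c\qquad\text{on }\mathbb{S}^n,$$ then $M^n$ is a rescaling of $\mathbb{S}^n$, i.e. $M^n=r\,\mathbb{S}^n$ for some $r>0$. (ii) The same conclusion holds for $p=1$ under no assumption on the sign of $h$: if $M^n\subset\mathbb{R}^{n+1}$ is a closed, smooth, strictly convex hypersurface with support function $h$ and Gauss curvature $\mathcal{K}$ such that $e^{\frac12|Dh|^2}\mathcal{K}=c$ on $\mathbb{S}^n$ for some constant $c$, then $M^n=r\,\mathbb{S}^n$ for some $r>0$.
   Context: $\mathbb{S}^n\subset\mathbb{R}^{n+1}$ is the unit sphere centred at the origin, with round metric $\bar g$ and Levi-Civita connection $\bar\nabla$. A closed, smooth, strictly convex hypersurface $M$ is the $C^\infty$-smooth boundary, with positive Gauss curvature, of a convex body (compact convex set with non-empty interior) in $\mathbb{R}^{n+1}$. Its outer unit normal $\nu:M\to\mathbb{S}^n$ (Gauss map) is a diffeomorphism, and the support function and Gauss curvature are regarded as functions on $\mathbb{S}^n$: $h(x)=\langle\nu^{-1}(x),x\rangle$ and $\frac{1}{\mathcal{K}(x)}=\frac{\det(\bar\nabla^2h+\bar g h)}{\det(\bar g)}\big|_x$. $Dh$ at $x\in\mathbb{S}^n$ denotes the Euclidean gradient at $x$ of the 1-homogeneous extension of $h$, i.e. $Dh(x)=\bar\nabla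 h(x)+h(x)x=\nu^{-1}(x)$, so $|Dh|^2=h^2+|\bar\nabla h|^2$. *)

theory Defs
  imports "HOL-Analysis.Analysis"
begin

text \<open>Smooth functions and smooth embedded hypersurfaces of \<open>\<real>\<^sup>n\<^sup>+\<^sup>1\<close>, which is rendered as
  \<open>real ^ 'm\<close> with \<open>CARD('m) = n + 1\<close>.\<close>

text \<open>Intended for open \<open>S\<close>: all partial derivatives up to order \<open>k\<close> exist and are continuous.\<close>

primrec Ck_on :: "nat \<Rightarrow> ('a::euclidean_space \<Rightarrow> 'b::real_normed_vector) \<Rightarrow> 'a set \<Rightarrow> bool" where
  "Ck_on 0 f S \<longleftrightarrow> continuous_on S f"
| "Ck_on (Suc k) f S \<longleftrightarrow>
     f differentiable_on S \<and> (\<forall>b\<in>Basis. Ck_on k (\<lambda>x. frechet_derivative f (at x) b) S)"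

definition smooth_on :: "('a::euclidean_space \<Rightarrow> 'b::real_normed_vector) \<Rightarrow> 'a set \<Rightarrow> bool" where
  "smooth_on f S \<longleftrightarrow> (\<forall>k. Ck_on k f S)"

text \<open>Locally the zero set of a smooth function with non-vanishing differential.\<close>

definition smooth_hypersurface :: "'a::euclidean_space set \<Rightarrow> bool" where
  "smooth_hypersurface M \<longleftrightarrow>
     (\<forall>y\<in>M. \<exists>U (F :: 'a \<Rightarrow> real). open U \<and> y \<in> U \<and> smooth_on F U \<and>
        M \<inter> U = {z \<in> U. F z = 0} \<and>
        (\<forall>z \<in> M \<inter> U. frechet_derivative F (at z) \<noteq> (\<lambda>v. 0)))"

definition convex_body :: "'a::euclidean_space set \<Rightarrow> bool" where
  "convex_body C \<longleftrightarrow> compact C \<and> convex C \<and> interior C \<noteq> {}"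

text \<open>Outer unit normal of the boundary \<open>M\<close> of a convex body \<open>C\<close>.  As \<open>C\<close> is the convex hull of
  \<open>M\<close> when the dimension is at least 2, it suffices to test the supporting half-space against
  the points of \<open>M\<close>.  For smooth \<open>M\<close> the vector is unique.\<close>

definition gauss_map :: "'a::euclidean_space set \<Rightarrow> 'a \<Rightarrow> 'a" where
  "gauss_map M y = (THE u. norm u = 1 \<and> (\<forall>z\<in>M. (z - y) \<bullet> u \<le> 0))"

text \<open>For a unit vector \<open>u\<close>: orthogonal projection onto the hyperplane orthogonal to \<open>u\<close>, which is
  the tangent space both of the sphere at \<open>u\<close> and of a hypersurface at a point with normal \<open>u\<close>.\<close>

definition tangent_proj :: "'a::euclidean_space \<Rightarrow> 'a \<Rightarrow> 'a" where
  "tangent_proj u v = v - (v \<bullet> u) *\<^sub>R u"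

text \<open>Determinant of a linear endomorphism \<open>A\<close> of the hyperplane orthogonal to the unit vector \<open>u\<close>,
  computed by extending \<open>A\<close> with \<open>u \<mapsto> u\<close> to the whole space.  Only the values of \<open>A\<close>
  on the hyperplane matter.\<close>

definition tangent_det :: "real ^ 'm \<Rightarrow> (real ^ 'm \<Rightarrow> real ^ 'm) \<Rightarrow> real" where
  "tangent_det u A = det (matrix (\<lambda>v. A (tangent_proj u v) + (v \<bullet> u) *\<^sub>R u))"

text \<open>Determinant of the Weingarten map, the differential of the Gauss map on the tangent space.
  A derivative within \<open>M\<close> is determined only on tangent vectors, which is all that
  \<open>tangent_det\<close> uses; the same remark applies to the derivatives within the sphere below.\<close>

definition gauss_curvature :: "(real ^ 'm) set \<Rightarrow> real ^ 'm \<Rightarrow> real" where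
  "gauss_curvature M y =
     tangent_det (gauss_map M y) (frechet_derivative (gauss_map M) (at y within M))"

definition closed_smooth_strictly_convex :: "(real ^ 'm) set \<Rightarrow> bool" where
  "closed_smooth_strictly_convex M \<longleftrightarrow>
     (\<exists>C. convex_body C \<and> M = frontier C) \<and> smooth_hypersurface M \<and>
     (\<forall>y\<in>M. gauss_curvature M y > 0)"

definition support_fn :: "'a::euclidean_space set \<Rightarrow> 'a \<Rightarrow> real" where
  "support_fn M x = inv_into M (gauss_map M) x \<bullet> x"

definition sphere_grad :: "('a::euclidean_space \<Rightarrow> real) \<Rightarrow> 'a \<Rightarrow> 'a" where
  "sphere_grad h x =
     (THE g. g \<bullet> x = 0 \<and>
        (\<forall>v. v \<bullet> x = 0 \<longrightarrow> g \<bullet> v = frechet_derivative h (at x within sphere 0 1) v))"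

text \<open>The covariant Hessian as an endomorphism of the tangent space: \<open>v\<close> is sent to the covariant
  derivative of the gradient in direction \<open>v\<close>.  The Levi-Civita connection of the round metric is
  the tangential part of the Euclidean derivative.\<close>

definition sphere_hess :: "('a::euclidean_space \<Rightarrow> real) \<Rightarrow> 'a \<Rightarrow> 'a \<Rightarrow> 'a" where
  "sphere_hess h x v =
     tangent_proj x (frechet_derivative (sphere_grad h) (at x within sphere 0 1) v)"

text \<open>Gauss curvature as a function on the sphere, with reciprocal
  \<open>det (\<nabla>\<^sup>2h + g h) / det g\<close>.  This quotient is the determinant of the endomorphism
  that the round metric \<open>g\<close> associates with the bilinear form \<open>\<nabla>\<^sup>2h + g h\<close>.\<close>

definition curvature_fn :: "(real ^ 'm) set \<Rightarrow> real ^ 'm \<Rightarrow> real" where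
  "curvature_fn M x =
     1 / tangent_det x (\<lambda>v. sphere_hess (support_fn M) x v + support_fn M x *\<^sub>R v)"

text \<open>Euclidean gradient of the 1-homogeneous extension \<open>y \<mapsto> |y| h (y / |y|)\<close>.\<close>

definition hom_grad :: "('a::euclidean_space \<Rightarrow> real) \<Rightarrow> 'a \<Rightarrow> 'a" where
  "hom_grad h x = (THE g. GDERIV (\<lambda>y. norm y * h (sgn y)) x :> g)"

end

theory Submission
  imports Defs
begin

text \<open>Let \<open>h\<close> be the support function, \<open>X = Dh\<close> the inverse Gauss map, \<open>A = \<nabla>\<^sup>2h + g h\<close> and
  \<open>S = det A = 1 / K\<close>.  Every interior point of the body is \<open>X x - s *\<^sub>R x\<close> for some unit vector \<open>x\<close> and some
  \<open>s\<close> below the least eigenvalue of \<open>A\<close>; since \<open>det (A - s I) \<le> (S\<^sup>1\<^sup>/\<^sup>n - s)\<^sup>n\<close>, integrating the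
  Jacobian of this map gives \<open>Vol \<le> 1/(n+1) \<integral> S\<^sup>1\<^sup>/\<^sup>n S\<close>, a form of the Heintze--Karcher inequality.  As
  \<open>Vol = 1/(n+1) \<integral> h S\<close> and \<open>n S\<^sup>1\<^sup>/\<^sup>n \<le> tr A = \<Delta>h + n h\<close>, this yields \<open>\<integral> S \<Delta>h \<ge> 0\<close>, that is
  \<open>\<integral> \<langle>\<nabla>S, \<nabla>h\<rangle> \<le> 0\<close>.  The curvature equation makes \<open>S\<close> a constant multiple of
  \<open>h\<^sup>p\<^sup>-\<^sup>1 exp (|X|\<^sup>2 / 2)\<close>, so
  \<open>\<langle>\<nabla>S, \<nabla>h\<rangle> = S ((p - 1) |\<nabla>h|\<^sup>2 / h + A(\<nabla>h, \<nabla>h)) \<ge> 0\<close>.  Hence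
  \<open>\<nabla>h = 0\<close>, because \<open>A\<close> is positive definite.

  Integrals over the sphere are replaced by integrals of 0-homogeneous functions over the punctured unit ball,
  and the divergence theorem on the sphere by the invariance of Lebesgue measure under rotations.\<close>

section \<open>Determinants of symmetric tangential maps\<close>

text \<open>The classical Heintze--Karcher inequality has the harmonic mean of the radii of
  curvature under the integral. The larger geometric mean is used here because it can be compared
  both with the determinant, through a Minkowski inequality, and with the arithmetic mean
  \<open>tr A / n\<close>. Equality cases of these inequalities are never analysed: rigidity comes
  from the pointwise term \<open>A(\<nabla>h, \<nabla>h)\<close>, which is present for every
  exponent. In (i) the positivity of \<open>h\<close> gives the sign of the term with the factor
  \<open>p - 1\<close>; in (ii) that term is absent, but the origin may lie outside the body, so
  radial coordinates have to start from an arbitrary interior point.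

  Working with the 1-homogeneous support function on the punctured space turns
  \<open>\<nabla>\<^sup>2h + g h\<close> into an ordinary Hessian: its symmetry is the theorem of
  Schwarz, its semidefiniteness is convexity, and positive curvature enters only as injectivity on
  the tangent space. Covariant derivatives on the sphere appear only in the final
  translation.\<close>

lemma symmetric_eigenbasis:
  fixes Q :: "'a::euclidean_space \<Rightarrow> 'a"
  assumes "linear Q" and sym: "\<And>u v. Q u \<bullet> v = u \<bullet> Q v"
    and "subspace V" and "\<And>v. v \<in> V \<Longrightarrow> Q v \<in> V"
  shows "\<exists>B e. pairwise orthogonal B \<and> (\<forall>b\<in>B. norm b = 1 \<and> Q b = e b *\<^sub>R b) \<and> span B = V"
  using assms(3,4)
proof (induction "dim V" arbitrary: V rule: less_induct)
  case less
  interpret Q: linear Q by fact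
  show ?case
  proof (cases "V = {0}")
    case True
    then show ?thesis by (intro exI[of _ "{}"]) auto
  next
    case False
    \<comment> \<open>A maximiser of the quadratic form on the unit sphere of \<open>V\<close> is an
      eigenvector; its orthogonal complement in \<open>V\<close> is invariant and of smaller
      dimension, which feeds the induction.\<close>
    define K where "K = V \<inter> sphere 0 1"
    obtain w where w: "w \<in> V" "w \<noteq> 0"
      using False subspace_0[OF less.prems(1)] by blast
    have "sgn w \<in> K"
      using w less.prems(1) by (simp add: K_def sgn_div_norm subspace_scale)
    moreover have "compact K"
      unfolding K_def using closed_subspace[OF less.prems(1)]
      by (metis compact_sphere closed_Int_compact)
    moreover have "continuous_on K (\<lambda>x. Q x \<bullet> x)"
      using \<open>linear Q\<close> by (intro continuous_intros linear_continuous_on) (simp add: linear_conv_bounded_linear)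
    ultimately obtain x where x: "x \<in> K" and xmax: "\<And>y. y \<in> K \<Longrightarrow> Q y \<bullet> y \<le> Q x \<bullet> x"
      using continuous_attains_sup[of K "\<lambda>x. Q x \<bullet> x"] by blast
    define l where "l = Q x \<bullet> x"
    have xV: "x \<in> V" and x1: "norm x = 1" and xx: "x \<bullet> x = 1"
      using x by (auto simp: K_def norm_eq_1)
    have le: "Q y \<bullet> y \<le> l * (y \<bullet> y)" if "y \<in> V" for y
    proof (cases "y = 0")
      case True then show ?thesis by (simp add: Q.zero)
    next
      case False
      have "sgn y \<in> K"
        using that False less.prems(1) by (simp add: K_def sgn_div_norm subspace_scale)
      from xmax[OF this] have "(Q y \<bullet> y) / (norm y)^2 \<le> l"
        by (simp add: sgn_div_norm Q.scale l_def power2_eq_square divide_simps)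
      then show ?thesis
        using False by (simp add: divide_simps dot_square_norm)
    qed
    have orth: "Q x \<bullet> y = 0" if y: "y \<in> V" "x \<bullet> y = 0" for y
    proof (rule ccontr)
      assume nz: "Q x \<bullet> y \<noteq> 0"
      define c where "c = l * (y \<bullet> y) - Q y \<bullet> y"
      have c: "c \<ge> 0" using le[OF y(1)] by (simp add: c_def)
      have *: "2 * t * (Q x \<bullet> y) \<le> t^2 * c" for t
      proof -
        have "x + t *\<^sub>R y \<in> V" using xV y less.prems(1) by (simp add: subspace_add subspace_scale)
        from le[OF this] have "Q (x + t *\<^sub>R y) \<bullet> (x + t *\<^sub>R y) \<le> l * ((x + t *\<^sub>R y) \<bullet> (x + t *\<^sub>R y))" .
        moreover have "Q y \<bullet> x = Q x \<bullet> y" using sym[of y x] by (simp add: inner_commute)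
        ultimately show ?thesis
          using y(2) xx unfolding c_def l_def
          by (simp add: Q.add Q.scale inner_add_left inner_add_right inner_commute[of y x] algebra_simps power2_eq_square)
      qed
      \<comment> \<open>\<open>*\<close> bounds a linear function of \<open>t\<close> by a quadratic
        one, which fails for small \<open>t\<close> with the sign of \<open>d\<close>. The
        denominator \<open>c + 1\<close> keeps the witness defined when
        \<open>c = 0\<close>.\<close>
      define d where "d = Q x \<bullet> y"
      have "2 * (d / (c + 1)) * d \<le> (d / (c + 1))^2 * c"
        using *[of "d/(c+1)"] by (simp add: d_def)
      moreover have "(d / (c + 1))^2 * c < 2 * (d / (c + 1)) * d"
      proof -
        have d2: "d^2 > 0" using nz by (simp add: d_def)
        have "(d / (c + 1))^2 * c = d^2 * (c / (c+1)^2)" by (simp add: power_divide)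
        also have "\<dots> < d^2 * (2 / (c+1))"
        proof (intro mult_strict_left_mono d2)
          have "c / (c+1) / (c+1) < 2 / (c+1)"
            using c by (intro divide_strict_right_mono) (auto simp: divide_simps)
          then show "c / (c+1)^2 < 2 / (c+1)" by (simp add: power2_eq_square)
        qed
        also have "\<dots> = 2 * (d / (c + 1)) * d" by (simp add: power2_eq_square)
        finally show ?thesis .
      qed
      ultimately show False by simp
    qed
    have eig: "Q x = l *\<^sub>R x"
    proof -
      define y where "y = Q x - l *\<^sub>R x"
      have "y \<in> V" using xV less.prems by (simp add: y_def subspace_diff subspace_scale)
      moreover have xy: "x \<bullet> y = 0"
        using xx by (simp add: y_def l_def inner_diff_right inner_commute)
      ultimately have "Q x \<bullet> y = 0" by (rule orth)
      then have "y \<bullet> y = 0" using xy by (simp add: y_def inner_diff_left inner_commute)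
      then show ?thesis by (simp add: y_def)
    qed
    define V' where "V' = {v \<in> V. x \<bullet> v = 0}"
    have sub': "subspace V'"
      using less.prems(1) by (auto simp: V'_def subspace_def inner_add_right)
    have inv': "Q v \<in> V'" if "v \<in> V'" for v
      using that less.prems(2) sym[of x v] eig by (auto simp: V'_def)
    have "x \<notin> V'" "V' \<subseteq> V" using xx by (auto simp: V'_def)
    then have "V' \<subset> V" using xV by blast
    then have "dim V' < dim V"
      using sub' less.prems(1) by (metis dim_psubset span_eq_iff)
    from less.hyps[OF this sub' inv'] obtain B e where B: "pairwise orthogonal B"
      "\<forall>b\<in>B. norm b = 1 \<and> Q b = e b *\<^sub>R b" "span B = V'" by blast
    have BV: "b \<in> V'" if "b \<in> B" for b using that B(3) span_base by blast
    have xB: "x \<notin> B" using BV xx by (auto simp: V'_def)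
    show ?thesis
    proof (intro exI conjI)
      show "pairwise orthogonal (insert x B)"
        using B(1) BV by (auto simp: pairwise_insert orthogonal_def V'_def inner_commute)
      show "\<forall>b\<in>insert x B. norm b = 1 \<and> Q b = (e(x := l)) b *\<^sub>R b"
        using B(2) x1 eig xB by auto
      show "span (insert x B) = V"
      proof
        have "insert x B \<subseteq> V" using xV BV by (auto simp: V'_def)
        then show "span (insert x B) \<subseteq> V" using less.prems(1) by (simp add: span_minimal)
        show "V \<subseteq> span (insert x B)"
        proof
          fix v assume v: "v \<in> V"
          have "v - (x \<bullet> v) *\<^sub>R x \<in> V'"
            using v xV xx less.prems(1) by (auto simp: V'_def subspace_diff subspace_scale inner_diff_right)
          then have "v - (x \<bullet> v) *\<^sub>R x \<in> span B" using B(3) by simp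
          then show "v \<in> span (insert x B)"
            by (metis span_breakdown_eq)
        qed
      qed
    qed
  qed
qed

lemma det_matrix_compose:
  assumes "linear f" "linear g"
  shows "det (matrix (\<lambda>v. f (g v :: real^'n))) = det (matrix f) * det (matrix (g :: real^'n \<Rightarrow> real^'n))"
  using matrix_compose[of g f] assms by (simp add: o_def det_mul linear_linear[symmetric])

text \<open>With \<open>R\<close> carrying the standard basis to \<open>B\<close> and
  \<open>D\<close> diagonal, \<open>f R = R D\<close>; the nonzero determinant of \<open>R\<close>
  cancels.\<close>

lemma det_matrix_eigenbasis:
  fixes f :: "real^'n \<Rightarrow> real^'n"
  assumes f: "linear f" and B: "pairwise orthogonal B" "\<And>b. b \<in> B \<Longrightarrow> norm b = 1" "span B = UNIV"
    and eig: "\<And>b. b \<in> B \<Longrightarrow> f b = e b *\<^sub>R b"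
  shows "det (matrix f) = prod e B"
proof -
  have "independent B"
    using B by (intro pairwise_orthogonal_independent) (auto, metis norm_zero zero_neq_one)
  then have fin: "finite B" and card: "card B = CARD('n)"
    using independent_imp_finite B(3) dim_span_eq_card_independent[of B] by auto
  then obtain b where b: "bij_betw b (UNIV::'n set) B"
    using finite_same_card_bij[of "UNIV::'n set" B] by auto
  define R :: "real^'n \<Rightarrow> real^'n" where "R v = (\<Sum>i\<in>UNIV. v $ i *\<^sub>R b i)" for v
  define D :: "real^'n^'n" where "D = (\<chi> i j. if i = j then e (b i) else 0)"
  have linR: "linear R"
  proof (rule linearI)
    show "R (u + v) = R u + R v" for u v by (simp only: R_def vector_add_component scaleR_add_left sum.distrib)
    show "R (c *\<^sub>R v) = c *\<^sub>R R v" for c v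
      by (simp only: R_def vector_scaleR_component scaleR_sum_right scaleR_scaleR real_scaleR_def)
  qed
  have bB: "b i \<in> B" for i using bij_betw_apply[OF b] by simp
  have Rax: "R (axis i 1) = b i" for i
    by (simp add: R_def axis_def if_distrib[of "\<lambda>c. c *\<^sub>R _"] cong: if_cong)
  have "B \<subseteq> range R" using bij_betw_imp_surj_on[OF b] Rax by (metis image_subset_iff rangeI)
  then have "span B \<subseteq> range R"
    using linR by (simp add: span_minimal linear_subspace_image)
  then have "surj R" using B(3) by auto
  then have "inj R" using linR linear_surjective_imp_injective by blast
  then have detR: "det (matrix R) \<noteq> 0" using det_nz_iff_inj linR by blast
  have Deq: "D *v v = (\<chi> i. e (b i) * v $ i)" for v
    by (simp add: D_def matrix_vector_mult_def vec_eq_iff if_distrib[of "\<lambda>c. c * _"] cong: if_cong)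
  have comm: "f (R v) = R (D *v v)" for v
    unfolding Deq R_def using f eig[OF bB]
    by (simp add: linear_sum[OF f] linear_scale[OF f] mult.commute)
  have "det (matrix f) * det (matrix R) = det (matrix (\<lambda>v. f (R v)))"
    using f linR by (simp add: det_matrix_compose)
  also have "\<dots> = det (matrix R) * det (matrix ((*v) D))"
    unfolding comm using linR by (intro det_matrix_compose) auto
  finally have "det (matrix f) = det D" using detR by simp
  also have "\<dots> = (\<Prod>i\<in>UNIV. e (b i))"
    by (subst det_diagonal) (auto simp: D_def)
  also have "\<dots> = prod e B" using b by (rule prod.reindex_bij_betw)
  finally show ?thesis .
qed

lemma orthonormal_expansion:
  fixes B :: "'a::euclidean_space set"
  assumes B: "pairwise orthogonal B" "\<And>b. b \<in> B \<Longrightarrow> norm b = 1" "span B = UNIV"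
  shows "finite B" and "v = (\<Sum>b\<in>B. (b \<bullet> v) *\<^sub>R b)"
proof -
  have "independent B"
    using B by (intro pairwise_orthogonal_independent) (auto, metis norm_zero zero_neq_one)
  then show fin: "finite B" using independent_imp_finite by blast
  then obtain c where c: "v = (\<Sum>b\<in>B. c b *\<^sub>R b)"
    using span_finite[of B] B(3) by auto
  have "b \<bullet> v = c b" if "b \<in> B" for b
  proof -
    have "b \<bullet> v = (\<Sum>a\<in>B. c a * (b \<bullet> a))" by (simp add: c inner_sum_right)
    also have "\<dots> = (\<Sum>a\<in>B. if a = b then c a else 0)"
      using that B by (intro sum.cong) (auto simp: pairwise_def orthogonal_def norm_eq_1)
    finally show ?thesis using fin that by simp
  qed
  then show "v = (\<Sum>b\<in>B. (b \<bullet> v) *\<^sub>R b)" using c by simp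
qed

lemma trace_orthonormal:
  fixes f :: "real^'n \<Rightarrow> real^'n"
  assumes f: "linear f" and B: "pairwise orthogonal B" "\<And>b. b \<in> B \<Longrightarrow> norm b = 1" "span B = UNIV"
    and eig: "\<And>b. b \<in> B \<Longrightarrow> f b = e b *\<^sub>R b"
  shows "(\<Sum>i\<in>UNIV. f (axis i 1) $ i) = sum e B"
proof -
  have f_ax: "f (axis i 1) $ i = (\<Sum>b\<in>B. e b * (b $ i)^2)" for i
  proof -
    have "f (axis i 1) = f (\<Sum>b\<in>B. (b \<bullet> axis i 1) *\<^sub>R b)"
      using orthonormal_expansion(2)[OF B] by metis
    also have "\<dots> = (\<Sum>b\<in>B. (b $ i) *\<^sub>R (e b *\<^sub>R b))"
      by (simp add: linear_sum[OF f] linear_scale[OF f] eig inner_axis)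
    finally show ?thesis by (simp add: power2_eq_square mult_ac)
  qed
  have "(\<Sum>i\<in>UNIV. f (axis i 1) $ i) = (\<Sum>b\<in>B. \<Sum>i\<in>UNIV. e b * (b $ i)^2)"
    unfolding f_ax by (rule sum.swap)
  also have "\<dots> = (\<Sum>b\<in>B. e b * (b \<bullet> b))"
    by (simp add: sum_distrib_left inner_vec_def power2_eq_square)
  also have "\<dots> = sum e B" using B(2) by (simp add: norm_eq_1)
  finally show ?thesis .
qed

text \<open>An orthogonal map takes \<open>x\<close> to a coordinate vector; the conjugated map
  differs from the identity in a single column, so Cramer's rule gives its determinant. The second
  formula is the transpose of the first.\<close>

lemma det_add_rank_one:
  fixes x p :: "real^'n"
  assumes x: "norm x = 1"
  shows "det (matrix (\<lambda>v. v + (x \<bullet> v) *\<^sub>R p)) = 1 + p \<bullet> x"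
    and "det (matrix (\<lambda>v. v + (p \<bullet> v) *\<^sub>R x)) = 1 + p \<bullet> x"
proof -
  obtain k :: 'n where True by blast
  obtain R where R: "orthogonal_transformation R" "R x = (axis k 1 :: real^'n)"
    using orthogonal_transformation_exists[of x "axis k 1"] x by auto
  have linR: "linear R" using R by (simp add: orthogonal_transformation_linear)
  obtain R' where R': "linear R'" "\<And>v. R' (R v) = v" "\<And>v. R (R' v) = v"
    using orthogonal_transformation_inj[OF R(1)] linR
    by (metis linear_injective_isomorphism)
  have x': "x \<bullet> v = R v $ k" for v
    using R by (metis inner_axis' orthogonal_transformation_def inner_real_def mult_1 real_inner_1_left)
  define g where "g v = v + (v $ k) *\<^sub>R R p" for v
  have ling: "linear g"
    unfolding g_def by (intro linearI) (auto simp: algebra_simps)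
  have "det (matrix (\<lambda>v. v + (x \<bullet> v) *\<^sub>R p)) = det (matrix (\<lambda>v. R' (g (R v))))"
    by (simp add: g_def x' linear_add[OF R'(1)] linear_scale[OF R'(1)] R')
  also have "\<dots> = det (matrix R') * det (matrix g) * det (matrix R)"
    using R'(1) ling linR det_matrix_compose[OF R'(1), of "\<lambda>v. g (R v)"] linear_compose[OF linR ling]
    by (simp add: det_matrix_compose o_def)
  also have "\<dots> = det (matrix g) * det (matrix (\<lambda>v. R' (R v)))"
    using det_matrix_compose[OF R'(1) linR] by simp
  also have "det (matrix (\<lambda>v. R' (R v))) = 1" using R'(2) by (simp add: id_def[symmetric])
  also have "matrix g = (\<chi> i j. if j = k then (axis k 1 + R p) $ i else mat 1 $ i $ j)"
    by (auto simp: matrix_def g_def vec_eq_iff axis_def mat_def)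
  also have "det \<dots> = 1 + R p $ k" using cramer_lemma[of k "mat 1" "axis k 1 + R p"] unfolding matrix_vector_mul_lid by (simp add: axis_def)
  also have "R p $ k = p \<bullet> x" using x'[of p] by (simp add: inner_commute)
  finally show 1: "det (matrix (\<lambda>v. v + (x \<bullet> v) *\<^sub>R p)) = 1 + p \<bullet> x" by simp
  have "matrix (\<lambda>v. v + (p \<bullet> v) *\<^sub>R x) = transpose (matrix (\<lambda>v. v + (x \<bullet> v) *\<^sub>R p))"
    by (auto simp: matrix_def transpose_def vec_eq_iff inner_axis mult.commute) (auto simp: axis_def)
  then show "det (matrix (\<lambda>v. v + (p \<bullet> v) *\<^sub>R x)) = 1 + p \<bullet> x"
    using 1 by (simp add: det_transpose)
qed

text \<open>Both maps are block triangular with respect to \<open>x\<close> and its complement: they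
  factor into the case \<open>w = x\<close> and a rank-one perturbation of the identity. The first
  form is the Jacobian of the inner normal map, the second that of the radial map.\<close>

lemma det_tangential_block:
  fixes x w :: "real^'n"
  assumes Q: "linear Q" and x: "norm x = 1"
  shows "Q x = 0 \<Longrightarrow> det (matrix (\<lambda>v. Q v + (w \<bullet> v) *\<^sub>R x))
            = (w \<bullet> x) * det (matrix (\<lambda>v. Q v + (x \<bullet> v) *\<^sub>R x))"
    and "(\<And>v. x \<bullet> Q v = 0) \<Longrightarrow> det (matrix (\<lambda>v. Q v + (x \<bullet> v) *\<^sub>R w))
            = (w \<bullet> x) * det (matrix (\<lambda>v. Q v + (x \<bullet> v) *\<^sub>R x))"
proof -
  interpret Q: linear Q by fact
  have xx: "x \<bullet> x = 1" using x by (simp add: norm_eq_1)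
  have lin1: "linear (\<lambda>v. Q v + (x \<bullet> v) *\<^sub>R x)"
    by (intro linearI) (auto simp: Q.add Q.scale algebra_simps)
  have lin2: "linear (\<lambda>v. v + (a \<bullet> v) *\<^sub>R b)" for a b :: "real^'n"
    by (intro linearI) (auto simp: algebra_simps)
  {
    assume "Q x = 0"
    then have "(\<lambda>v. Q v + (w \<bullet> v) *\<^sub>R x) =
      (\<lambda>v. (\<lambda>v. Q v + (x \<bullet> v) *\<^sub>R x) (v + ((w - x) \<bullet> v) *\<^sub>R x))"
      by (auto simp: fun_eq_iff Q.add Q.diff Q.scale xx inner_add_right algebra_simps)
    then show "det (matrix (\<lambda>v. Q v + (w \<bullet> v) *\<^sub>R x))
            = (w \<bullet> x) * det (matrix (\<lambda>v. Q v + (x \<bullet> v) *\<^sub>R x))"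
      using det_matrix_compose[OF lin1 lin2[of "w - x" x]] det_add_rank_one(2)[OF x, of "w - x"] xx
      by (simp only: inner_diff_left) simp
  next
    assume "\<And>v. x \<bullet> Q v = 0"
    then have "(\<lambda>v. Q v + (x \<bullet> v) *\<^sub>R w) =
      (\<lambda>v. (\<lambda>v. v + (x \<bullet> v) *\<^sub>R (w - x)) (Q v + (x \<bullet> v) *\<^sub>R x))"
      by (auto simp: fun_eq_iff xx inner_add_right algebra_simps)
    then show "det (matrix (\<lambda>v. Q v + (x \<bullet> v) *\<^sub>R w))
            = (w \<bullet> x) * det (matrix (\<lambda>v. Q v + (x \<bullet> v) *\<^sub>R x))"
      using det_matrix_compose[OF lin2[of x "w - x"] lin1] det_add_rank_one(1)[OF x, of "w - x"] xx
      by (simp only: inner_diff_left) simp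
  }
qed

text \<open>\<open>B\<close> spans the hyperplane orthogonal to \<open>x\<close>. Completed by
  \<open>x\<close>, it diagonalises every combination of \<open>Q\<close> and the tangential
  projection at once; \<open>x\<close> contributes the factor 1 to the determinant and 0 to the
  trace.\<close>

lemma tangential_eigenbasis:
  fixes x :: "real^'n"
  assumes Q: "linear Q" and sym: "\<And>u v. Q u \<bullet> v = u \<bullet> Q v" and Qx: "Q x = 0" and x: "norm x = 1"
  obtains B e where "finite B" "card B = CARD('n) - 1"
    "\<And>b. b \<in> B \<Longrightarrow> norm b = 1 \<and> x \<bullet> b = 0 \<and> Q b = e b *\<^sub>R b"
    "\<And>s k. det (matrix (\<lambda>v. s *\<^sub>R Q v + k *\<^sub>R (v - (x \<bullet> v) *\<^sub>R x) + (x \<bullet> v) *\<^sub>R x))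
        = (\<Prod>b\<in>B. s * e b + k)"
    "(\<Sum>i\<in>UNIV. Q (axis i 1) $ i) = sum e B"
proof -
  interpret Q: linear Q by fact
  have xx: "x \<bullet> x = 1" using x by (simp add: norm_eq_1)
  define V where "V = {v. x \<bullet> v = 0}"
  have "subspace V" by (auto simp: V_def subspace_def inner_add_right)
  moreover have "Q v \<in> V" if "v \<in> V" for v using sym[of x v] by (simp add: V_def Qx)
  ultimately obtain B e where B: "pairwise orthogonal B" "\<forall>b\<in>B. norm b = 1 \<and> Q b = e b *\<^sub>R b" "span B = V"
    using symmetric_eigenbasis[OF Q sym] by blast
  have BV: "x \<bullet> b = 0" if "b \<in> B" for b using that B(3) span_base V_def by blast
  have xB: "x \<notin> B" using BV xx by auto
  have orth: "pairwise orthogonal (insert x B)"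
    using B(1) BV by (auto simp: pairwise_insert orthogonal_def inner_commute)
  have nrm: "\<And>b. b \<in> insert x B \<Longrightarrow> norm b = 1" using B x by auto
  have spn: "span (insert x B) = UNIV"
  proof -
    have "v \<in> span (insert x B)" for v
    proof -
      have "v - (x \<bullet> v) *\<^sub>R x \<in> span B" using xx B(3) by (simp add: V_def inner_diff_right)
      then show ?thesis by (metis span_breakdown_eq)
    qed
    then show ?thesis by blast
  qed
  have "independent (insert x B)"
    using orth by (intro pairwise_orthogonal_independent) (use nrm norm_zero zero_neq_one in metis)+
  then have "card (insert x B) = CARD('n)"
    using dim_span_eq_card_independent[of "insert x B"] spn by simp
  moreover have fin: "finite B" using orthonormal_expansion(1)[OF orth nrm spn] by simp
  ultimately have card: "card B = CARD('n) - 1" using xB by simp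
  show ?thesis
  proof (rule that[OF fin card])
    show "\<And>b. b \<in> B \<Longrightarrow> norm b = 1 \<and> x \<bullet> b = 0 \<and> Q b = e b *\<^sub>R b" using B BV by auto
    fix s k
    have "linear (\<lambda>v. s *\<^sub>R Q v + k *\<^sub>R (v - (x \<bullet> v) *\<^sub>R x) + (x \<bullet> v) *\<^sub>R x)"
      by (intro linearI) (auto simp: Q.add Q.scale algebra_simps)
    then have "det (matrix (\<lambda>v. s *\<^sub>R Q v + k *\<^sub>R (v - (x \<bullet> v) *\<^sub>R x) + (x \<bullet> v) *\<^sub>R x))
        = (\<Prod>b\<in>insert x B. if b = x then 1 else s * e b + k)"
      by (rule det_matrix_eigenbasis[OF _ orth nrm spn])
        (use B(2) BV Qx xB xx in \<open>auto simp: algebra_simps\<close>)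
    also have "\<dots> = (\<Prod>b\<in>B. if b = x then 1 else s * e b + k)" using xB fin by simp
    also have "\<dots> = (\<Prod>b\<in>B. s * e b + k)" using xB by (intro prod.cong) auto
    finally show "det (matrix (\<lambda>v. s *\<^sub>R Q v + k *\<^sub>R (v - (x \<bullet> v) *\<^sub>R x) + (x \<bullet> v) *\<^sub>R x))
        = (\<Prod>b\<in>B. s * e b + k)" .
  next
    have "(\<Sum>i\<in>UNIV. Q (axis i 1) $ i) = sum (\<lambda>b. if b = x then 0 else e b) (insert x B)"
      using B(2) xB Qx by (intro trace_orthonormal[OF Q orth nrm spn]) auto
    also have "\<dots> = sum (\<lambda>b. if b = x then 0 else e b) B" using fin xB by simp
    also have "\<dots> = sum e B" using xB by (intro sum.cong) auto
    finally show "(\<Sum>i\<in>UNIV. Q (axis i 1) $ i) = sum e B" .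
  qed
qed

text \<open>Minkowski's determinant inequality for eigenvalues: divide by the geometric mean
  \<open>G\<close> of the \<open>e b + k\<close> and apply the inequality of arithmetic and
  geometric means to the ratios \<open>e b / (e b + k)\<close> and \<open>k / (e b + k)\<close>,
  which add up to 1.\<close>

lemma geometric_mean_shift:
  fixes e :: "'b \<Rightarrow> real"
  assumes "finite B" "B \<noteq> {}" and e: "\<And>b. b \<in> B \<Longrightarrow> 0 \<le> e b" and k: "k \<ge> 0"
  shows "(\<Prod>b\<in>B. e b) powr (1 / card B) + k \<le> (\<Prod>b\<in>B. e b + k) powr (1 / card B)"
proof (cases "k = 0")
  case True then show ?thesis by simp
next
  case False
  then have k: "k > 0" using k by simp
  define n where "n = card B"
  have n: "n > 0" using assms n_def by (simp add: card_gt_0_iff)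
  define G where "G = (\<Prod>b\<in>B. e b + k) powr (1 / n)"
  have pos: "e b + k > 0" if "b \<in> B" for b using e[OF that] k by simp
  have prodpos: "(\<Prod>b\<in>B. e b + k) > 0" using pos by (intro prod_pos) auto
  have G: "G > 0" using prodpos by (simp add: G_def)
  have 1: "(\<Prod>b\<in>B. e b) powr (1/n) / G \<le> (\<Sum>b\<in>B. e b / (e b + k) / n)"
  proof -
    have "(\<Prod>b\<in>B. e b) powr (1/n) / G = (\<Prod>b\<in>B. e b / (e b + k)) powr (1/n)"
      using e prodpos unfolding G_def
      by (simp add: prod_dividef powr_divide prod_nonneg)
    also have "\<dots> \<le> (\<Sum>b\<in>B. e b / (e b + k) / n)"
      unfolding n_def using assms pos by (intro arith_geom_mean) (auto intro!: divide_nonneg_pos)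
    finally show ?thesis .
  qed
  have 2: "k / G \<le> (\<Sum>b\<in>B. k / (e b + k) / n)"
  proof -
    have "k = (\<Prod>b\<in>B. k) powr (1/n)" using k n by (simp add: n_def powr_realpow[symmetric] powr_powr)
    then have "k / G = (\<Prod>b\<in>B. k / (e b + k)) powr (1/n)"
      using k prodpos unfolding G_def by (simp add: prod_dividef powr_divide prod_nonneg)
    also have "\<dots> \<le> (\<Sum>b\<in>B. k / (e b + k) / n)"
      unfolding n_def using assms pos by (intro arith_geom_mean) (auto intro!: divide_nonneg_pos)
    finally show ?thesis .
  qed
  have "((\<Prod>b\<in>B. e b) powr (1/n) + k) / G \<le> (\<Sum>b\<in>B. e b / (e b + k) / n + k / (e b + k) / n)"
    using 1 2 by (simp add: add_divide_distrib sum.distrib)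
  also have "\<dots> = (\<Sum>b\<in>B. 1 / n)"
  proof (intro sum.cong refl)
    fix b assume "b \<in> B"
    from pos[OF this] show "e b / (e b + k) / n + k / (e b + k) / n = 1 / n"
      by (metis add_divide_distrib divide_self less_numeral_extra(3))
  qed
  also have "\<dots> = 1" using n by (simp add: n_def)
  finally show ?thesis using G by (simp add: G_def n_def divide_le_eq)
qed

text \<open>The exponent is the reciprocal of the dimension of the hyperplane. The third part is
  used backwards: \<open>Q\<close> is a curvature form from which \<open>k\<close> has been
  subtracted, and adding \<open>k\<close> back bounds its determinant from above.\<close>

lemma tangential_psd_det:
  fixes x :: "real^'n"
  assumes Q: "linear Q" and sym: "\<And>u v. Q u \<bullet> v = u \<bullet> Q v" and Qx: "Q x = 0" and x: "norm x = 1"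
    and psd: "\<And>v. 0 \<le> Q v \<bullet> v" and n: "CARD('n) \<ge> 2"
  shows "0 \<le> det (matrix (\<lambda>v. Q v + (x \<bullet> v) *\<^sub>R x))"
    and "det (matrix (\<lambda>v. Q v + (x \<bullet> v) *\<^sub>R x)) powr (1 / (CARD('n) - 1))
           \<le> (\<Sum>i\<in>UNIV. Q (axis i 1) $ i) / (CARD('n) - 1)"
    and "k \<ge> 0 \<Longrightarrow> det (matrix (\<lambda>v. Q v + (x \<bullet> v) *\<^sub>R x)) powr (1 / (CARD('n) - 1)) + k
           \<le> det (matrix (\<lambda>v. Q v + k *\<^sub>R (v - (x \<bullet> v) *\<^sub>R x) + (x \<bullet> v) *\<^sub>R x)) powr (1 / (CARD('n) - 1))"
    and "(\<And>v. Q v = 0 \<Longrightarrow> x \<bullet> v = 0 \<Longrightarrow> v = 0) \<Longrightarrow> 0 < det (matrix (\<lambda>v. Q v + (x \<bullet> v) *\<^sub>R x))"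
proof -
  obtain B e where B: "finite B" "card B = CARD('n) - 1"
    "\<And>b. b \<in> B \<Longrightarrow> norm b = 1 \<and> x \<bullet> b = 0 \<and> Q b = e b *\<^sub>R b"
    "\<And>s k. det (matrix (\<lambda>v. s *\<^sub>R Q v + k *\<^sub>R (v - (x \<bullet> v) *\<^sub>R x) + (x \<bullet> v) *\<^sub>R x))
        = (\<Prod>b\<in>B. s * e b + k)"
    "(\<Sum>i\<in>UNIV. Q (axis i 1) $ i) = sum e B"
    by (rule tangential_eigenbasis[OF Q sym Qx x]) (rule that; assumption)
  have Bne: "B \<noteq> {}" using B(2) n by auto
  have c: "real (CARD('n) - 1) = card B" using B(2) by simp
  have e: "0 \<le> e b" if "b \<in> B" for b using B(3)[OF that] psd[of b] by (simp add: norm_eq_1)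
  have d0: "det (matrix (\<lambda>v. Q v + (x \<bullet> v) *\<^sub>R x)) = prod e B" using B(4)[of 1 0] by simp
  have dk: "det (matrix (\<lambda>v. Q v + k *\<^sub>R (v - (x \<bullet> v) *\<^sub>R x) + (x \<bullet> v) *\<^sub>R x)) = (\<Prod>b\<in>B. e b + k)"
    using B(4)[of 1 k] by simp
  show "0 \<le> det (matrix (\<lambda>v. Q v + (x \<bullet> v) *\<^sub>R x))" unfolding d0 using e by (simp add: prod_nonneg)
  show "det (matrix (\<lambda>v. Q v + (x \<bullet> v) *\<^sub>R x)) powr (1 / (CARD('n) - 1))
           \<le> (\<Sum>i\<in>UNIV. Q (axis i 1) $ i) / (CARD('n) - 1)"
    unfolding d0 c B(5) using arith_geom_mean[OF B(1) Bne e] by (simp add: sum_divide_distrib)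
  show "k \<ge> 0 \<Longrightarrow> det (matrix (\<lambda>v. Q v + (x \<bullet> v) *\<^sub>R x)) powr (1 / (CARD('n) - 1)) + k
           \<le> det (matrix (\<lambda>v. Q v + k *\<^sub>R (v - (x \<bullet> v) *\<^sub>R x) + (x \<bullet> v) *\<^sub>R x)) powr (1 / (CARD('n) - 1))"
    unfolding d0 c dk by (rule geometric_mean_shift[OF B(1) Bne e])
  assume inj: "\<And>v. Q v = 0 \<Longrightarrow> x \<bullet> v = 0 \<Longrightarrow> v = 0"
  have "e b > 0" if "b \<in> B" for b
  proof -
    have "e b \<noteq> 0" using inj[of b] B(3)[OF that] by auto
    then show ?thesis using e[OF that] by simp
  qed
  then show "0 < det (matrix (\<lambda>v. Q v + (x \<bullet> v) *\<^sub>R x))" unfolding d0 by (simp add: prod_pos)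
qed

lemma tangential_det_scale:
  fixes x :: "real^'n"
  assumes Q: "linear Q" and sym: "\<And>u v. Q u \<bullet> v = u \<bullet> Q v" and Qx: "Q x = 0" and x: "norm x = 1"
  shows "det (matrix (\<lambda>v. s *\<^sub>R Q v + (x \<bullet> v) *\<^sub>R x))
          = s ^ (CARD('n) - 1) * det (matrix (\<lambda>v. Q v + (x \<bullet> v) *\<^sub>R x))"
proof -
  obtain B e where B: "finite B" "card B = CARD('n) - 1"
    "\<And>b. b \<in> B \<Longrightarrow> norm b = 1 \<and> x \<bullet> b = 0 \<and> Q b = e b *\<^sub>R b"
    "\<And>s k. det (matrix (\<lambda>v. s *\<^sub>R Q v + k *\<^sub>R (v - (x \<bullet> v) *\<^sub>R x) + (x \<bullet> v) *\<^sub>R x))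
        = (\<Prod>b\<in>B. s * e b + k)"
    "(\<Sum>i\<in>UNIV. Q (axis i 1) $ i) = sum e B"
    by (rule tangential_eigenbasis[OF Q sym Qx x]) (rule that; assumption)
  show ?thesis using B(4)[of s 0] B(4)[of 1 0] B(2) by (simp add: prod.distrib)
qed

section \<open>Calculus\<close>

lemma has_real_derivative_along_line:
  assumes "(f has_derivative f') (at (z + t *\<^sub>R u))"
  shows "((\<lambda>t. f (z + t *\<^sub>R u)) has_real_derivative f' u) (at t)"
proof -
  have "((\<lambda>t. z + t *\<^sub>R u) has_derivative (\<lambda>s. s *\<^sub>R u)) (at t)"
    by (auto intro!: derivative_eq_intros)
  from has_derivative_compose[OF this assms]
  have "((\<lambda>t. f (z + t *\<^sub>R u)) has_derivative (\<lambda>s. f' (s *\<^sub>R u))) (at t)" .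
  moreover have "f' (s *\<^sub>R u) = f' u * s" for s
    using has_derivative_linear[OF assms] by (simp add: linear_scale mult.commute)
  ultimately show ?thesis by (simp add: has_field_derivative_def)
qed

text \<open>The mean value theorem is applied twice: in direction \<open>u\<close> to the increment
  of \<open>H\<close> across \<open>s *\<^sub>R v\<close>, then in direction \<open>v\<close> to
  \<open>X y \<bullet> u\<close>.\<close>

lemma second_difference_mean_value:
  fixes H :: "'a::euclidean_space \<Rightarrow> real"
  assumes H: "\<And>y. y \<in> U \<Longrightarrow> (H has_derivative (\<lambda>v. X y \<bullet> v)) (at y)"
    and X: "\<And>y. y \<in> U \<Longrightarrow> (X has_derivative W y) (at y)"
    and s: "0 < s" and box: "\<And>a b. 0 \<le> a \<Longrightarrow> a \<le> s \<Longrightarrow> 0 \<le> b \<Longrightarrow> b \<le> s \<Longrightarrow> z + a *\<^sub>R u + b *\<^sub>R v \<in> U"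
  obtains a b where "0 < a" "a < s" "0 < b" "b < s"
    "H (z + s *\<^sub>R u + s *\<^sub>R v) - H (z + s *\<^sub>R u) - H (z + s *\<^sub>R v) + H z
       = s * s * (W (z + a *\<^sub>R u + b *\<^sub>R v) v \<bullet> u)"
proof -
  define \<phi> where "\<phi> t = H ((z + s *\<^sub>R v) + t *\<^sub>R u) - H (z + t *\<^sub>R u)" for t
  have "(\<phi> has_real_derivative (X ((z + s *\<^sub>R v) + t *\<^sub>R u) \<bullet> u - X (z + t *\<^sub>R u) \<bullet> u)) (at t)"
    if "0 \<le> t" "t \<le> s" for t
    unfolding \<phi>_def using that s box[of t s] box[of t 0]
    by (intro DERIV_diff has_real_derivative_along_line H) (auto simp: algebra_simps)
  from MVT2[OF s this] obtain a where a: "0 < a" "a < s"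
    "\<phi> s - \<phi> 0 = s * (X ((z + s *\<^sub>R v) + a *\<^sub>R u) \<bullet> u - X (z + a *\<^sub>R u) \<bullet> u)" by auto
  define \<psi> where "\<psi> t = X ((z + a *\<^sub>R u) + t *\<^sub>R v) \<bullet> u" for t
  have "(\<psi> has_real_derivative (W ((z + a *\<^sub>R u) + t *\<^sub>R v) v \<bullet> u)) (at t)"
    if "0 \<le> t" "t \<le> s" for t
    unfolding \<psi>_def
    by (rule has_real_derivative_along_line[where f = "\<lambda>y. X y \<bullet> u"])
      (auto intro!: derivative_eq_intros X box that a(1) less_imp_le[OF a(2)] simp: a less_imp_le)
  from MVT2[OF s this] obtain b where b: "0 < b" "b < s"
    "\<psi> s - \<psi> 0 = s * (W ((z + a *\<^sub>R u) + b *\<^sub>R v) v \<bullet> u)" by auto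
  have "H (z + s *\<^sub>R u + s *\<^sub>R v) - H (z + s *\<^sub>R u) - H (z + s *\<^sub>R v) + H z = \<phi> s - \<phi> 0"
    by (simp add: \<phi>_def algebra_simps)
  also have "\<dots> = s * (\<psi> s - \<psi> 0)" unfolding a(3) by (simp add: \<psi>_def algebra_simps)
  also have "\<dots> = s * s * (W (z + a *\<^sub>R u + b *\<^sub>R v) v \<bullet> u)" unfolding b(3) by simp
  finally show ?thesis using that a b by blast
qed

text \<open>The mixed second difference is symmetric in \<open>u\<close> and \<open>v\<close>, so
  the two mean values agree; by continuity both are close to the values at \<open>z\<close> on a
  small parallelogram.\<close>

lemma gradient_derivative_symmetric:
  fixes H :: "'a::euclidean_space \<Rightarrow> real"
  assumes U: "open U" "z \<in> U"
    and H: "\<And>y. y \<in> U \<Longrightarrow> (H has_derivative (\<lambda>v. X y \<bullet> v)) (at y)"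
    and X: "\<And>y. y \<in> U \<Longrightarrow> (X has_derivative W y) (at y)"
    and cont: "\<And>v. continuous_on U (\<lambda>y. W y v)"
  shows "W z u \<bullet> v = u \<bullet> W z v"
proof (rule ccontr)
  define d where "d = \<bar>W z u \<bullet> v - W z v \<bullet> u\<bar>"
  assume "W z u \<bullet> v \<noteq> u \<bullet> W z v"
  then have d: "d > 0" by (simp add: d_def inner_commute)
  have "isCont (\<lambda>y. W y u \<bullet> v) z" "isCont (\<lambda>y. W y v \<bullet> u) z"
    using cont[of u] cont[of v] U by (auto intro!: continuous_intros simp: continuous_on_eq_continuous_at)
  then have lim: "((\<lambda>y. W y u \<bullet> v) \<longlongrightarrow> W z u \<bullet> v) (nhds z)" "((\<lambda>y. W y v \<bullet> u) \<longlongrightarrow> W z v \<bullet> u) (nhds z)"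
    unfolding isCont_def by (auto dest: tendsto_at_iff_tendsto_nhds[THEN iffD1])
  have "\<forall>\<^sub>F y in nhds z. \<bar>W y u \<bullet> v - W z u \<bullet> v\<bar> < d/2"
    "\<forall>\<^sub>F y in nhds z. \<bar>W y v \<bullet> u - W z v \<bullet> u\<bar> < d/2"
    using tendstoD[OF lim(1), of "d/2"] tendstoD[OF lim(2), of "d/2"] d by (simp_all add: dist_real_def)
  moreover have "\<forall>\<^sub>F y in nhds z. y \<in> U" using U by (rule eventually_nhds_in_open)
  ultimately have "\<forall>\<^sub>F y in nhds z. y \<in> U \<and> \<bar>W y u \<bullet> v - W z u \<bullet> v\<bar> < d/2 \<and> \<bar>W y v \<bullet> u - W z v \<bullet> u\<bar> < d/2"
    by (simp add: eventually_conj_iff)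
  then obtain r where r: "r > 0" and near: "\<And>y. dist y z < r \<Longrightarrow>
     y \<in> U \<and> \<bar>W y u \<bullet> v - W z u \<bullet> v\<bar> < d/2 \<and> \<bar>W y v \<bullet> u - W z v \<bullet> u\<bar> < d/2"
    by (auto simp: eventually_nhds_metric)
  \<comment> \<open>Parallelograms with sides up to \<open>s *\<^sub>R u\<close> and
    \<open>s *\<^sub>R v\<close> stay within distance \<open>r\<close>; the summand 1 covers
    \<open>u = v = 0\<close>.\<close>
  define s where "s = r / (norm u + norm v + 1)"
  have pos: "norm u + norm v + 1 > 0" by (smt (verit) norm_ge_zero)
  have s: "s > 0" using r pos by (simp add: s_def)
  have box: "dist (z + a *\<^sub>R u + b *\<^sub>R v) z < r" if "0 \<le> a" "a \<le> s" "0 \<le> b" "b \<le> s" for a b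
  proof -
    have "dist (z + a *\<^sub>R u + b *\<^sub>R v) z = norm (a *\<^sub>R u + b *\<^sub>R v)" by (simp add: dist_norm)
    also have "\<dots> \<le> a * norm u + b * norm v" using that by (metis norm_triangle_ineq norm_scaleR abs_of_nonneg)
    also have "\<dots> \<le> s * norm u + s * norm v" using that by (intro add_mono mult_right_mono) auto
    also have "\<dots> < s * (norm u + norm v + 1)" using s by (simp add: algebra_simps)
    also have "\<dots> = r" using pos by (simp add: s_def)
    finally show ?thesis .
  qed
  have box': "z + a *\<^sub>R v + b *\<^sub>R u \<in> U" "z + a *\<^sub>R u + b *\<^sub>R v \<in> U"
    if "0 \<le> a" "a \<le> s" "0 \<le> b" "b \<le> s" for a b
    using near[OF box[of a b]] near[OF box[of b a]] that by (auto simp: add_ac)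
  obtain a b where ab: "0 < a" "a < s" "0 < b" "b < s"
    "H (z + s *\<^sub>R u + s *\<^sub>R v) - H (z + s *\<^sub>R u) - H (z + s *\<^sub>R v) + H z
       = s * s * (W (z + a *\<^sub>R u + b *\<^sub>R v) v \<bullet> u)"
    using second_difference_mean_value[OF H X s box'(2)] by blast
  obtain a' b' where ab': "0 < a'" "a' < s" "0 < b'" "b' < s"
    "H (z + s *\<^sub>R v + s *\<^sub>R u) - H (z + s *\<^sub>R v) - H (z + s *\<^sub>R u) + H z
       = s * s * (W (z + a' *\<^sub>R v + b' *\<^sub>R u) u \<bullet> v)"
    using second_difference_mean_value[OF H X s box'(1)] by blast
  have "s * s * (W (z + a *\<^sub>R u + b *\<^sub>R v) v \<bullet> u) = s * s * (W (z + a' *\<^sub>R v + b' *\<^sub>R u) u \<bullet> v)"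
  proof -
    have eq: "z + s *\<^sub>R u + s *\<^sub>R v = z + s *\<^sub>R v + s *\<^sub>R u" by simp
    show ?thesis using ab(5)[unfolded eq] ab'(5) by linarith
  qed
  then have "W (z + a *\<^sub>R u + b *\<^sub>R v) v \<bullet> u = W (z + a' *\<^sub>R v + b' *\<^sub>R u) u \<bullet> v"
    using s by simp
  moreover have "\<bar>W (z + a *\<^sub>R u + b *\<^sub>R v) v \<bullet> u - W z v \<bullet> u\<bar> < d/2"
    using near[OF box[of a b]] ab by simp
  moreover have "\<bar>W (z + a' *\<^sub>R v + b' *\<^sub>R u) u \<bullet> v - W z u \<bullet> v\<bar> < d/2"
    using near[OF box[of b' a']] ab' by (simp add: add_ac)
  ultimately show False unfolding d_def by (smt (verit) field_sum_of_halves)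
qed

text \<open>Were the form negative at \<open>v\<close>, the slope \<open>G y \<bullet> v\<close>
  would be negative just beyond \<open>x\<close>, and \<open>f\<close> would drop below its
  minimum.\<close>

lemma second_order_minimum:
  fixes f :: "'a::euclidean_space \<Rightarrow> real"
  assumes U: "open U" "x \<in> U" and f: "\<And>y. y \<in> U \<Longrightarrow> (f has_derivative (\<lambda>v. G y \<bullet> v)) (at y)"
    and min: "\<And>y. y \<in> U \<Longrightarrow> f x \<le> f y" and G: "(G has_derivative A) (at x)" and G0: "G x = 0"
  shows "0 \<le> A v \<bullet> v"
proof (rule ccontr)
  assume neg: "\<not> 0 \<le> A v \<bullet> v"
  have "((\<lambda>y. G y \<bullet> v) has_derivative (\<lambda>w. A w \<bullet> v)) (at (x + 0 *\<^sub>R v))"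
    using G by (auto intro!: derivative_eq_intros)
  from has_real_derivative_along_line[OF this]
  have "((\<lambda>t. G (x + t *\<^sub>R v) \<bullet> v) has_real_derivative A v \<bullet> v) (at 0)" .
  from DERIV_neg_dec_right[OF this] neg G0 obtain d where d: "d > 0"
    and dec: "\<And>t. 0 < t \<Longrightarrow> t < d \<Longrightarrow> G (x + t *\<^sub>R v) \<bullet> v < 0" by auto
  have "((\<lambda>t. x + t *\<^sub>R v) \<longlongrightarrow> x) (at 0)" by (auto intro!: tendsto_eq_intros)
  then have "\<forall>\<^sub>F t in at 0. x + t *\<^sub>R v \<in> U" using U by (rule topological_tendstoD)
  then obtain e where e: "e > 0" and inU: "\<And>t. t \<noteq> 0 \<Longrightarrow> \<bar>t\<bar> < e \<Longrightarrow> x + t *\<^sub>R v \<in> U"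
    by (auto simp: eventually_at dist_real_def)
  define s where "s = min d e / 2"
  have s: "0 < s" "s < d" "s < e" using d e by (auto simp: s_def)
  have in': "x + t *\<^sub>R v \<in> U" if "0 \<le> t" "t \<le> s" for t
    using that inU[of t] s U by (cases "t = 0") auto
  have "((\<lambda>t. f (x + t *\<^sub>R v)) has_real_derivative G (x + t *\<^sub>R v) \<bullet> v) (at t)" if "0 \<le> t" "t \<le> s" for t
    by (intro has_real_derivative_along_line f in' that)
  from MVT2[OF s(1) this] obtain t where t: "0 < t" "t < s"
    "f (x + s *\<^sub>R v) - f (x + 0 *\<^sub>R v) = (s - 0) * (G (x + t *\<^sub>R v) \<bullet> v)" by auto
  have "s * (G (x + t *\<^sub>R v) \<bullet> v) < 0" using dec[of t] t s by (simp add: mult_pos_neg)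
  then have "f (x + s *\<^sub>R v) < f x" using t by simp
  then show False using min[OF in'[of s]] s by simp
qed

section \<open>Integrals over the punctured ball\<close>

lemma bounded_continuous_absolutely_integrable:
  fixes f :: "'a::euclidean_space \<Rightarrow> real"
  assumes S: "S \<in> lmeasurable" and f: "continuous_on S f" and bd: "\<And>z. z \<in> S \<Longrightarrow> \<bar>f z\<bar> \<le> M"
  shows "f absolutely_integrable_on S"
proof (rule measurable_bounded_by_integrable_imp_absolutely_integrable)
  show "f \<in> borel_measurable (lebesgue_on S)"
    using S f by (intro continuous_imp_measurable_on_sets_lebesgue) auto
  show "(\<lambda>_. M) integrable_on S" using S by (rule integrable_on_const)
qed (use S bd in auto)

lemma zero_homogeneous_bounded:
  fixes f :: "'a::euclidean_space \<Rightarrow> 'b::real_normed_vector"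
  assumes "continuous_on (-{0}) f" and hom: "\<And>z. z \<noteq> 0 \<Longrightarrow> f z = f (sgn z)"
  obtains M where "\<And>z. z \<noteq> 0 \<Longrightarrow> norm (f z) \<le> M"
proof -
  have "compact (f ` sphere 0 1)"
    using assms(1) by (intro compact_continuous_image) (auto intro: continuous_on_subset)
  then obtain M where M: "\<And>y. y \<in> f ` sphere 0 1 \<Longrightarrow> norm y \<le> M"
    using compact_imp_bounded bounded_iff by metis
  have "norm (f z) \<le> M" if "z \<noteq> 0" for z
    unfolding hom[OF that] using that by (intro M imageI) (simp add: norm_sgn)
  then show ?thesis using that by blast
qed

lemma nonneg_integral_zero_imp_zero:
  fixes f :: "'a::euclidean_space \<Rightarrow> real"
  assumes U: "open U" and f: "continuous_on U f" "f integrable_on U" and nn: "\<And>z. z \<in> U \<Longrightarrow> 0 \<le> f z"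
    and int: "integral U f \<le> 0" and z: "z \<in> U"
  shows "f z = 0"
proof -
  obtain a b where ab: "cbox a b \<subseteq> U" "z \<in> box a b"
    using open_contains_cbox[OF U z] by metis
  have fab: "f integrable_on cbox a b" using f(2) ab(1) by (rule integrable_on_subcbox)
  have "integral (cbox a b) f \<le> integral U f"
    using ab fab f nn by (intro integral_subset_le) auto
  moreover have "0 \<le> integral (cbox a b) f"
    using fab nn ab by (intro integral_nonneg) auto
  ultimately have "(f has_integral 0) (cbox a b)"
    using fab int by (metis integrable_integral order_antisym order_trans)
  then show ?thesis
    using ab nn box_subset_cbox[of a b] f(1)
    by (intro has_integral_0_cbox_imp_0[of a b f z]) (auto intro: continuous_on_subset)
qed

text \<open>The integral of \<open>F\<close> composed with a rotation does not depend on the angle,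
  so the difference quotients at angle 0 have integral 0. The mean value theorem bounds them by
  \<open>M\<close>, and dominated convergence passes to the derivative along the rotation
  field.\<close>

lemma integral_rotation_derivative:
  fixes F :: "(real^'m::{finite,wellorder}) \<Rightarrow> real"
  assumes F: "\<And>z. z \<noteq> 0 \<Longrightarrow> (F has_derivative F' z) (at z)"
    and bdF: "\<And>z. z \<noteq> 0 \<Longrightarrow> \<bar>F z\<bar> \<le> M"
    and bdF': "\<And>z. z \<noteq> 0 \<Longrightarrow> \<bar>F' z (z $ i *\<^sub>R axis j 1 - z $ j *\<^sub>R axis i 1)\<bar> \<le> M"
  shows "((\<lambda>z. F' z (z $ i *\<^sub>R axis j 1 - z $ j *\<^sub>R axis i 1)) has_integral 0) (ball 0 1 - {0})"
proof (cases "i = j")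
  case True
  have "((\<lambda>z. F' z (z $ i *\<^sub>R axis j 1 - z $ j *\<^sub>R axis i 1)) has_integral 0) (ball 0 1 - {0}) \<longleftrightarrow>
        ((\<lambda>z::real^'m::_. 0::real) has_integral 0) (ball 0 1 - {0})"
    using True linear_0[OF has_derivative_linear[OF F]] by (intro has_integral_cong) auto
  then show ?thesis by simp
next
  case False
  define D :: "(real^'m::_) set" where "D = ball 0 1 - {0}"
  define J :: "(real^'m::_) \<Rightarrow> real^'m::_" where "J z = z $ i *\<^sub>R axis j 1 - z $ j *\<^sub>R axis i 1" for z
  define P :: "(real^'m::_) \<Rightarrow> real^'m::_" where "P z = z $ i *\<^sub>R axis i 1 + z $ j *\<^sub>R axis j 1" for z
  \<comment> \<open>\<open>R t\<close> is the exponential of \<open>t J\<close>: on the plane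
    spanned by the two axes \<open>J\<close> squares to minus the identity, and \<open>P\<close> is
    the projection to that plane.\<close>
  define R :: "real \<Rightarrow> (real^'m::_) \<Rightarrow> real^'m::_" where "R t z = z + (cos t - 1) *\<^sub>R P z + sin t *\<^sub>R J z" for t z
  have linJ: "linear J" and linP: "linear P"
    unfolding J_def P_def by (auto intro!: linearI simp: algebra_simps)
  have PJ: "J (P z) = J z" "P (J z) = J z" "J (J z) = - P z" "P (P z) = P z" for z
    using False by (auto simp: J_def P_def vec_eq_iff axis_def)
  have linR: "linear (R t)" for t
    unfolding R_def by (intro linearI) (auto simp: linear_add[OF linJ] linear_add[OF linP]
      linear_scale[OF linJ] linear_scale[OF linP] algebra_simps)
  have JR: "J (R t z) = - sin t *\<^sub>R P z + cos t *\<^sub>R J z" for t z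
    by (simp add: R_def linear_add[OF linJ] linear_diff[OF linJ] linear_scale[OF linJ] PJ algebra_simps)
  have PR: "P (R t z) = cos t *\<^sub>R P z + sin t *\<^sub>R J z" for t z
    by (simp add: R_def linear_add[OF linP] linear_diff[OF linP] linear_scale[OF linP] PJ algebra_simps)
  have RR: "R (- t) (R t z) = z" for t z
  proof -
    have "R (- t) (R t z) = R t z + (cos t - 1) *\<^sub>R P (R t z) - sin t *\<^sub>R J (R t z)"
      by (simp add: R_def[of "-t"])
    also have "\<dots> = z + (cos t * cos t + sin t * sin t - 1) *\<^sub>R P z"
      unfolding JR PR by (simp add: R_def algebra_simps del: sin_cos_squared_add3)
    finally show ?thesis by simp
  qed
  have normR: "norm (R t z) = norm z" for t z
  proof -
    define p where "p = (z $ i)^2 + (z $ j)^2"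
    have in1: "z \<bullet> P z = p" "P z \<bullet> P z = p" "J z \<bullet> J z = p" "z \<bullet> J z = 0" "P z \<bullet> J z = 0"
      using False by (auto simp: P_def J_def p_def inner_add_left inner_add_right inner_diff_left inner_diff_right
          inner_axis inner_axis' inner_axis_axis power2_eq_square) (auto simp: axis_def)
    have "R t z \<bullet> R t z = z \<bullet> z + 2 * (cos t - 1) * p + (cos t - 1)^2 * p + (sin t)^2 * p"
      unfolding R_def using in1
      by (simp add: inner_add_left inner_add_right inner_commute[of "P z" z] inner_commute[of "J z" z]
           inner_commute[of "J z" "P z"] power2_eq_square algebra_simps)
    also have "\<dots> = z \<bullet> z + ((cos t)^2 + (sin t)^2 - 1) * p"
      by (simp add: power2_eq_square algebra_simps del: sin_cos_squared_add3 sin_cos_squared_add2)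
    finally show ?thesis by (simp add: norm_eq)
  qed
  have RD: "R t z \<in> D" if "z \<in> D" for t z
    using that normR[of t z] by (auto simp: D_def dist_norm)
  have Rnz: "R t z \<noteq> 0" if "z \<noteq> 0" for t z using that normR[of t z] by auto
  have detR: "\<bar>det (matrix (R t))\<bar> = 1" for t
    by (intro orthogonal_transformation_det) (simp add: orthogonal_transformation linR normR)
  have lmD: "D \<in> lmeasurable" unfolding D_def by (intro lmeasurable_open bounded_diff bounded_ball open_Diff) auto
  have intF: "F absolutely_integrable_on D"
  proof (rule bounded_continuous_absolutely_integrable[OF lmD])
    have "F differentiable at z" if "z \<noteq> 0" for z using F[OF that] by (auto simp: differentiable_def)
    then show "continuous_on D F"
      by (intro differentiable_imp_continuous_on differentiable_at_imp_differentiable_on) (auto simp: D_def)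
  qed (use bdF in \<open>auto simp: D_def\<close>)
  have invar: "(\<lambda>z. F (R t z)) absolutely_integrable_on D \<and> integral D (\<lambda>z. F (R t z)) = integral D F" for t
    using cov_invertible_real[of D "R t" "\<lambda>_. R t" D "R (-t)" "\<lambda>_. R (-t)" F "integral D F"]
      linear_imp_has_derivative[OF linR] RD RR RR[of "-t"] intF
    by (auto simp: detR fun_eq_iff)
  \<comment> \<open>Difference quotients along the angles \<open>1 / Suc k\<close>, a sequence to
    which dominated convergence applies.\<close>
  define q where "q k z = (F (R (1 / real (Suc k)) z) - F z) * real (Suc k)" for k z
  have der: "((\<lambda>t. F (R t z)) has_real_derivative F' (R t z) (J (R t z))) (at t)" if "z \<noteq> 0" for t z
  proof -
    have "((\<lambda>t. R t z) has_derivative (\<lambda>s. s *\<^sub>R J (R t z))) (at t)"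
      unfolding R_def[of _ z] JR[of t z, unfolded R_def]
      by (auto intro!: derivative_eq_intros simp: algebra_simps)
    from has_derivative_compose[OF this F[OF Rnz[OF that]]]
    have "((\<lambda>t. F (R t z)) has_derivative (\<lambda>s. F' (R t z) (s *\<^sub>R J (R t z)))) (at t)" .
    moreover have "F' (R t z) (s *\<^sub>R w) = F' (R t z) w * s" for s w
      using has_derivative_linear[OF F[OF Rnz[OF that]]] by (simp add: linear_scale mult.commute)
    ultimately show ?thesis by (simp add: has_field_derivative_def)
  qed
  have R0: "R 0 z = z" for z by (simp add: R_def)
  have qint: "q k integrable_on D" and q0: "integral D (q k) = 0" for k
    unfolding q_def using invar[of "1 / real (Suc k)"] intF
    by (auto simp: integral_diff absolutely_integrable_on_def intro!: integrable_diff)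
  have qbd: "norm (q k z) \<le> M" if "z \<in> D" for k z
  proof -
    have z: "z \<noteq> 0" using that by (simp add: D_def)
    define s where "s = 1 / real (Suc k)"
    have s: "0 < s" by (simp add: s_def)
    from MVT2[OF s der[OF z]] obtain t where t: "F (R s z) - F (R 0 z) = s * F' (R t z) (J (R t z))" by auto
    have "q k z = F' (R t z) (J (R t z))" using t s by (simp add: q_def R0 s_def)
    then show ?thesis using bdF'[OF Rnz[OF z]] by (simp add: J_def)
  qed
  have qlim: "(\<lambda>k. q k z) \<longlonglongrightarrow> F' z (J z)" if "z \<in> D" for z
  proof -
    have z: "z \<noteq> 0" using that by (simp add: D_def)
    have "((\<lambda>t. (F (R t z) - F z) / t) \<longlongrightarrow> F' z (J z)) (at 0)"
      using der[OF z, of 0] by (simp add: DERIV_def R0)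
    moreover have "filterlim (\<lambda>k. 1 / real (Suc k)) (at 0) sequentially"
      unfolding filterlim_at using LIMSEQ_inverse_real_of_nat by (auto simp: inverse_eq_divide)
    ultimately show ?thesis unfolding q_def
      by (auto dest: filterlim_compose)
  qed
  have "(\<lambda>z. F' z (J z)) integrable_on D" "(\<lambda>k. integral D (q k)) \<longlonglongrightarrow> integral D (\<lambda>z. F' z (J z))"
    using dominated_convergence[OF qint integrable_on_const[OF lmD, of M] qbd qlim] by auto
  then have "((\<lambda>z. F' z (J z)) has_integral 0) D"
    unfolding q0 by (metis LIMSEQ_const_iff integrable_integral)
  then show ?thesis by (simp add: D_def J_def)
qed

lemma has_derivative_norm_sgn:
  fixes z :: "'a::real_inner"
  shows "z \<noteq> 0 \<Longrightarrow> (norm has_derivative (\<lambda>v. sgn z \<bullet> v)) (at z)"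
  using has_derivative_norm[of z] by (simp add: inner_commute)

lemma has_derivative_sgn:
  fixes z :: "'a::real_inner"
  assumes "z \<noteq> 0"
  shows "(sgn has_derivative (\<lambda>v. (v - (sgn z \<bullet> v) *\<^sub>R sgn z) /\<^sub>R norm z)) (at z)"
proof -
  have "((\<lambda>y. y /\<^sub>R norm y) has_derivative (\<lambda>v. (v - (sgn z \<bullet> v) *\<^sub>R sgn z) /\<^sub>R norm z)) (at z)"
    using assms
    by (auto intro!: derivative_eq_intros has_derivative_norm_sgn
        simp: sgn_div_norm algebra_simps power2_eq_square fun_eq_iff divide_simps)
  then show ?thesis by (simp add: sgn_div_norm[abs_def])
qed

section \<open>The inverse Gauss map\<close>

text \<open>\<open>X\<close> is the 0-homogeneous extension of the inverse Gauss map, that is the Euclidean gradient of the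
  1-homogeneous support function \<open>H z = X z \<bullet> z\<close>, and \<open>W\<close> is its derivative.  For a unit vector \<open>x\<close>,
  \<open>W x\<close> vanishes on \<open>x\<close> and equals \<open>\<nabla>\<^sup>2h + g h\<close> on the tangent space.  The functions \<open>h\<close>
  and \<open>S\<close> below are the 0-homogeneous extensions of the support function and of the reciprocal curvature.\<close>

locale gauss_inverse =
  fixes C :: "(real^'m) set" and X :: "real^'m \<Rightarrow> real^'m" and W :: "real^'m \<Rightarrow> real^'m \<Rightarrow> real^'m"
  assumes dim2: "CARD('m) \<ge> 2" and compact_C: "compact C" and convex_C: "convex C" and interior_C: "interior C \<noteq> {}"
    and X_mem: "\<And>z. z \<noteq> 0 \<Longrightarrow> X z \<in> C"
    and support: "\<And>z y. z \<noteq> 0 \<Longrightarrow> y \<in> C \<Longrightarrow> y \<bullet> z \<le> X z \<bullet> z"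
    and X_scale: "\<And>t z. t > 0 \<Longrightarrow> z \<noteq> 0 \<Longrightarrow> X (t *\<^sub>R z) = X z"
    and X_inj: "\<And>x y. norm x = 1 \<Longrightarrow> norm y = 1 \<Longrightarrow> X x = X y \<Longrightarrow> x = y"
    and frontier_C: "frontier C = X ` sphere 0 1"
    and X_deriv: "\<And>z. z \<noteq> 0 \<Longrightarrow> (X has_derivative W z) (at z)"
    and W_cont: "\<And>v. continuous_on (-{0}) (\<lambda>z. W z v)"
    and W_ker1: "\<And>x v. norm x = 1 \<Longrightarrow> W x v = 0 \<Longrightarrow> x \<bullet> v = 0 \<Longrightarrow> v = 0"
begin

definition h where "h z = X z \<bullet> sgn z"

definition h_grad where "h_grad z = (X z - h z *\<^sub>R sgn z) /\<^sub>R norm z"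

text \<open>\<open>W\<close> is homogeneous of degree -1, which the factor \<open>norm z\<close>
  compensates; the rank-one term acts as the identity on the normal line.\<close>

definition S where "S z = det (matrix (\<lambda>v. norm z *\<^sub>R W z v + (sgn z \<bullet> v) *\<^sub>R sgn z))"

section \<open>Homogeneity, symmetry and semidefiniteness of the Hessian\<close>

lemma X_sgn: "z \<noteq> 0 \<Longrightarrow> X (sgn z) = X z"
  by (simp add: sgn_div_norm X_scale)

lemma W_lin: "z \<noteq> 0 \<Longrightarrow> linear (W z)"
  using X_deriv has_derivative_linear by blast

lemma W_scale:
  assumes "t > 0" "z \<noteq> 0" shows "W (t *\<^sub>R z) v = W z v /\<^sub>R t"
proof -
  have "((\<lambda>y. t *\<^sub>R y) has_derivative (\<lambda>v. t *\<^sub>R v)) (at z)" by (auto intro!: derivative_eq_intros)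
  from has_derivative_compose[OF this X_deriv]
  have "((\<lambda>y. X (t *\<^sub>R y)) has_derivative (\<lambda>v. W (t *\<^sub>R z) (t *\<^sub>R v))) (at z)" using assms by simp
  moreover have "((\<lambda>y. X (t *\<^sub>R y)) has_derivative W z) (at z)"
    by (rule has_derivative_transform_within_open[OF X_deriv[OF assms(2)], of "-{0}"])
      (use assms X_scale in auto)
  ultimately have "W z = (\<lambda>v. W (t *\<^sub>R z) (t *\<^sub>R v))" using has_derivative_unique by blast
  then have "W z v = t *\<^sub>R W (t *\<^sub>R z) v"
    using linear_scale[OF W_lin[of "t *\<^sub>R z"]] assms by (metis less_irrefl scaleR_eq_0_iff)
  then show ?thesis using assms by simp
qed

lemma W_sgn: "z \<noteq> 0 \<Longrightarrow> W (sgn z) v = norm z *\<^sub>R W z v"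
  using W_scale[of "inverse (norm z)" z v] by (simp add: sgn_div_norm)

text \<open>Among all points \<open>X y\<close>, the one with normal \<open>z\<close> is highest in
  direction \<open>z\<close>, so the derivative of this height vanishes there.\<close>

lemma W_perp: assumes "z \<noteq> 0" shows "W z v \<bullet> z = 0"
proof -
  have "((\<lambda>y. X y \<bullet> z) has_derivative (\<lambda>v. W z v \<bullet> z)) (at z)"
    using X_deriv[OF assms] by (auto intro!: derivative_eq_intros)
  then have "(\<lambda>v. W z v \<bullet> z) = (\<lambda>v. 0)"
    using assms X_mem support by (intro differential_zero_maxmin[of z "-{0}"]) auto
  then show ?thesis by metis
qed

lemma W_radial: assumes "z \<noteq> 0" shows "W z z = 0"
proof -
  have "((\<lambda>t. X (z + t *\<^sub>R z) \<bullet> w) has_real_derivative (W z z \<bullet> w)) (at 0)" for w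
    by (rule has_real_derivative_along_line[where f = "\<lambda>y. X y \<bullet> w"])
      (use X_deriv[OF assms] in \<open>auto intro!: derivative_eq_intros\<close>)
  moreover have "((\<lambda>t. X (z + t *\<^sub>R z) \<bullet> w) has_real_derivative 0) (at 0)" for w
  proof (rule DERIV_cong_ev[THEN iffD2, OF refl _ refl])
    have "\<forall>\<^sub>F t in nhds (0::real). t \<in> {-1<..<1}" by (intro eventually_nhds_in_open) auto
    then show "\<forall>\<^sub>F t in nhds 0. X (z + t *\<^sub>R z) \<bullet> w = X z \<bullet> w"
    proof eventually_elim
      case (elim t)
      then show ?case using X_scale[of "1 + t" z] assms by (simp add: algebra_simps)
    qed
  qed simp
  ultimately have "W z z \<bullet> w = 0" for w using DERIV_unique by blast
  then show ?thesis by (metis inner_eq_zero_iff)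
qed

text \<open>The second term of the product rule vanishes by \<open>W_perp\<close>; this is why
  \<open>X\<close> is the gradient of \<open>H\<close>.\<close>

lemma H_deriv:
  assumes "z \<noteq> 0" shows "((\<lambda>y. X y \<bullet> y) has_derivative (\<lambda>v. X z \<bullet> v)) (at z)"
  using X_deriv[OF assms] W_perp[OF assms] by (auto intro!: derivative_eq_intros)

lemma W_sym: "z \<noteq> 0 \<Longrightarrow> W z u \<bullet> v = u \<bullet> W z v"
  using gradient_derivative_symmetric[of "-{0}" z "\<lambda>y. X y \<bullet> y" X W u v] H_deriv X_deriv W_cont by auto

text \<open>The point \<open>X z\<close> lies in \<open>C\<close>, so \<open>H\<close> dominates the
  linear function \<open>y \<mapsto> X z \<bullet> y\<close>, with equality at
  \<open>z\<close>.\<close>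

lemma W_psd: assumes "z \<noteq> 0" shows "0 \<le> W z v \<bullet> v"
proof (rule second_order_minimum[of "-{0}" z "\<lambda>y. X y \<bullet> y - X z \<bullet> y" "\<lambda>y. X y - X z"])
  fix y assume "y \<in> -{0::real^'m}"
  then show "((\<lambda>y. X y \<bullet> y - X z \<bullet> y) has_derivative (\<lambda>v. (X y - X z) \<bullet> v)) (at y)"
    using has_derivative_diff[OF H_deriv[of y] has_derivative_inner_right[OF has_derivative_ident, of "X z"]]
    by (simp add: inner_diff_left)
  show "X z \<bullet> z - X z \<bullet> z \<le> X y \<bullet> y - X z \<bullet> y" using support[of y "X z"] X_mem[of z] assms \<open>y \<in> -{0}\<close> by simp
next
  show "((\<lambda>y. X y - X z) has_derivative W z) (at z)"
    using X_deriv[OF assms] by (auto intro!: derivative_eq_intros)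
qed (use assms in auto)

lemma W_ker: "z \<noteq> 0 \<Longrightarrow> W z v = 0 \<Longrightarrow> z \<bullet> v = 0 \<Longrightarrow> v = 0"
  using W_ker1[of "sgn z" v] W_sgn[of z v] by (simp add: norm_sgn sgn_div_norm)

text \<open>A semidefinite form has no null vectors outside its kernel: moving \<open>v\<close>
  against \<open>W z v\<close> would make the form negative to first order. The step
  \<open>a / (b + 1)\<close> is short enough for the quadratic term.\<close>

lemma W_psd_ker: assumes "z \<noteq> 0" "W z v \<bullet> v = 0" shows "W z v = 0"
proof (rule ccontr)
  assume nz: "W z v \<noteq> 0"
  define w where "w = W z v"
  define a where "a = w \<bullet> w"
  define b where "b = W z w \<bullet> w"
  have a: "a > 0" using nz by (simp add: a_def w_def)
  have b: "b \<ge> 0" using W_psd[OF assms(1)] by (simp add: b_def)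
  have "0 \<le> W z (v + t *\<^sub>R w) \<bullet> (v + t *\<^sub>R w)" for t by (rule W_psd[OF assms(1)])
  then have *: "0 \<le> 2 * t * a + t^2 * b" for t
    using assms(2) W_sym[OF assms(1), of w v] linear_add[OF W_lin[OF assms(1)]] linear_scale[OF W_lin[OF assms(1)]]
    by (simp add: a_def b_def w_def[symmetric] inner_add_left inner_add_right power2_eq_square inner_commute algebra_simps)
  have "2 * (- a / (b + 1)) * a + (- a / (b + 1))^2 * b = - (a^2 * (b + 2)) / (b + 1)^2"
    using b by (simp add: power2_eq_square divide_simps) (simp add: algebra_simps)
  also have "\<dots> < 0" using a b by (intro divide_neg_pos) auto
  finally show False using *[of "- a / (b + 1)"] by linarith
qed

lemma h_deriv:
  assumes z: "z \<noteq> 0" shows "(h has_derivative (\<lambda>v. h_grad z \<bullet> v)) (at z)"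
proof -
  have "W z v \<bullet> sgn z = 0" for v using W_perp[OF z, of v] by (simp add: sgn_div_norm)
  then have "((\<lambda>y. X y \<bullet> sgn y) has_derivative (\<lambda>v. h_grad z \<bullet> v)) (at z)"
    using X_deriv[OF z] has_derivative_sgn[OF z]
    by (auto intro!: derivative_eq_intros simp: h_grad_def h_def fun_eq_iff inner_diff_left inner_diff_right algebra_simps)
  then show ?thesis by (simp add: h_def[abs_def])
qed

lemma h_sgn: "z \<noteq> 0 \<Longrightarrow> h (sgn z) = h z"
  by (simp add: h_def X_sgn sgn_div_norm[of "sgn z"] norm_sgn)

text \<open>The numerator is the squared length of the tangential part of \<open>X z\<close>, that
  is \<open>|\<nabla>h|\<^sup>2\<close> on the sphere.\<close>

lemma h_grad_X: "z \<noteq> 0 \<Longrightarrow> h_grad z \<bullet> X z = ((norm (X z))\<^sup>2 - (h z)\<^sup>2) / norm z"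
  unfolding power2_norm_eq_inner
  by (simp add: h_grad_def h_def inner_diff_left inner_diff_right inner_commute divide_simps power2_eq_square)

lemma h_le_norm_X: "z \<noteq> 0 \<Longrightarrow> (h z)\<^sup>2 \<le> (norm (X z))\<^sup>2"
  using Cauchy_Schwarz_ineq2[of "X z" "sgn z"] by (simp add: h_def norm_sgn abs_le_square_iff[symmetric])

lemma h_grad_radial: "z \<noteq> 0 \<Longrightarrow> h_grad z \<bullet> z = 0"
  by (simp add: h_grad_def h_def inner_diff_left sgn_div_norm dot_square_norm power2_eq_square divide_simps)

lemma S_sgn: "z \<noteq> 0 \<Longrightarrow> S z = det (matrix (\<lambda>v. W (sgn z) v + (sgn z \<bullet> v) *\<^sub>R sgn z))"
  by (simp add: S_def W_sgn)

lemma S_pos: assumes "z \<noteq> 0" shows "S z > 0"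
proof -
  have x: "norm (sgn z) = 1" "sgn z \<noteq> 0" using assms by (auto simp: norm_sgn sgn_zero_iff)
  show ?thesis unfolding S_sgn[OF assms]
    by (rule tangential_psd_det(4)[OF W_lin[OF x(2)] W_sym[OF x(2)] W_radial[OF x(2)] x(1)
      W_psd[OF x(2)] dim2 W_ker1[OF x(1)]])
qed

lemma X_cont: "continuous_on (-{0}) X"
  by (intro continuous_at_imp_continuous_on ballI has_derivative_continuous[OF X_deriv]) simp

lemma h_cont: "continuous_on (-{0}) h"
  by (intro continuous_at_imp_continuous_on ballI has_derivative_continuous[OF h_deriv]) simp

lemma sgn_cont: "continuous_on (-{0::real^'m}) sgn"
  by (auto intro!: continuous_intros simp: sgn_div_norm[abs_def])

text \<open>\<open>W_cont\<close> concerns a fixed vector; an expansion in coordinates lets the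
  vector vary with the point.\<close>

lemma W_cont_comp:
  assumes "continuous_on (-{0}) f"
  shows "continuous_on (-{0}) (\<lambda>z. W z (f z))"
proof -
  have "W z (f z) = (\<Sum>i\<in>UNIV. f z $ i *\<^sub>R W z (axis i 1))" if "z \<in> -{0}" for z
  proof -
    have "W z (f z) = W z (\<Sum>i\<in>UNIV. f z $ i *\<^sub>R axis i 1)"
      using basis_expansion[of "f z"] by (simp add: scalar_mult_eq_scaleR)
    also have "\<dots> = (\<Sum>i\<in>UNIV. f z $ i *\<^sub>R W z (axis i 1))"
      using that by (simp add: linear_sum[OF W_lin] linear_scale[OF W_lin])
    finally show ?thesis .
  qed
  moreover have "continuous_on (-{0}) (\<lambda>z. \<Sum>i\<in>UNIV. f z $ i *\<^sub>R W z (axis i 1))"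
    using assms W_cont by (intro continuous_intros)
  ultimately show ?thesis by (subst continuous_on_cong[OF refl]) auto
qed

end

text \<open>Lagrange's identity, with each coordinate plane counted twice. It turns a sum of
  products of rotation derivatives into the inner product of two gradients.\<close>

lemma sum_lagrange_identity:
  fixes a b d :: "real^'n"
  shows "(\<Sum>i\<in>UNIV. \<Sum>j\<in>UNIV. (a $ i * b $ j - a $ j * b $ i) * (a $ i * d $ j - a $ j * d $ i))
    = 2 * ((a \<bullet> a) * (b \<bullet> d) - (a \<bullet> b) * (a \<bullet> d))"
proof -
  have 1: "(\<Sum>i\<in>UNIV. \<Sum>j\<in>UNIV. (p $ i * q $ i) * (r $ j * s $ j)) = (p \<bullet> q) * (r \<bullet> s)"
    for p q r s :: "real^'n"
    by (simp add: inner_vec_def sum_product)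
  have 2: "(\<Sum>i\<in>UNIV. \<Sum>j\<in>UNIV. (p $ j * q $ j) * (r $ i * s $ i)) = (p \<bullet> q) * (r \<bullet> s)"
    for p q r s :: "real^'n"
    by (subst sum.swap) (rule 1)
  have "(\<Sum>i\<in>UNIV. \<Sum>j\<in>UNIV. (a $ i * b $ j - a $ j * b $ i) * (a $ i * d $ j - a $ j * d $ i))
    = (\<Sum>i\<in>UNIV. \<Sum>j\<in>UNIV. (a $ i * a $ i) * (b $ j * d $ j) + (a $ j * a $ j) * (b $ i * d $ i)
        - (a $ i * d $ i) * (a $ j * b $ j) - (a $ i * b $ i) * (a $ j * d $ j))"
    by (intro sum.cong refl) (simp add: algebra_simps)
  also have "\<dots> = 2 * ((a \<bullet> a) * (b \<bullet> d) - (a \<bullet> b) * (a \<bullet> d))"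
    by (simp only: sum.distrib sum_subtractf 1 2) (simp add: algebra_simps)
  finally show ?thesis .
qed

section \<open>The isotropic curvature equation\<close>

text \<open>The function \<open>g\<close> stands for the power with exponent \<open>p - 1\<close> in
  (i) and for the constant 1 in (ii); positive values and a nonnegative derivative on the range of
  \<open>h\<close> treat both at once. The equation is solved for the reciprocal curvature
  \<open>S\<close>.\<close>

locale gauss_curvature_eq = gauss_inverse C X W
  for C :: "(real^'m::{finite,wellorder}) set" and X W +
  fixes g g' :: "real \<Rightarrow> real" and c :: real
  assumes g_deriv: "\<And>x. norm x = 1 \<Longrightarrow> (g has_real_derivative g' (h x)) (at (h x))"
    and g_pos: "\<And>x. norm x = 1 \<Longrightarrow> g (h x) > 0"
    and g'_nonneg: "\<And>x. norm x = 1 \<Longrightarrow> g' (h x) \<ge> 0"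
    and g'_cont: "continuous_on (h ` sphere 0 1) g'"
    and curvature_eq: "\<And>x. norm x = 1 \<Longrightarrow> S x = g (h x) * exp ((norm (X x))\<^sup>2 / 2) / c"
begin

abbreviation D where "D \<equiv> ball 0 1 - {0::real^'m::_}"

definition n where "n = CARD('m) - 1"

text \<open>Logarithmic differentiation of the curvature equation; by symmetry of
  \<open>W z\<close>, half the squared norm of \<open>X\<close> has gradient
  \<open>W z (X z)\<close>.\<close>

definition S_grad where "S_grad z = S z *\<^sub>R ((g' (h z) / g (h z)) *\<^sub>R h_grad z + W z (X z))"

text \<open>The geometric mean of the principal radii of curvature.\<close>

definition rho where "rho z = S z powr (1 / n)"

definition rho_grad where "rho_grad z = (rho z / (n * S z)) *\<^sub>R S_grad z"

section \<open>Differentiating the reciprocal curvature and its root\<close>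

lemma n_pos: "n > 0" using dim2 by (simp add: n_def)

lemma unit: "z \<noteq> 0 \<Longrightarrow> norm (sgn z) = 1" "z \<noteq> 0 \<Longrightarrow> sgn z \<bullet> sgn z = 1" for z :: "real^'m::_"
  by (auto simp: norm_sgn norm_eq_1[symmetric])

lemma S_sgn': "z \<noteq> 0 \<Longrightarrow> S (sgn z) = S z"
  using S_sgn[of z] S_sgn[of "sgn z"] by (simp add: sgn_zero_iff sgn_div_norm[of "sgn z"] norm_sgn)

lemma g_at: assumes "z \<noteq> 0"
  shows "(g has_real_derivative g' (h z)) (at (h z))" "g (h z) > 0" "g' (h z) \<ge> 0"
    "S z = g (h z) * exp ((norm (X z))\<^sup>2 / 2) / c"
  using g_deriv[OF unit(1)] g_pos[OF unit(1)] g'_nonneg[OF unit(1)] curvature_eq[OF unit(1)] assms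
  by (auto simp: h_sgn S_sgn' X_sgn)

lemma S_deriv: assumes z: "z \<noteq> 0" shows "(S has_derivative (\<lambda>v. S_grad z \<bullet> v)) (at z)"
proof -
  have gh: "((\<lambda>y. g (h y)) has_derivative (\<lambda>v. g' (h z) * (h_grad z \<bullet> v))) (at z)"
    using has_derivative_compose[OF h_deriv[OF z] g_at(1)[OF z, unfolded has_field_derivative_def]] by simp
  have "((\<lambda>y. g (h y) * exp ((X y \<bullet> X y) / 2) / c) has_derivative (\<lambda>v. S_grad z \<bullet> v)) (at z)"
  proof -
    have c: "c \<noteq> 0" using S_pos[OF z] g_at(4)[OF z] by auto
    have expand: "S_grad z \<bullet> v = S z * (g' (h z) / g (h z) * (h_grad z \<bullet> v) + W z (X z) \<bullet> v)" for v
      by (simp add: S_grad_def inner_add_left)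
    have wx: "X z \<bullet> W z v = W z (X z) \<bullet> v" "W z v \<bullet> X z = W z (X z) \<bullet> v" for v
      using W_sym[OF z, of "X z" v] by (simp_all add: inner_commute)
    show ?thesis
      using g_at(2)[OF z] c
      by (auto intro!: derivative_eq_intros gh X_deriv[OF z] simp: fun_eq_iff expand wx g_at(4)[OF z]
        power2_norm_eq_inner) (simp add: field_simps)
  qed
  note f = this
  show ?thesis
    by (rule has_derivative_transform_within_open[OF f, of "-{0}"])
      (use z g_at(4) in \<open>auto simp: power2_norm_eq_inner\<close>)
qed

lemma S_cont: "continuous_on (-{0}) S"
  by (intro continuous_at_imp_continuous_on ballI has_derivative_continuous[OF S_deriv]) simp

lemma S_grad_radial: "z \<noteq> 0 \<Longrightarrow> S_grad z \<bullet> z = 0"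
  using h_grad_radial[of z] W_perp[of z "X z"] by (simp add: S_grad_def inner_add_left)

text \<open>\<open>S_grad z\<close> is tangential, so pairing it with \<open>X z\<close> amounts to
  pairing it with the gradient of \<open>h\<close>. Both resulting terms are nonnegative, hence a
  zero sum makes the term with \<open>W\<close> vanish.\<close>

lemma S_grad_X_nonneg: assumes "z \<noteq> 0"
  shows "0 \<le> S_grad z \<bullet> X z" and "S_grad z \<bullet> X z = 0 \<Longrightarrow> W z (X z) \<bullet> X z = 0"
proof -
  have eq: "S_grad z \<bullet> X z = S z * ((g' (h z) / g (h z)) * (h_grad z \<bullet> X z) + W z (X z) \<bullet> X z)"
    by (simp add: S_grad_def inner_add_left)
  have 1: "0 \<le> (g' (h z) / g (h z)) * (h_grad z \<bullet> X z)"
    using g_at[OF assms] h_grad_X[OF assms] h_le_norm_X[OF assms] by simp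
  show "0 \<le> S_grad z \<bullet> X z" unfolding eq
    using 1 W_psd[OF assms] S_pos[OF assms] by simp
  assume "S_grad z \<bullet> X z = 0"
  then show "W z (X z) \<bullet> X z = 0" using eq 1 W_psd[OF assms, of "X z"] S_pos[OF assms] by simp
qed

lemma rho_pos: "z \<noteq> 0 \<Longrightarrow> rho z > 0" using S_pos[of z] by (simp add: rho_def)

lemma rho_power: "z \<noteq> 0 \<Longrightarrow> rho z ^ n = S z"
  using S_pos[of z] n_pos by (simp add: rho_def powr_realpow[symmetric] powr_powr)

lemma rho_deriv: assumes z: "z \<noteq> 0" shows "(rho has_derivative (\<lambda>v. rho_grad z \<bullet> v)) (at z)"
proof -
  have "((\<lambda>s. s powr (1/n)) has_real_derivative (rho z / (n * S z))) (at (S z))"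
  proof (rule DERIV_cong[OF has_real_derivative_powr[OF S_pos[OF z]]])
    have "S z powr (1 / n - 1) = rho z / S z" unfolding rho_def powr_diff using S_pos[OF z] by simp
    then show "1 / n * S z powr (1 / n - 1) = rho z / (n * S z)" by simp
  qed
  from has_derivative_compose[OF S_deriv[OF z] this[unfolded has_field_derivative_def]]
  show ?thesis unfolding rho_def[abs_def, symmetric] by (simp add: rho_grad_def)
qed

lemma rho_cont: "continuous_on (-{0}) rho"
  by (intro continuous_at_imp_continuous_on ballI has_derivative_continuous[OF rho_deriv]) simp

lemma rho_sgn: "z \<noteq> 0 \<Longrightarrow> rho (sgn z) = rho z" by (simp add: rho_def S_sgn')

lemma D_lmeasurable: "D \<in> lmeasurable"
  by (intro lmeasurable_open bounded_diff bounded_ball open_Diff) auto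

lemma homogeneous_absolutely_integrable:
  fixes f :: "(real^'m::_) \<Rightarrow> real"
  assumes f: "continuous_on (-{0}) f" and hom: "\<And>z. z \<noteq> 0 \<Longrightarrow> f z = f (sgn z)"
  shows "f absolutely_integrable_on D"
proof -
  obtain M where "\<And>z. z \<noteq> 0 \<Longrightarrow> norm (f z) \<le> M" using zero_homogeneous_bounded[OF assms] by metis
  then show ?thesis
    using f by (intro bounded_continuous_absolutely_integrable[OF D_lmeasurable, of f M])
      (auto intro: continuous_on_subset)
qed

section \<open>Volume of the body in radial coordinates\<close>

lemma support_strict: assumes "a \<in> interior C" "z \<noteq> 0" shows "0 < (X z - a) \<bullet> sgn z"
proof -
  obtain e where e: "e > 0" "cball a e \<subseteq> C" using assms(1) mem_interior_cball by metis
  have "a + e *\<^sub>R sgn z \<in> C" using e unit(1)[OF assms(2)] by (intro subsetD[OF e(2)]) (simp add: dist_norm)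
  from support[OF _ this, of "sgn z"] show ?thesis
    using e assms(2) unit(2)[OF assms(2)]
    by (simp add: sgn_zero_iff X_sgn inner_add_left inner_diff_left)
qed

lemma X_frontier: "z \<noteq> 0 \<Longrightarrow> X z \<in> frontier C"
  using X_sgn[of z] unit(1)[of z] unfolding frontier_C by (metis dist_0_norm imageI mem_sphere)

lemma X_not_interior: "z \<noteq> 0 \<Longrightarrow> X z \<notin> interior C"
  using X_frontier by (auto simp: frontier_def)

lemma segment_interior:
  assumes "a \<in> interior C" "y \<in> C" "0 \<le> t" "t < 1" shows "a + t *\<^sub>R (y - a) \<in> interior C"
proof -
  have "y - (1 - t) *\<^sub>R (y - a) \<in> interior C"
    using assms convex_C by (intro mem_interior_convex_shrink) auto
  then show ?thesis by (simp add: algebra_simps)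
qed

text \<open>A ray from \<open>a\<close> leaves \<open>C\<close> at a frontier point
  \<open>X x\<close>; \<open>norm z\<close> is the fraction of the way from \<open>a\<close> to that
  point.\<close>

lemma radial_image:
  assumes a: "a \<in> interior C"
  shows "(\<lambda>z. a + norm z *\<^sub>R (X z - a)) ` D = interior C - {a}"
proof
  show "(\<lambda>z. a + norm z *\<^sub>R (X z - a)) ` D \<subseteq> interior C - {a}"
    using segment_interior[OF a] X_mem X_not_interior a by auto
  show "interior C - {a} \<subseteq> (\<lambda>z. a + norm z *\<^sub>R (X z - a)) ` D"
  proof
    fix y assume y: "y \<in> interior C - {a}"
    obtain d where d: "d > 0" "a + d *\<^sub>R (y - a) \<in> frontier C"
      by (rule ray_to_frontier[of C a "y - a"]) (use compact_imp_bounded[OF compact_C] a y that in auto)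
    then obtain x where x: "norm x = 1" "a + d *\<^sub>R (y - a) = X x"
      unfolding frontier_C by auto
    have yC: "y \<in> C" using y interior_subset by blast
    have "a + (d / 1) *\<^sub>R (y - a) \<notin> interior C" using d(2) by (simp add: frontier_def)
    then have "d \<noteq> 1" "\<not> d < 1" using segment_interior[OF a yC, of d] d y by auto
    then have d1: "d > 1" by simp
    have x0: "x \<noteq> 0" using x by auto
    have "X ((1/d) *\<^sub>R x) = X x" using d x0 by (intro X_scale) auto
    moreover have "y = a + (1/d) *\<^sub>R (X x - a)" using d by (simp flip: x(2))
    ultimately have "y = a + norm ((1/d) *\<^sub>R x) *\<^sub>R (X ((1/d) *\<^sub>R x) - a)" using d x by simp
    moreover have "(1/d) *\<^sub>R x \<in> D" using d1 x x0 by simp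
    ultimately show "y \<in> (\<lambda>z. a + norm z *\<^sub>R (X z - a)) ` D" by blast
  qed
qed

text \<open>If two points with different norms had the same image, one of the frontier points would
  lie strictly between \<open>a\<close> and the other, hence in the interior. Equal norms leave
  equal values of \<open>X\<close>, and \<open>X_inj\<close> applies.\<close>

lemma radial_inj:
  assumes a: "a \<in> interior C"
  shows "inj_on (\<lambda>z. a + norm z *\<^sub>R (X z - a)) D"
proof -
  have lt: False if "z \<noteq> 0" "z' \<noteq> 0" "norm z *\<^sub>R (X z - a) = norm z' *\<^sub>R (X z' - a)" "norm z < norm z'" for z z'
  proof -
    have "X z' - a = (norm z / norm z') *\<^sub>R (X z - a)"
    proof -
      have "(norm z / norm z') *\<^sub>R (X z - a) = (1 / norm z') *\<^sub>R (norm z *\<^sub>R (X z - a))" by simp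
      also have "\<dots> = X z' - a" unfolding that(3) using that(2) by simp
      finally show ?thesis by simp
    qed
    then have "X z' = a + (norm z / norm z') *\<^sub>R (X z - a)" by (simp add: algebra_simps)
    moreover have "a + (norm z / norm z') *\<^sub>R (X z - a) \<in> interior C"
      using that by (intro segment_interior[OF a X_mem]) auto
    ultimately show False using X_not_interior that by metis
  qed
  show ?thesis
  proof (rule inj_onI)
    fix z z' assume z: "z \<in> D" "z' \<in> D" and eq: "a + norm z *\<^sub>R (X z - a) = a + norm z' *\<^sub>R (X z' - a)"
    then have nz: "norm z = norm z'" using lt[of z z'] lt[of z' z] by (cases "norm z" "norm z'" rule: linorder_cases) auto
    then have "X z = X z'" using eq z by simp
    then have "sgn z = sgn z'" using X_inj[of "sgn z" "sgn z'"] z unit(1) X_sgn by auto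
    moreover have "norm z *\<^sub>R sgn z = z" "norm z' *\<^sub>R sgn z' = z'" using z by (simp_all add: sgn_div_norm)
    ultimately show "z = z'" using nz by metis
  qed
qed

text \<open>The Jacobian of the radial map is 0-homogeneous. The factor \<open>1 / (n + 1)\<close>
  of the formula on the sphere is the radial integral of \<open>r ^ n\<close>, which the integral
  over the ball contains.\<close>

lemma radial_volume:
  assumes a: "a \<in> interior C"
  shows "((\<lambda>z. ((X z - a) \<bullet> sgn z) * S z) has_integral measure lebesgue C) D"
proof -
  let ?f = "\<lambda>z. a + norm z *\<^sub>R (X z - a)"
  let ?f' = "\<lambda>z v. norm z *\<^sub>R W z v + (sgn z \<bullet> v) *\<^sub>R (X z - a)"
  have der: "(?f has_derivative ?f' z) (at z within D)" if "z \<in> D" for z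
  proof (rule has_derivative_at_withinI)
    have z: "z \<noteq> 0" using that by simp
    show "(?f has_derivative ?f' z) (at z)"
      using has_derivative_add[OF has_derivative_const[of a] has_derivative_scaleR[OF has_derivative_norm_sgn[OF z]
          has_derivative_diff[OF X_deriv[OF z] has_derivative_const[of a]]]] by simp
  qed
  have meas: "?f ` D \<in> lmeasurable" "measure lebesgue (?f ` D) = measure lebesgue C"
  proof -
    have "negligible (frontier C)" using convex_C by (rule negligible_convex_frontier)
    then have "measure lebesgue (interior C) = measure lebesgue C"
      using compact_C by (intro measure_interior) (auto intro: compact_imp_bounded)
    moreover have lm: "interior C \<in> lmeasurable"
      using compact_C compact_imp_bounded bounded_interior by (intro lmeasurable_open) auto
    moreover have neg: "negligible (interior C - (interior C - {a}) \<union> (interior C - {a} - interior C))"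
      by (rule negligible_subset[of "{a}"]) auto
    ultimately show "?f ` D \<in> lmeasurable" "measure lebesgue (?f ` D) = measure lebesgue C"
      unfolding radial_image[OF a]
      using lmeasurable_negligible_symdiff[OF lm, of "interior C - {a}"]
        measure_negligible_symdiff[of "interior C" "interior C - {a}"] by auto
  qed
  have "((\<lambda>z. \<bar>det (matrix (?f' z))\<bar>) has_integral measure lebesgue C) D"
    using has_measure_differentiable_image[OF _ der radial_inj[OF a]] meas D_lmeasurable by blast
  moreover have "\<bar>det (matrix (?f' z))\<bar> = ((X z - a) \<bullet> sgn z) * S z" if "z \<in> D" for z
  proof -
    have z: "z \<noteq> 0" using that by simp
    have "det (matrix (?f' z)) = ((X z - a) \<bullet> sgn z) * S z"
      unfolding S_def
    proof (rule det_tangential_block(2)[OF _ unit(1)[OF z]])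
      show "linear (\<lambda>v. norm z *\<^sub>R W z v)" using W_lin[OF z] by (rule linear_compose_scale_right)
      show "sgn z \<bullet> (norm z *\<^sub>R W z v) = 0" for v using W_perp[OF z, of v] by (simp add: sgn_div_norm inner_commute)
    qed
    then show ?thesis using support_strict[OF a z] S_pos[OF z] by simp
  qed
  ultimately show ?thesis by (rule has_integral_eq[rotated])
qed

text \<open>\<open>radial_volume\<close> is affine in \<open>a\<close> and constant on an open set, so its linear term vanishes; the origin
  therefore need not lie in \<open>C\<close>.\<close>

lemma volume_eq: "((\<lambda>z. h z * S z) has_integral measure lebesgue C) D"
proof -
  obtain a where a: "a \<in> interior C" using interior_C by blast
  then obtain e where e: "e > 0" "cball a e \<subseteq> interior C"
    by (metis open_contains_cball open_interior)
  \<comment> \<open>A multiple of \<open>a\<close> of length \<open>e\<close>, so that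
    \<open>a - v\<close> remains in the ball around \<open>a\<close>; the vanishing linear term is
    rescaled from \<open>v\<close> to \<open>a\<close> afterwards.\<close>
  define v where "v = (if a = 0 then 0 else (e / norm a) *\<^sub>R a)"
  have "a - v \<in> interior C"
    by (rule subsetD[OF e(2)]) (use e in \<open>auto simp: v_def dist_norm\<close>)
  note r1 = radial_volume[OF a] and r2 = radial_volume[OF this]
  have "((\<lambda>z. ((X z - (a - v)) \<bullet> sgn z) * S z - ((X z - a) \<bullet> sgn z) * S z) has_integral 0) D"
    using has_integral_diff[OF r2 r1] by simp
  then have v0: "((\<lambda>z. (v \<bullet> sgn z) * S z) has_integral 0) D"
    by (simp add: inner_diff_left algebra_simps)
  have "((\<lambda>z. (a \<bullet> sgn z) * S z) has_integral 0) D"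
  proof (cases "a = 0")
    case True then show ?thesis by simp
  next
    case False
    have "((\<lambda>z. (norm a / e) * ((v \<bullet> sgn z) * S z)) has_integral (norm a / e) * 0) D"
      by (rule has_integral_mult_right[OF v0])
    then show ?thesis using False e by (simp add: v_def)
  qed
  from has_integral_add[OF r1 this] show ?thesis
    by (simp add: h_def inner_diff_left algebra_simps)
qed

text \<open>\<open>Psi\<close> is the inner normal map \<open>X x - s *\<^sub>R x\<close> with \<open>s = rho (1 - |z|)\<close>.  This choice of the radial
  variable makes the Jacobian bound independent of \<open>|z|\<close>: with \<open>rho = S\<^sup>1\<^sup>/\<^sup>n\<close> the estimate
  \<open>det (A - s I) \<le> (rho - s)\<^sup>n\<close> becomes \<open>|det DPsi| \<le> rho S\<close>.\<close>

definition kappa where "kappa z = rho z * (1 / norm z - 1)"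

text \<open>Multiplied by \<open>norm z\<close>, this is
  \<open>\<nabla>\<^sup>2h + g h - s I\<close> at \<open>sgn z\<close> with
  \<open>s = rho z * (1 - norm z)\<close>.\<close>

definition A where "A z v = W z v - kappa z *\<^sub>R (v - (sgn z \<bullet> v) *\<^sub>R sgn z)"

definition Psi where "Psi z = X z - (rho z * (1 - norm z)) *\<^sub>R sgn z"

text \<open>Minus the gradient of the coefficient \<open>s\<close>, giving the normal component of
  the derivative of \<open>Psi\<close>.\<close>

definition Psi_w where "Psi_w z = rho z *\<^sub>R sgn z - (1 - norm z) *\<^sub>R rho_grad z"

text \<open>The region where \<open>s\<close> does not exceed the least radius of curvature, so that
  the inner normal has not yet met a focal point.\<close>

definition E where "E = {z \<in> D. \<forall>v. 0 \<le> A z v \<bullet> v}"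

section \<open>The inner normal map and the volume bound\<close>

lemma kappa_cont: "continuous_on (-{0}) kappa"
  unfolding kappa_def using rho_cont by (auto intro!: continuous_intros)

text \<open>For each \<open>v\<close> the condition is relatively closed in the punctured space, and
  closedness survives the uncountable intersection over \<open>v\<close>.\<close>

lemma E_measurable: "E \<in> sets lebesgue"
proof -
  have "closedin (top_of_set (-{0})) {z \<in> -{0}. A z v \<bullet> v \<in> {0..}}" for v
  proof -
    have "continuous_on (-{0}) (\<lambda>z. A z v \<bullet> v)"
      unfolding A_def using kappa_cont W_cont sgn_cont by (intro continuous_intros) auto
    from continuous_closedin_preimage[OF this closed_atLeast[of 0]] show ?thesis
      by (simp add: vimage_def Int_def)
  qed
  then have "closedin (top_of_set (-{0})) (\<Inter>v. {z \<in> -{0}. A z v \<bullet> v \<in> {0..}})"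
    by (intro closedin_INT) auto
  then obtain T where T: "closed T" "(\<Inter>v. {z \<in> -{0}. A z v \<bullet> v \<in> {0..}}) = -{0} \<inter> T"
    by (auto simp: closedin_closed)
  have "E = D \<inter> (\<Inter>v. {z \<in> -{0}. A z v \<bullet> v \<in> {0..}})" by (auto simp: E_def)
  also have "\<dots> = D \<inter> T" unfolding T(2) by auto
  finally show ?thesis using T(1) D_lmeasurable by auto
qed

lemma Psi_deriv:
  assumes z: "z \<noteq> 0"
  shows "(Psi has_derivative (\<lambda>v. A z v + (Psi_w z \<bullet> v) *\<^sub>R sgn z)) (at z)"
proof -
  have "((\<lambda>y. rho y * (1 - norm y)) has_derivative
      (\<lambda>v. rho z * (0 - sgn z \<bullet> v) + (rho_grad z \<bullet> v) * (1 - norm z))) (at z)"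
    by (intro has_derivative_mult rho_deriv z has_derivative_diff has_derivative_const has_derivative_norm_sgn)
  from has_derivative_diff[OF X_deriv[OF z] has_derivative_scaleR[OF this has_derivative_sgn[OF z]]]
  have "(Psi has_derivative (\<lambda>v. W z v -
      ((rho z * (1 - norm z)) *\<^sub>R ((v - (sgn z \<bullet> v) *\<^sub>R sgn z) /\<^sub>R norm z) +
       (rho z * (0 - sgn z \<bullet> v) + (rho_grad z \<bullet> v) * (1 - norm z)) *\<^sub>R sgn z))) (at z)"
    by (simp add: Psi_def[abs_def])
  moreover have "W z v -
      ((rho z * (1 - norm z)) *\<^sub>R ((v - (sgn z \<bullet> v) *\<^sub>R sgn z) /\<^sub>R norm z) +
       (rho z * (0 - sgn z \<bullet> v) + (rho_grad z \<bullet> v) * (1 - norm z)) *\<^sub>R sgn z)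
     = A z v + (Psi_w z \<bullet> v) *\<^sub>R sgn z" for v
  proof -
    have "kappa z = rho z * (1 - norm z) * inverse (norm z)" using z by (simp add: kappa_def field_simps)
    then have "(rho z * (1 - norm z)) *\<^sub>R (u /\<^sub>R norm z) = kappa z *\<^sub>R u" for u :: "real^'m::_" by simp
    then show ?thesis unfolding A_def Psi_w_def
      by (simp only:) (simp add: inner_diff_left algebra_simps)
  qed
  ultimately show ?thesis by simp
qed

lemma A_tangential:
  assumes z: "z \<noteq> 0"
  shows "linear (A z)" "A z u \<bullet> v = u \<bullet> A z v" "A z (sgn z) = 0"
proof -
  show "linear (A z)" unfolding A_def
    by (intro linearI) (auto simp: linear_add[OF W_lin[OF z]] linear_scale[OF W_lin[OF z]] algebra_simps)
  show "A z u \<bullet> v = u \<bullet> A z v" using W_sym[OF z, of u v]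
    by (simp add: A_def inner_diff_left inner_diff_right inner_commute algebra_simps)
  have "W z (sgn z) = 0" using W_radial[OF z] by (simp add: sgn_div_norm linear_scale[OF W_lin[OF z]])
  then show "A z (sgn z) = 0" using unit(2)[OF z] by (simp add: A_def)
qed

text \<open>\<open>Q\<close> is the form shifted by \<open>s\<close>; shifting back gives
  determinant \<open>S z\<close>, so the root of \<open>det Q\<close> is at most
  \<open>rho z - s = rho z * norm z\<close>. The powers of \<open>norm z\<close> cancel between
  \<open>det Q\<close> and this bound, and the normal direction contributes the remaining factor
  \<open>rho z\<close>.\<close>

lemma Psi_jacobian:
  assumes zE: "z \<in> E"
  shows "\<bar>det (matrix (\<lambda>v. A z v + (Psi_w z \<bullet> v) *\<^sub>R sgn z))\<bar> \<le> rho z * S z"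
proof -
  have z: "z \<noteq> 0" "norm z < 1" using zE by (auto simp: E_def)
  note A = A_tangential[OF z(1)] and x1 = unit(1)[OF z(1)]
  have r: "rho z > 0" using rho_pos z by blast
  define d where "d = det (matrix (\<lambda>v. A z v + (sgn z \<bullet> v) *\<^sub>R sgn z))"
  define Q where "Q v = norm z *\<^sub>R A z v" for v
  have Q: "linear Q" unfolding Q_def by (intro linear_compose_scale_right A(1))
  have Qsym: "Q u \<bullet> v = u \<bullet> Q v" for u v using A(2)[of u v] by (simp add: Q_def)
  have Qx: "Q (sgn z) = 0" using A(3) by (simp add: Q_def)
  have Qpsd: "0 \<le> Q v \<bullet> v" for v using zE by (simp add: Q_def E_def)
  define d' where "d' = det (matrix (\<lambda>v. Q v + (sgn z \<bullet> v) *\<^sub>R sgn z))"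
  have d': "d' = norm z ^ n * d"
    unfolding d_def d'_def Q_def n_def by (rule tangential_det_scale[OF A x1])
  have d'0: "d' \<ge> 0" unfolding d'_def by (rule tangential_psd_det(1)[OF Q Qsym Qx x1 Qpsd dim2])
  have "Psi_w z \<bullet> sgn z = rho z"
    using S_grad_radial[OF z(1)] unit(2)[OF z(1)]
    by (simp add: Psi_w_def rho_grad_def inner_diff_left sgn_div_norm)
  then have det: "det (matrix (\<lambda>v. A z v + (Psi_w z \<bullet> v) *\<^sub>R sgn z)) = rho z * d"
    unfolding d_def using det_tangential_block(1)[OF A(1) x1 A(3), of "Psi_w z"] by simp
  have k: "norm z * kappa z = rho z * (1 - norm z)" using z by (simp add: kappa_def field_simps)
  have "d' powr (1 / n) + rho z * (1 - norm z)
     \<le> det (matrix (\<lambda>v. Q v + (rho z * (1 - norm z)) *\<^sub>R (v - (sgn z \<bullet> v) *\<^sub>R sgn z) + (sgn z \<bullet> v) *\<^sub>R sgn z)) powr (1 / n)"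
    unfolding d'_def n_def
    by (rule tangential_psd_det(3)[OF Q Qsym Qx x1 Qpsd dim2]) (use r z in simp)
  also have "(\<lambda>v. Q v + (rho z * (1 - norm z)) *\<^sub>R (v - (sgn z \<bullet> v) *\<^sub>R sgn z) + (sgn z \<bullet> v) *\<^sub>R sgn z)
     = (\<lambda>v. norm z *\<^sub>R W z v + (sgn z \<bullet> v) *\<^sub>R sgn z)"
    unfolding Q_def A_def k[symmetric] by (simp add: scaleR_diff_right mult.assoc)
  also have "det (matrix \<dots>) powr (1 / n) = rho z" by (simp add: rho_def S_def)
  finally have "d' powr (1 / n) \<le> rho z * norm z" by (simp add: algebra_simps)
  then have "(d' powr (1 / n)) ^ n \<le> (rho z * norm z) ^ n" by (intro power_mono) auto
  moreover have "(d' powr (1 / n)) ^ n = d'"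
    using d'0 n_pos by (cases "d' = 0") (auto simp: powr_realpow[symmetric] powr_powr)
  ultimately have "norm z ^ n * d \<le> norm z ^ n * S z"
    using d' by (simp add: power_mult_distrib rho_power[OF z(1)] mult.commute)
  then have "d \<le> S z" using z by simp
  moreover have "d \<ge> 0" using d' d'0 z by (metis norm_ge_zero zero_le_power linorder_not_less mult_pos_neg zero_less_power zero_less_norm_iff)
  ultimately show ?thesis unfolding det using r by (simp add: abs_mult)
qed

text \<open>The foot \<open>x\<close> of the largest ball around \<open>y\<close> inside \<open>C\<close> minimises \<open>h - \<langle>y, _\<rangle>\<close>; the
  second-order condition there places the radius below the least radius of curvature.  The second set collects
  the points with \<open>|z| = 0\<close>, where \<open>Psi\<close> is not differentiable.\<close>

lemma interior_covered:
  assumes y: "y \<in> interior C"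
  shows "y \<in> Psi ` E \<union> (\<lambda>x. X x - rho x *\<^sub>R x) ` sphere 0 1"
proof -
  have "sphere 0 1 \<noteq> ({} :: (real^'m::_) set)" by simp
  moreover have "continuous_on (sphere 0 1) (\<lambda>x. X x \<bullet> x - y \<bullet> x)"
    using X_cont by (auto intro!: continuous_intros intro: continuous_on_subset)
  ultimately obtain x where x: "norm x = 1" and min: "\<And>w. norm w = 1 \<Longrightarrow> X x \<bullet> x - y \<bullet> x \<le> X w \<bullet> w - y \<bullet> w"
    using continuous_attains_inf[OF compact_sphere, of 0 1 "\<lambda>x. X x \<bullet> x - y \<bullet> x"] by auto
  define s where "s = X x \<bullet> x - y \<bullet> x"
  have x0: "x \<noteq> 0" and sgnx: "sgn x = x" using x by (auto simp: sgn_div_norm)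
  have xx: "x \<bullet> x = 1" using x by (simp add: norm_eq_1)
  have s: "s > 0" using support_strict[OF y x0] by (simp add: s_def sgnx inner_diff_left)
  \<comment> \<open>The 1-homogeneous extension of the difference being minimised: the constrained
    minimum at \<open>x\<close> becomes an unconstrained one with value 0, so the ordinary first-
    and second-order conditions apply.\<close>
  define F where "F z = X z \<bullet> z - y \<bullet> z - s * norm z" for z
  define G where "G z = X z - y - s *\<^sub>R sgn z" for z
  have Fx: "F x = 0" using x by (simp add: F_def s_def)
  have F_nonneg: "F z \<ge> 0" if "z \<noteq> 0" for z
  proof -
    have "s \<le> X (sgn z) \<bullet> sgn z - y \<bullet> sgn z" unfolding s_def by (rule min[OF unit(1)[OF that]])
    then have "s * norm z \<le> (X z \<bullet> sgn z - y \<bullet> sgn z) * norm z" using that by (simp add: X_sgn mult_right_mono)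
    also have "\<dots> = X z \<bullet> z - y \<bullet> z" using that by (simp add: sgn_div_norm field_simps)
    finally show ?thesis by (simp add: F_def)
  qed
  have F_deriv: "(F has_derivative (\<lambda>v. G z \<bullet> v)) (at z)" if "z \<noteq> 0" for z
  proof -
    have "(F has_derivative (\<lambda>v. X z \<bullet> v - y \<bullet> v - s * (sgn z \<bullet> v))) (at z)"
      unfolding F_def[abs_def]
      by (intro has_derivative_diff H_deriv[OF that] has_derivative_inner_right has_derivative_ident
        has_derivative_mult_right has_derivative_norm_sgn that)
    then show ?thesis by (simp add: G_def inner_diff_left)
  qed
  have "(\<lambda>v. G x \<bullet> v) = (\<lambda>v. 0)"
    using F_nonneg Fx x0 by (intro differential_zero_maxmin[OF _ _ F_deriv, of x "-{0}"]) auto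
  then have Gx: "G x = 0" by (metis inner_eq_zero_iff)
  then have yx: "y = X x - s *\<^sub>R x" by (simp add: G_def sgnx algebra_simps)
  define Q where "Q v = W x v - s *\<^sub>R (v - (x \<bullet> v) *\<^sub>R x)" for v
  have G_deriv: "(G has_derivative Q) (at x)"
  proof -
    have "(G has_derivative (\<lambda>v. W x v - 0 - s *\<^sub>R ((v - (sgn x \<bullet> v) *\<^sub>R sgn x) /\<^sub>R norm x))) (at x)"
      unfolding G_def[abs_def]
      by (intro has_derivative_diff X_deriv x0 has_derivative_const has_derivative_scaleR_right has_derivative_sgn)
    then show ?thesis by (simp add: Q_def[abs_def] sgnx x)
  qed
  have Qpsd: "0 \<le> Q v \<bullet> v" for v
    using second_order_minimum[of "-{0}" x F G Q v] F_deriv F_nonneg Fx G_deriv Gx x0 by auto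
  have Qlin: "linear Q" using G_deriv has_derivative_linear by blast
  have Qsym: "Q u \<bullet> v = u \<bullet> Q v" for u v
    using W_sym[OF x0, of u v] by (simp add: Q_def inner_diff_left inner_diff_right inner_commute algebra_simps)
  have Qx: "Q x = 0" using W_radial[OF x0] xx by (simp add: Q_def)
  have "det (matrix (\<lambda>v. Q v + (x \<bullet> v) *\<^sub>R x)) powr (1 / n) + s
     \<le> det (matrix (\<lambda>v. Q v + s *\<^sub>R (v - (x \<bullet> v) *\<^sub>R x) + (x \<bullet> v) *\<^sub>R x)) powr (1 / n)"
    unfolding n_def by (rule tangential_psd_det(3)[OF Qlin Qsym Qx x Qpsd dim2]) (use s in simp)
  also have "det (matrix (\<lambda>v. Q v + s *\<^sub>R (v - (x \<bullet> v) *\<^sub>R x) + (x \<bullet> v) *\<^sub>R x)) powr (1 / n) = rho x"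
    by (simp add: Q_def rho_def S_def sgnx x)
  finally have sr: "s \<le> rho x" by (smt (verit) powr_ge_zero)
  show ?thesis
  proof (cases "s = rho x")
    case True
    then show ?thesis using yx x by auto
  next
    case False
    have r: "rho x > 0" using rho_pos x0 by blast
    \<comment> \<open>The solution of \<open>rho x * (1 - t) = s\<close>; it lies strictly between 0
      and 1 because \<open>0 < s < rho x\<close>.\<close>
    define t where "t = 1 - s / rho x"
    have t: "0 < t" "t < 1" using s sr r False by (auto simp: t_def)
    define z where "z = t *\<^sub>R x"
    have z0: "z \<noteq> 0" and nz: "norm z = t" and sz: "sgn z = x"
      using t x x0 by (auto simp: z_def sgn_div_norm)
    have Xz: "X z = X x" unfolding z_def by (rule X_scale[OF t(1) x0])
    have rz: "rho z = rho x" using rho_sgn[OF z0] sz by simp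
    have ts: "rho x * (1 - t) = s" using r by (simp add: t_def)
    have "Psi z = y" by (simp add: Psi_def Xz rz nz sz ts yx)
    moreover have "z \<in> E"
    proof -
      have "kappa z = s / t" unfolding kappa_def rz nz ts[symmetric] using t by (simp add: field_simps)
      moreover have "W z v = W x v /\<^sub>R t" for v unfolding z_def by (rule W_scale[OF t(1) x0])
      ultimately have "A z v = Q v /\<^sub>R t" for v
        by (simp add: A_def Q_def sz scaleR_diff_right divide_inverse mult.commute)
      then show ?thesis using Qpsd t z0 nz by (simp add: E_def)
    qed
    ultimately show ?thesis by blast
  qed
qed

text \<open>\<open>Psi\<close> may cover a point several times, which only enlarges the integral of
  its Jacobian. The exceptional points form a differentiable image of the sphere and are
  negligible.\<close>

lemma volume_le: "measure lebesgue C \<le> integral D (\<lambda>z. rho z * S z)"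
proof -
  define J where "J z = det (matrix (\<lambda>v. A z v + (Psi_w z \<bullet> v) *\<^sub>R sgn z))" for z
  have ED: "E \<subseteq> D" by (auto simp: E_def)
  have der: "(Psi has_derivative (\<lambda>v. A z v + (Psi_w z \<bullet> v) *\<^sub>R sgn z)) (at z within E)" if "z \<in> E" for z
    using Psi_deriv[of z] that ED by (auto intro: has_derivative_at_withinI)
  have intD: "(\<lambda>z. rho z * S z) absolutely_integrable_on D"
    using rho_cont S_cont by (intro homogeneous_absolutely_integrable continuous_intros) (auto simp: rho_sgn S_sgn')
  then have intE: "(\<lambda>z. rho z * S z) absolutely_integrable_on E"
    using E_measurable ED by (rule set_integrable_subset)
  have intJ: "(\<lambda>z. \<bar>J z\<bar>) absolutely_integrable_on E"
  proof (rule measurable_bounded_by_integrable_imp_absolutely_integrable)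
    show "(\<lambda>z. \<bar>J z\<bar>) \<in> borel_measurable (lebesgue_on E)"
      unfolding J_def using borel_measurable_det_Jacobian[OF E_measurable der] by measurable
    show "(\<lambda>z. rho z * S z) integrable_on E" using intE by (simp add: absolutely_integrable_on_def)
  qed (use E_measurable Psi_jacobian in \<open>auto simp: J_def\<close>)
  have img: "(\<lambda>_. 1::real) absolutely_integrable_on (Psi ` E)"
    by (rule absolutely_integrable_on_image_real[OF der]) (use intJ in \<open>auto simp: J_def\<close>)
  have lm: "Psi ` E \<in> lmeasurable"
    using img by (simp add: lmeasurable_iff_integrable_on absolutely_integrable_on_def)
  have "measure lebesgue (Psi ` E) = integral (Psi ` E) (\<lambda>_. 1)" by (rule lmeasure_integral[OF lm])
  also have "\<dots> \<le> integral E (\<lambda>z. \<bar>J z\<bar> * 1)"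
    unfolding J_def
    by (rule integral_on_image_ubound[where f = "\<lambda>_. 1", OF _ der])
      (use intJ in \<open>auto simp: J_def absolutely_integrable_on_def\<close>)
  also have "\<dots> \<le> integral E (\<lambda>z. rho z * S z)"
    using intJ intE Psi_jacobian by (intro integral_le) (auto simp: absolutely_integrable_on_def J_def)
  also have "\<dots> \<le> integral D (\<lambda>z. rho z * S z)"
    using intD intE ED rho_pos S_pos by (intro integral_subset_le) (auto simp: absolutely_integrable_on_def less_imp_le)
  finally have le: "measure lebesgue (Psi ` E) \<le> integral D (\<lambda>z. rho z * S z)" .
  let ?N = "(\<lambda>x. X x - rho x *\<^sub>R x) ` sphere 0 1"
  have neg: "negligible ?N"
  proof (rule negligible_differentiable_image_negligible)
    show "(\<lambda>x. X x - rho x *\<^sub>R x) differentiable_on sphere 0 1"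
    proof (rule differentiable_at_imp_differentiable_on)
      fix x :: "real^'m::_" assume "x \<in> sphere 0 1"
      then have x: "x \<noteq> 0" by auto
      show "(\<lambda>x. X x - rho x *\<^sub>R x) differentiable at x"
        using X_deriv[OF x] rho_deriv[OF x] by (intro derivative_intros) (auto simp: differentiable_def)
    qed
  qed (auto simp: negligible_sphere)
  have "measure lebesgue C = measure lebesgue (interior C)"
    using compact_C convex_C by (intro measure_interior[symmetric] negligible_convex_frontier) (auto intro: compact_imp_bounded)
  also have "\<dots> \<le> measure lebesgue (Psi ` E \<union> ?N)"
  proof (rule measure_mono_fmeasurable)
    show "interior C \<subseteq> Psi ` E \<union> ?N" using interior_covered by blast
    show "Psi ` E \<union> ?N \<in> lmeasurable" using neg by (intro fmeasurable.Un[OF lm negligible_imp_measurable])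
  qed auto
  also have "\<dots> = measure lebesgue (Psi ` E)"
    by (rule measure_negligible_symdiff[OF lm]) (rule negligible_subset[OF neg], auto)
  finally show ?thesis using le by simp
qed

text \<open>\<open>u i j\<close> and \<open>u_rot i j\<close> are the first and second derivatives of \<open>h\<close> along the rotation field
  \<open>rot i j\<close>.  Summing over all \<open>i, j\<close> counts each rotation plane twice, which gives \<open>2 \<Delta>h\<close>
  in \<open>sum_u_rot\<close>.\<close>

definition div_X where "div_X z = (\<Sum>i\<in>UNIV. W z (axis i 1) $ i)"

definition rot where "rot i j z = z $ i *\<^sub>R axis j 1 - z $ j *\<^sub>R axis i (1::real)" for z :: "real^'m::_"

definition u where "u i j z = sgn z $ i * X z $ j - sgn z $ j * X z $ i"

definition u_rot where "u_rot i j z =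
  (rot i j z $ i * X z $ j - rot i j z $ j * X z $ i
    + z $ i * W z (rot i j z) $ j - z $ j * W z (rot i j z) $ i) / norm z"

text \<open>The derivative of \<open>S z * u i j z\<close> along \<open>rot i j\<close>, hence a
  function with integral 0.\<close>

definition Su_rot where "Su_rot i j z = (S_grad z \<bullet> rot i j z) * u i j z + S z * u_rot i j z"

section \<open>Rotation derivatives of the support function\<close>

lemma rot_radial: "sgn z \<bullet> rot i j z = 0"
  by (simp add: rot_def inner_diff_right inner_axis sgn_div_norm)

lemma u_deriv:
  assumes z: "z \<noteq> 0"
  obtains u' where "(u i j has_derivative u') (at z)" "u' (rot i j z) = u_rot i j z"
proof
  let ?s = "\<lambda>v. (v - (sgn z \<bullet> v) *\<^sub>R sgn z) /\<^sub>R norm z"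
  have s: "((\<lambda>z. sgn z $ k) has_derivative (\<lambda>v. ?s v $ k)) (at z)" for k
    by (rule bounded_linear.has_derivative[OF bounded_linear_vec_nth has_derivative_sgn[OF z]])
  have x: "((\<lambda>z. X z $ k) has_derivative (\<lambda>v. W z v $ k)) (at z)" for k
    by (rule bounded_linear.has_derivative[OF bounded_linear_vec_nth X_deriv[OF z]])
  show "(u i j has_derivative (\<lambda>v. (sgn z $ i * W z v $ j + ?s v $ i * X z $ j)
      - (sgn z $ j * W z v $ i + ?s v $ j * X z $ i))) (at z)"
    unfolding u_def[abs_def] by (intro has_derivative_diff has_derivative_mult s x)
  show "(sgn z $ i * W z (rot i j z) $ j + ?s (rot i j z) $ i * X z $ j)
      - (sgn z $ j * W z (rot i j z) $ i + ?s (rot i j z) $ j * X z $ i) = u_rot i j z"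
    unfolding rot_radial u_rot_def by (simp add: sgn_div_norm divide_inverse algebra_simps)
qed

lemma rot_sgn: "z \<noteq> 0 \<Longrightarrow> rot i j (sgn z) = rot i j z /\<^sub>R norm z"
  by (simp add: rot_def sgn_div_norm scaleR_diff_right)

lemma h_grad_sgn: "z \<noteq> 0 \<Longrightarrow> h_grad (sgn z) = norm z *\<^sub>R h_grad z"
  by (simp add: h_grad_def X_sgn h_sgn unit sgn_div_norm[of "sgn z"])

lemma S_grad_sgn: "z \<noteq> 0 \<Longrightarrow> S_grad (sgn z) = norm z *\<^sub>R S_grad z"
  by (simp add: S_grad_def h_grad_sgn h_sgn S_sgn' W_sgn X_sgn algebra_simps)

lemma u_sgn: "z \<noteq> 0 \<Longrightarrow> u i j (sgn z) = u i j z"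
  by (simp add: u_def X_sgn sgn_div_norm[of "sgn z"] unit)

lemma u_rot_sgn: assumes z: "z \<noteq> 0" shows "u_rot i j (sgn z) = u_rot i j z"
proof -
  have wr: "W (sgn z) (rot i j (sgn z)) = W z (rot i j z)"
    using z by (simp add: W_sgn rot_sgn linear_scale[OF W_lin[OF z]])
  show ?thesis
    unfolding u_rot_def wr unfolding X_sgn[OF z] rot_sgn[OF z] unit(1)[OF z]
    by (simp add: sgn_div_norm divide_inverse algebra_simps)
qed

lemma Su_rot_sgn: "z \<noteq> 0 \<Longrightarrow> Su_rot i j z = Su_rot i j (sgn z)"
  by (simp add: Su_rot_def u_sgn u_rot_sgn S_grad_sgn rot_sgn S_sgn')

lemma h_grad_cont: "continuous_on (-{0}) h_grad"
  unfolding h_grad_def[abs_def] using X_cont h_cont sgn_cont by (intro continuous_intros) auto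

lemma gh_cont: "continuous_on (-{0}) (\<lambda>z. g (h z))" "continuous_on (-{0}) (\<lambda>z. g' (h z))"
proof -
  have "h ` (-{0}) \<subseteq> h ` sphere 0 1"
  proof
    fix y assume "y \<in> h ` (-{0})"
    then obtain z where z: "z \<noteq> 0" "y = h z" by auto
    then have "y = h (sgn z)" "sgn z \<in> sphere 0 1" by (simp_all add: h_sgn unit)
    then show "y \<in> h ` sphere 0 1" by blast
  qed
  then show "continuous_on (-{0}) (\<lambda>z. g' (h z))"
    using continuous_on_compose2[OF g'_cont h_cont] by blast
  show "continuous_on (-{0}) (\<lambda>z. g (h z))"
  proof (intro continuous_at_imp_continuous_on ballI)
    fix z :: "real^'m::_" assume "z \<in> -{0}"
    then have "z \<noteq> 0" by simp
    show "isCont (\<lambda>z. g (h z)) z"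
      using has_derivative_continuous[OF h_deriv[OF \<open>z \<noteq> 0\<close>]] DERIV_isCont[OF g_at(1)[OF \<open>z \<noteq> 0\<close>]]
      by (rule isCont_o2)
  qed
qed

lemma S_grad_cont: "continuous_on (-{0}) S_grad"
proof -
  have "continuous_on (-{0}) (\<lambda>z. g' (h z) / g (h z))"
    by (intro continuous_on_divide gh_cont) (use g_at(2) in force)
  then show ?thesis
    unfolding S_grad_def[abs_def]
    by (intro continuous_on_scaleR continuous_on_add S_cont h_grad_cont W_cont_comp[OF X_cont])
qed

lemma rot_cont: "continuous_on T (rot i j)"
  unfolding rot_def[abs_def] by (intro continuous_intros)

lemma u_cont: "continuous_on (-{0}) (u i j)"
  unfolding u_def[abs_def] using sgn_cont X_cont by (intro continuous_intros) auto

lemma u_rot_cont: "continuous_on (-{0}) (u_rot i j)"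
  unfolding u_rot_def[abs_def] using X_cont W_cont_comp[OF rot_cont] rot_cont[of "-{0}"]
  by (intro continuous_intros) auto

text \<open>The product and its rotation derivative are continuous and 0-homogeneous, hence bounded
  on the punctured space, as \<open>integral_rotation_derivative\<close> requires.\<close>

lemma Su_rot_integral: "((\<lambda>z. Su_rot i j z) has_integral 0) D"
proof -
  have "\<exists>u'. z \<noteq> 0 \<longrightarrow> (u i j has_derivative u') (at z) \<and> u' (rot i j z) = u_rot i j z" for z
    using u_deriv[of z i j] by metis
  then obtain u' where u': "\<And>z. z \<noteq> 0 \<Longrightarrow> (u i j has_derivative u' z) (at z)"
    "\<And>z. z \<noteq> 0 \<Longrightarrow> u' z (rot i j z) = u_rot i j z" by metis
  define F' where "F' z v = S z * u' z v + (S_grad z \<bullet> v) * u i j z" for z v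
  have der: "((\<lambda>z. S z * u i j z) has_derivative F' z) (at z)" if "z \<noteq> 0" for z
    unfolding F'_def[abs_def] by (intro has_derivative_mult S_deriv u' that)
  have F'rot: "F' z (rot i j z) = Su_rot i j z" if "z \<noteq> 0" for z
    using that by (simp add: F'_def Su_rot_def u'(2))
  obtain M1 where M1: "\<And>z. z \<noteq> 0 \<Longrightarrow> norm (S z * u i j z) \<le> M1"
    using S_cont u_cont by (rule zero_homogeneous_bounded[OF continuous_on_mult]) (auto simp: S_sgn' u_sgn)
  have "continuous_on (-{0}) (Su_rot i j)"
    unfolding Su_rot_def[abs_def] using S_grad_cont rot_cont[of "-{0}"] u_cont S_cont u_rot_cont
    by (intro continuous_intros)
  then obtain M2 where M2: "\<And>z. z \<noteq> 0 \<Longrightarrow> norm (Su_rot i j z) \<le> M2"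
    using Su_rot_sgn by (rule zero_homogeneous_bounded) auto
  have "((\<lambda>z. F' z (z $ i *\<^sub>R axis j 1 - z $ j *\<^sub>R axis i 1)) has_integral 0) D"
  proof (rule integral_rotation_derivative[where M = "max M1 M2", OF der])
    fix z :: "real^'m::_" assume z: "z \<noteq> 0"
    show "\<bar>S z * u i j z\<bar> \<le> max M1 M2" using M1[OF z] by simp
    show "\<bar>F' z (z $ i *\<^sub>R axis j 1 - z $ j *\<^sub>R axis i 1)\<bar> \<le> max M1 M2"
      using M2[OF z] F'rot[OF z] by (simp add: rot_def)
  qed
  then show ?thesis
    by (rule has_integral_eq[rotated]) (use F'rot in \<open>auto simp: rot_def\<close>)
qed

text \<open>In Lagrange's identity the product of radial parts drops out because
  \<open>S_grad z\<close> is orthogonal to \<open>z\<close>.\<close>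

lemma sum_S_grad_u:
  assumes z: "z \<noteq> 0"
  shows "(\<Sum>i\<in>UNIV. \<Sum>j\<in>UNIV. (S_grad z \<bullet> rot i j z) * u i j z) = 2 * norm z * (S_grad z \<bullet> X z)"
proof -
  have "(S_grad z \<bullet> rot i j z) * u i j z
    = (z $ i * S_grad z $ j - z $ j * S_grad z $ i) * (z $ i * X z $ j - z $ j * X z $ i) / norm z" for i j
    by (simp add: rot_def u_def inner_diff_right inner_axis sgn_div_norm divide_inverse algebra_simps)
  then have "(\<Sum>i\<in>UNIV. \<Sum>j\<in>UNIV. (S_grad z \<bullet> rot i j z) * u i j z)
     = 2 * ((z \<bullet> z) * (S_grad z \<bullet> X z) - (z \<bullet> S_grad z) * (z \<bullet> X z)) / norm z"
    by (simp add: sum_lagrange_identity flip: sum_divide_distrib)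
  also have "\<dots> = 2 * norm z * (S_grad z \<bullet> X z)"
    using S_grad_radial[OF z] z by (simp add: inner_commute dot_square_norm power2_eq_square)
  finally show ?thesis .
qed

text \<open>The second-order terms leave the trace of \<open>W z\<close>, since the mixed ones
  contain \<open>W z z = 0\<close>; differentiating the rotation field itself produces the multiple
  of \<open>h z\<close>.\<close>

lemma sum_u_rot:
  assumes z: "z \<noteq> 0"
  shows "(\<Sum>i\<in>UNIV. \<Sum>j\<in>UNIV. u_rot i j z) = 2 * (norm z * div_X z - n * h z)"
proof -
  define w where "w i j = W z (axis j 1) $ i" for i j
  have Wrot: "W z (rot i j z) $ k = z $ i * w k j - z $ j * w k i" for i j k
    by (simp add: rot_def w_def linear_diff[OF W_lin[OF z]] linear_scale[OF W_lin[OF z]])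
  have Wz: "(\<Sum>j\<in>UNIV. z $ j * w i j) = 0" for i
  proof -
    have "W z z = W z (\<Sum>j\<in>UNIV. z $ j *\<^sub>R axis j 1)"
      using basis_expansion[of z] by (simp add: scalar_mult_eq_scaleR)
    also have "\<dots> = (\<Sum>j\<in>UNIV. z $ j *\<^sub>R W z (axis j 1))"
      by (simp add: linear_sum[OF W_lin[OF z]] linear_scale[OF W_lin[OF z]])
    finally show ?thesis using W_radial[OF z] by (simp add: w_def vec_eq_iff)
  qed
  have rotc: "rot i j z $ i = (if i = j then z $ i else 0) - z $ j" "rot i j z $ j = z $ i - (if i = j then z $ j else 0)" for i j
    by (auto simp: rot_def axis_def)
  \<comment> \<open>The diagonal \<open>i = j\<close>, where the field is zero, contributes nothing;
    this lowers the factor from \<open>CARD('m)\<close> to \<open>n\<close>.\<close>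
  have e1: "(\<Sum>i\<in>UNIV. \<Sum>j\<in>UNIV. rot i j z $ i * X z $ j - rot i j z $ j * X z $ i) = - 2 * n * (z \<bullet> X z)"
  proof -
    have "(\<Sum>i\<in>UNIV. \<Sum>j\<in>UNIV. rot i j z $ i * X z $ j - rot i j z $ j * X z $ i)
      = (\<Sum>i\<in>UNIV. \<Sum>j\<in>UNIV. (if i = j then 2 * (z $ i * X z $ i) else 0) - z $ j * X z $ j - z $ i * X z $ i)"
      unfolding rotc by (intro sum.cong refl) (auto simp: algebra_simps)
    also have "\<dots> = 2 * (z \<bullet> X z) - 2 * CARD('m) * (z \<bullet> X z)"
      by (simp add: sum_subtractf inner_vec_def flip: sum_distrib_left)
    also have "\<dots> = - 2 * n * (z \<bullet> X z)"
      using dim2 by (simp add: n_def of_nat_diff algebra_simps)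
    finally show ?thesis .
  qed
  have e2: "(\<Sum>i\<in>UNIV. \<Sum>j\<in>UNIV. z $ i * W z (rot i j z) $ j - z $ j * W z (rot i j z) $ i)
      = 2 * (z \<bullet> z) * div_X z"
  proof -
    have "(\<Sum>i\<in>UNIV. \<Sum>j\<in>UNIV. z $ i * W z (rot i j z) $ j - z $ j * W z (rot i j z) $ i)
       = (\<Sum>i\<in>UNIV. \<Sum>j\<in>UNIV. (z $ i * z $ i) * w j j + (z $ j * z $ j) * w i i
            - z $ j * (z $ i * w j i) - z $ i * (z $ j * w i j))"
      unfolding Wrot by (intro sum.cong refl) (simp add: algebra_simps)
    also have "\<dots> = (\<Sum>i\<in>UNIV. \<Sum>j\<in>UNIV. (z $ i * z $ i) * w j j) + (\<Sum>i\<in>UNIV. \<Sum>j\<in>UNIV. (z $ j * z $ j) * w i i)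
         - (\<Sum>i\<in>UNIV. \<Sum>j\<in>UNIV. z $ j * (z $ i * w j i)) - (\<Sum>i\<in>UNIV. \<Sum>j\<in>UNIV. z $ i * (z $ j * w i j))"
      by (simp add: sum.distrib sum_subtractf)
    also have "(\<Sum>i\<in>UNIV. \<Sum>j\<in>UNIV. z $ j * (z $ i * w j i)) = (\<Sum>i\<in>UNIV. \<Sum>j\<in>UNIV. z $ i * (z $ j * w i j))"
      by (rule sum.swap)
    also have "(\<Sum>i\<in>UNIV. \<Sum>j\<in>UNIV. z $ i * (z $ j * w i j)) = 0" by (simp add: Wz flip: sum_distrib_left)
    also have "(\<Sum>i\<in>UNIV. \<Sum>j\<in>UNIV. (z $ j * z $ j) * w i i) = (\<Sum>i\<in>UNIV. \<Sum>j\<in>UNIV. (z $ i * z $ i) * w j j)"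
      by (rule sum.swap)
    also have "(\<Sum>i\<in>UNIV. \<Sum>j\<in>UNIV. (z $ i * z $ i) * w j j) = (z \<bullet> z) * div_X z"
      by (simp add: inner_vec_def div_X_def w_def sum_product)
    finally show ?thesis by simp
  qed
  have "(\<Sum>i\<in>UNIV. \<Sum>j\<in>UNIV. u_rot i j z) =
     ((\<Sum>i\<in>UNIV. \<Sum>j\<in>UNIV. rot i j z $ i * X z $ j - rot i j z $ j * X z $ i) +
      (\<Sum>i\<in>UNIV. \<Sum>j\<in>UNIV. z $ i * W z (rot i j z) $ j - z $ j * W z (rot i j z) $ i)) / norm z"
    by (simp add: u_rot_def sum.distrib sum_subtractf flip: sum_divide_distrib)
  also have "\<dots> = 2 * ((z \<bullet> z) / norm z * div_X z - n * ((z \<bullet> X z) / norm z))"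
    unfolding e1 e2 using z by (simp add: field_simps)
  also have "(z \<bullet> z) / norm z = norm z" using z by (simp add: dot_square_norm power2_eq_square)
  also have "(z \<bullet> X z) / norm z = h z" by (simp add: h_def sgn_div_norm inner_commute divide_inverse)
  finally show ?thesis .
qed

lemma div_X_sgn: "z \<noteq> 0 \<Longrightarrow> div_X (sgn z) = norm z * div_X z"
  by (simp add: div_X_def W_sgn sum_distrib_left)

section \<open>The integral inequality and rigidity\<close>

lemma rho_le_trace: assumes z: "z \<noteq> 0" shows "n * rho z \<le> norm z * div_X z"
proof -
  have x0: "sgn z \<noteq> 0" using z by (simp add: sgn_zero_iff)
  have "rho z \<le> div_X (sgn z) / n"
    unfolding rho_def S_sgn[OF z] div_X_def n_def
    by (rule tangential_psd_det(2)[OF W_lin[OF x0] W_sym[OF x0] W_radial[OF x0] unit(1)[OF z] W_psd[OF x0] dim2])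
  then show ?thesis using n_pos z by (simp add: div_X_sgn field_simps)
qed

text \<open>Summing the vanishing integrals gives \<open>?P\<close> plus
  \<open>S z * (norm z * div_X z - n * h z)\<close> total integral 0. The second part has
  nonnegative integral: \<open>n\<close> times the volume is at most the integral of
  \<open>n * (rho z * S z)\<close>, hence at most that of the trace term. So the continuous
  nonnegative \<open>?P\<close> has integral at most 0 and vanishes pointwise.\<close>

lemma S_grad_X_zero: assumes z: "z \<in> D" shows "S_grad z \<bullet> X z = 0"
proof -
  let ?P = "\<lambda>z. norm z * (S_grad z \<bullet> X z)"
  have nc: "continuous_on (-{0}) (\<lambda>z::real^'m::_. norm z)" by (intro continuous_intros)
  have divc: "continuous_on (-{0}) div_X"
    unfolding div_X_def[abs_def] using W_cont by (intro continuous_intros)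
  have "((\<lambda>z. \<Sum>i\<in>UNIV. \<Sum>j\<in>UNIV. Su_rot i j z) has_integral (\<Sum>i\<in>(UNIV::'m set). \<Sum>j\<in>(UNIV::'m set). 0)) D"
    by (intro has_integral_sum Su_rot_integral) auto
  then have tot0: "((\<lambda>z. \<Sum>i\<in>UNIV. \<Sum>j\<in>UNIV. Su_rot i j z) has_integral 0) D" by simp
  have "((\<lambda>z. 2 * ?P z + S z * (2 * (norm z * div_X z - n * h z))) has_integral 0) D"
  proof (rule has_integral_eq[OF _ tot0])
    fix z assume "z \<in> D"
    then have z: "z \<noteq> 0" by simp
    show "(\<Sum>i\<in>UNIV. \<Sum>j\<in>UNIV. Su_rot i j z) = 2 * ?P z + S z * (2 * (norm z * div_X z - n * h z))"
      by (simp only: Su_rot_def sum.distrib sum_distrib_left[symmetric] sum_S_grad_u[OF z] sum_u_rot[OF z] mult.assoc)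
  qed
  then have tot: "((\<lambda>z. ?P z + S z * (norm z * div_X z - n * h z)) has_integral 0) D"
    by (auto dest: has_integral_divide[of _ 0 _ 2] simp: algebra_simps add_divide_distrib diff_divide_distrib)
  have Pc: "continuous_on (-{0}) ?P"
    using S_grad_cont X_cont nc by (intro continuous_intros)
  have Pint: "?P absolutely_integrable_on D"
    by (rule homogeneous_absolutely_integrable[OF Pc]) (simp add: S_grad_sgn X_sgn unit)
  have Tint: "(\<lambda>z. S z * (norm z * div_X z)) absolutely_integrable_on D"
    using S_cont divc nc by (intro homogeneous_absolutely_integrable continuous_intros) (simp_all add: S_sgn' div_X_sgn unit)
  have rint: "(\<lambda>z. rho z * S z) absolutely_integrable_on D"
    using rho_cont S_cont by (intro homogeneous_absolutely_integrable continuous_intros) (auto simp: rho_sgn S_sgn')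
  have hint: "(\<lambda>z. h z * S z) integrable_on D" "integral D (\<lambda>z. h z * S z) = measure lebesgue C"
    using volume_eq by (auto simp: has_integral_iff)
  have "n * integral D (\<lambda>z. h z * S z) \<le> n * integral D (\<lambda>z. rho z * S z)"
    unfolding hint(2) by (intro mult_left_mono volume_le) simp
  also have "\<dots> = integral D (\<lambda>z. n * (rho z * S z))" by simp
  also have "\<dots> \<le> integral D (\<lambda>z. S z * (norm z * div_X z))"
  proof (rule integral_le)
    fix z assume "z \<in> D"
    then have "z \<noteq> 0" by simp
    from mult_right_mono[OF rho_le_trace[OF this] less_imp_le[OF S_pos[OF this]]]
    show "n * (rho z * S z) \<le> S z * (norm z * div_X z)" by (simp add: mult_ac)
  qed (use rint Tint in \<open>auto simp: absolutely_integrable_on_def intro!: integrable_on_mult_right\<close>)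
  finally have le: "n * integral D (\<lambda>z. h z * S z) \<le> integral D (\<lambda>z. S z * (norm z * div_X z))" .
  have "((\<lambda>z. ?P z + (S z * (norm z * div_X z) - n * (h z * S z))) has_integral
      integral D ?P + (integral D (\<lambda>z. S z * (norm z * div_X z)) - n * integral D (\<lambda>z. h z * S z))) D"
    using Pint Tint hint by (intro has_integral_add has_integral_diff has_integral_mult_right integrable_integral)
      (auto simp: absolutely_integrable_on_def)
  then have "((\<lambda>z. ?P z + S z * (norm z * div_X z - n * h z)) has_integral
      integral D ?P + (integral D (\<lambda>z. S z * (norm z * div_X z)) - n * integral D (\<lambda>z. h z * S z))) D"
    by (simp add: algebra_simps)
  from has_integral_unique[OF this tot] le have "integral D ?P \<le> 0" by simp
  then have "?P z = 0"
    using Pint Pc S_grad_X_nonneg(1) z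
    by (intro nonneg_integral_zero_imp_zero[of D ?P z])
      (auto simp: absolutely_integrable_on_def open_Diff intro: continuous_on_subset)
  then show ?thesis using z by auto
qed

theorem frontier_is_sphere: "\<exists>r>0. frontier C = (\<lambda>x. r *\<^sub>R x) ` sphere 0 1"
proof -
  have radial: "X z = h z *\<^sub>R sgn z" if z: "z \<noteq> 0" for z
  proof -
    \<comment> \<open>\<open>S_grad_X_zero\<close> holds inside the unit ball; halving
      \<open>sgn z\<close> moves there without changing the direction or \<open>X\<close>.\<close>
    define x where "x = (1/2) *\<^sub>R sgn z"
    have x: "x \<in> D" "x \<noteq> 0" "X x = X z" "sgn x = sgn z"
      using z unit(1)[OF z] by (auto simp: x_def sgn_zero_iff X_scale X_sgn sgn_div_norm[of "(1/2) *\<^sub>R sgn z"])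
    have "W x (X x) = 0"
      using S_grad_X_nonneg(2)[OF x(2) S_grad_X_zero[OF x(1)]] W_psd_ker[OF x(2)] by blast
    moreover have "W x (sgn z) = 0"
      using linear_scale[OF W_lin[OF x(2)], of 2 x] W_radial[OF x(2)] by (simp add: x_def)
    ultimately have "W x (X z - h z *\<^sub>R sgn z) = 0"
      by (simp add: linear_diff[OF W_lin[OF x(2)]] linear_scale[OF W_lin[OF x(2)]] x(3))
    moreover have "x \<bullet> (X z - h z *\<^sub>R sgn z) = 0"
      using unit(2)[OF z] by (simp add: x_def h_def inner_diff_right inner_commute)
    ultimately show ?thesis using W_ker[OF x(2)] by fastforce
  qed
  \<comment> \<open>Connectedness of the punctured space is where dimension at least 2 enters; it
    makes \<open>h\<close> globally constant.\<close>
  have "connected (-{0::real^'m::_})"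
    using dim2 by (intro connected_punctured_universe) simp
  moreover have "(h has_derivative (\<lambda>v. 0)) (at z within -{0})" if "z \<in> -{0}" for z
  proof -
    have "h_grad z = 0" using radial[of z] that by (simp add: h_grad_def)
    then show ?thesis using h_deriv[of z] that by (auto intro: has_derivative_at_withinI)
  qed
  ultimately have "h constant_on -{0}"
    using h_cont by (intro has_derivative_zero_connected_constant_on[of "-{0::real^'m::_}" "{}"]) auto
  then obtain r where r: "\<And>z. z \<noteq> 0 \<Longrightarrow> h z = r" by (auto simp: constant_on_def)
  have Xr: "X x = r *\<^sub>R x" if "norm x = 1" for x
  proof -
    have "x \<noteq> 0" using that by auto
    then show ?thesis using radial[of x] r[of x] that by (simp add: sgn_div_norm)
  qed
  have fr: "frontier C = (\<lambda>x. r *\<^sub>R x) ` sphere 0 1"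
    unfolding frontier_C using Xr by (intro image_cong) auto
  moreover have "r > 0"
  proof -
    obtain a where a: "a \<in> interior C" using interior_C by blast
    obtain x :: "real^'m::_" where x: "norm x = 1" using vector_choose_size[of 1] by auto
    then have x0: "x \<noteq> 0" "-x \<noteq> 0" and sx: "sgn x = x" "sgn (-x) = -x"
      by (auto simp: sgn_div_norm)
    have "0 < r - a \<bullet> x" "0 < r + a \<bullet> x"
      using support_strict[OF a x0(1)] support_strict[OF a x0(2)] r[OF x0(1)] r[OF x0(2)]
      by (simp_all add: h_def inner_diff_left sx)
    then show ?thesis by linarith
  qed
  ultimately show ?thesis by blast
qed

end

section \<open>Arbitrary finite index types\<close>

text \<open>Conjugation by \<open>f\<close> is a sign-preserving bijection between the permutations
  of the two index types and matches the terms of the Leibniz formula.\<close>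

lemma det_reindex:
  fixes A :: "real^'n^'n" and f :: "'k::finite \<Rightarrow> 'n::finite"
  assumes f: "bij f"
  shows "det (\<chi> i j. A $ f i $ f j) = det A"
proof -
  let ?P = "\<lambda>p. map_permutation UNIV f p"
  have P: "?P p = f \<circ> p \<circ> inv f" for p
    using f by (simp add: map_permutation_def restrict_id_def bij_is_surj fun_eq_iff)
  have inv: "inv f (f i) = i" "f (inv f k) = k" for i k
    using f by (simp_all add: bij_is_inj bij_is_surj surj_f_inv_f)
  have prod_eq: "(\<Prod>i\<in>UNIV. A $ i $ ?P p i) = (\<Prod>i\<in>UNIV. A $ f i $ f (p i))" for p
    unfolding P by (rule prod.reindex_bij_betw[OF f, symmetric, THEN trans]) (simp add: inv)
  have "det A = (\<Sum>p | p permutes (UNIV::'k set). of_int (sign (?P p)) * (\<Prod>i\<in>UNIV. A $ i $ ?P p i))"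
    unfolding det_def
  proof (rule sum.reindex_bij_betw[symmetric])
    show "bij_betw ?P {p. p permutes (UNIV::'k set)} {p. p permutes (UNIV::'n set)}"
    proof (rule bij_betw_byWitness[where f' = "\<lambda>q. inv f \<circ> q \<circ> f"])
      show "?P ` {p. p permutes (UNIV::'k set)} \<subseteq> {p. p permutes (UNIV::'n set)}"
        using map_permutation_permutes f by auto
      show "(\<lambda>q. inv f \<circ> q \<circ> f) ` {p. p permutes (UNIV::'n set)} \<subseteq> {p. p permutes (UNIV::'k set)}"
        using f by (auto intro!: bij_imp_permutes bij_comp bij_imp_bij_inv dest: permutes_bij)
    qed (auto simp: P fun_eq_iff inv)
  qed
  also have "\<dots> = (\<Sum>p | p permutes (UNIV::'k set). of_int (sign p) * (\<Prod>i\<in>UNIV. A $ f i $ f (p i)))"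
    using f by (intro sum.cong refl) (simp add: prod_eq sign_map_permutation bij_is_inj)
  finally show ?thesis by (simp add: det_def)
qed

text \<open>The change-of-variables theorems of the library need a well-ordered index type; this copy of a
  finite type provides one.\<close>

typedef 'a wo = "UNIV :: 'a set" ..

definition wo_rank :: "'a::finite wo \<Rightarrow> nat" where
  "wo_rank x = (SOME f. inj f) (Rep_wo x)"

lemma inj_wo_rank: "inj (wo_rank :: 'a::finite wo \<Rightarrow> nat)"
proof -
  obtain f :: "'a \<Rightarrow> nat" where "inj f"
    using finite_imp_inj_to_nat_seg[OF finite[of UNIV]] by metis
  then have "inj (SOME f :: 'a \<Rightarrow> nat. inj f)" by (rule someI[of inj])
  show ?thesis
  proof (rule injI)
    fix x y :: "'a wo" assume "wo_rank x = wo_rank y"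
    then show "x = y" unfolding wo_rank_def using \<open>inj (SOME f. inj f)\<close> Rep_wo_inject by (metis injD)
  qed
qed

instantiation wo :: (finite) "{finite, wellorder}"
begin

definition "x \<le> y \<longleftrightarrow> wo_rank x \<le> wo_rank y"

definition "x < y \<longleftrightarrow> wo_rank x < wo_rank y"

instance
proof
  show "finite (UNIV :: 'a wo set)"
    unfolding type_definition.Abs_image[OF type_definition_wo, symmetric] by simp
  show "x = y" if "x \<le> y" "y \<le> x" for x y :: "'a wo"
    using that inj_wo_rank by (auto simp: less_eq_wo_def dest: injD)
  show "P a" if "\<And>x. (\<And>y. y < x \<Longrightarrow> P y) \<Longrightarrow> P x" for P and a :: "'a wo"
    using that unfolding less_wo_def by (induct a rule: measure_induct_rule[of wo_rank]) blast
qed (auto simp: less_eq_wo_def less_wo_def)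

end

section \<open>Transfer along a relabelling of coordinates\<close>

definition to_wo :: "real^'m \<Rightarrow> real^('m::finite) wo" where "to_wo v = (\<chi> i. v $ Rep_wo i)"

definition of_wo :: "real^('m::finite) wo \<Rightarrow> real^'m" where "of_wo w = (\<chi> i. w $ Abs_wo i)"

lemma bij_Rep_wo: "bij Rep_wo"
  by (rule bijI') (auto simp: Rep_wo_inject intro: Abs_wo_inverse[symmetric])

lemma to_of_wo [simp]: "to_wo (of_wo w) = w" "of_wo (to_wo v) = v"
  by (simp_all add: to_wo_def of_wo_def vec_eq_iff Rep_wo_inverse Abs_wo_inverse)

lemma linear_to_wo: "linear to_wo" and linear_of_wo: "linear of_wo"
  by (auto intro!: linearI simp: to_wo_def of_wo_def vec_eq_iff)

lemma to_wo_inner [simp]: "to_wo u \<bullet> to_wo v = u \<bullet> v"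
  unfolding inner_vec_def to_wo_def using sum.reindex_bij_betw[OF bij_Rep_wo, of "\<lambda>i. u $ i \<bullet> v $ i"] by simp

lemma of_wo_inner: "of_wo u \<bullet> v = u \<bullet> to_wo v"
  using to_wo_inner[of "of_wo u" v] by (simp only: to_of_wo)

lemma norm_to_wo [simp]: "norm (to_wo v) = norm v" and norm_of_wo [simp]: "norm (of_wo w) = norm w"
  using of_wo_inner[of w "of_wo w"] by (simp_all only: norm_eq_sqrt_inner to_wo_inner to_of_wo)

lemma wo_eq_0 [simp]: "to_wo v = 0 \<longleftrightarrow> v = 0" "of_wo w = 0 \<longleftrightarrow> w = 0"
  by (metis norm_to_wo norm_eq_zero) (metis norm_of_wo norm_eq_zero)

lemma to_wo_sphere: "to_wo ` sphere 0 1 = sphere 0 1" and of_wo_sphere: "of_wo ` sphere 0 1 = sphere 0 1"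
  by (auto intro: image_eqI[where x = "of_wo _"] image_eqI[where x = "to_wo _"])

lemma det_wo:
  "det (matrix (\<lambda>v. to_wo (f (of_wo v)))) = det (matrix f)"
proof -
  have "of_wo (axis j 1) = axis (Rep_wo j) 1" for j :: "'a wo"
    by (auto simp: of_wo_def axis_def vec_eq_iff Abs_wo_inverse Rep_wo_inverse)
  then have "matrix (\<lambda>v. to_wo (f (of_wo v))) = (\<chi> i j. matrix f $ Rep_wo i $ Rep_wo j)"
    by (simp add: matrix_def to_wo_def)
  then show ?thesis using det_reindex[OF bij_Rep_wo] by simp
qed

lemma bij_to_wo: "bij to_wo"
  by (rule o_bij[of of_wo]) (auto simp: fun_eq_iff)

lemma CARD_wo: "CARD('m wo) = CARD('m::finite)"
  using bij_betw_same_card[OF bij_Rep_wo] .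

lemma gauss_inverse_wo:
  assumes "gauss_inverse C X W"
  shows "gauss_inverse (to_wo ` C) (\<lambda>z. to_wo (X (of_wo z))) (\<lambda>z v. to_wo (W (of_wo z) (of_wo v)))"
proof -
  interpret gauss_inverse C X W by fact
  have bl: "bounded_linear to_wo" "bounded_linear of_wo"
    using linear_to_wo linear_of_wo by (simp_all add: linear_conv_bounded_linear)
  have cont_of: "continuous_on T of_wo" for T using bl(2) by (rule bounded_linear.continuous_on) (rule continuous_on_id)
  have cont_to: "continuous_on T f \<Longrightarrow> continuous_on T (\<lambda>z. to_wo (f z))"
    for f :: "real^'a wo \<Rightarrow> real^'a" and T using bl(1) by (rule bounded_linear.continuous_on)
  have int: "interior (to_wo ` C) = to_wo ` interior C"
    by (rule interior_bijective_linear_image[OF linear_to_wo bij_to_wo])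
  show ?thesis
  proof
    show "CARD('a wo) \<ge> 2" using dim2 by (simp add: CARD_wo)
    show "compact (to_wo ` C)" by (rule compact_continuous_image[OF linear_continuous_on[OF bl(1)] compact_C])
    show "convex (to_wo ` C)" using linear_to_wo convex_C by (rule convex_linear_image)
    show "interior (to_wo ` C) \<noteq> {}" unfolding int using interior_C by simp
    have "frontier (to_wo ` C) = to_wo ` frontier C"
      unfolding frontier_def int
      by (simp only: closure_injective_linear_image[OF linear_to_wo bij_is_inj[OF bij_to_wo]]
          image_set_diff[OF bij_is_inj[OF bij_to_wo]])
    also have "\<dots> = (\<lambda>z. to_wo (X (of_wo z))) ` to_wo ` sphere 0 1"
      unfolding frontier_C by (simp add: image_image)
    also have "to_wo ` sphere 0 1 = sphere 0 1" by (rule to_wo_sphere)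
    finally show "frontier (to_wo ` C) = (\<lambda>z. to_wo (X (of_wo z))) ` sphere 0 1" .
    show "continuous_on (- {0}) (\<lambda>z. to_wo (W (of_wo z) (of_wo v)))" for v
      by (intro cont_to continuous_on_compose2[OF W_cont cont_of]) auto
    show "((\<lambda>z. to_wo (X (of_wo z))) has_derivative (\<lambda>v. to_wo (W (of_wo z) (of_wo v)))) (at z)" if "z \<noteq> 0" for z
    proof -
      have "(of_wo has_derivative of_wo) (at z)" by (rule bounded_linear_imp_has_derivative[OF bl(2)])
      from has_derivative_compose[OF this X_deriv] that
      have "((\<lambda>z. X (of_wo z)) has_derivative (\<lambda>v. W (of_wo z) (of_wo v))) (at z)" by simp
      then show ?thesis by (rule bounded_linear.has_derivative[OF bl(1)])
    qed
  next
    fix x y :: "real^'a wo" assume *: "norm x = 1" "norm y = 1" "to_wo (X (of_wo x)) = to_wo (X (of_wo y))"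
    then have "X (of_wo x) = X (of_wo y)" by (metis to_of_wo(2))
    then have "of_wo x = of_wo y" using X_inj[of "of_wo x" "of_wo y"] * by simp
    then show "x = y" by (metis to_of_wo(1))
  next
    fix x v :: "real^'a wo" assume *: "norm x = 1" "to_wo (W (of_wo x) (of_wo v)) = 0" "x \<bullet> v = 0"
    have "of_wo x \<bullet> of_wo v = 0" using *(3) by (simp add: of_wo_inner)
    then show "v = 0" using W_ker1[of "of_wo x" "of_wo v"] * by simp
  next
    fix z y :: "real^'a wo" assume "z \<noteq> 0" "y \<in> to_wo ` C"
    then obtain y' where "y = to_wo y'" "y' \<in> C" by auto
    then show "y \<bullet> z \<le> to_wo (X (of_wo z)) \<bullet> z"
      using support[of "of_wo z" y'] \<open>z \<noteq> 0\<close> by (simp add: of_wo_inner[symmetric] inner_commute)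
  qed (use X_mem X_scale in \<open>auto simp: linear_scale[OF linear_of_wo]\<close>)
qed

text \<open>The relabelling of coordinates is a linear isometry that also preserves determinants, so
  all data pass to the well-ordered copy and the sphere found there pulls back.\<close>

theorem (in gauss_inverse) isotropic_curvature_sphere:
  assumes "\<And>x. norm x = 1 \<Longrightarrow> (g has_real_derivative g' (X x \<bullet> x)) (at (X x \<bullet> x))"
    and "\<And>x. norm x = 1 \<Longrightarrow> g (X x \<bullet> x) > 0"
    and "\<And>x. norm x = 1 \<Longrightarrow> g' (X x \<bullet> x) \<ge> 0"
    and "continuous_on ((\<lambda>x. X x \<bullet> x) ` sphere 0 1) g'"
    and "\<And>x. norm x = 1 \<Longrightarrow> det (matrix (\<lambda>v. W x v + (x \<bullet> v) *\<^sub>R x))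
            = g (X x \<bullet> x) * exp ((norm (X x))\<^sup>2 / 2) / c"
  shows "\<exists>r>0. frontier C = (\<lambda>x. r *\<^sub>R x) ` sphere 0 1"
proof -
  interpret wo: gauss_inverse "to_wo ` C" "\<lambda>z. to_wo (X (of_wo z))" "\<lambda>z v. to_wo (W (of_wo z) (of_wo v))"
    by (rule gauss_inverse_wo) unfold_locales
  have sgn: "sgn x = x" if "norm x = 1" for x :: "real^'m wo"
    using that by (simp add: sgn_div_norm)
  have h: "wo.h x = X (of_wo x) \<bullet> of_wo x" if "norm x = 1" for x
    using that by (simp add: wo.h_def sgn of_wo_inner[symmetric] inner_commute)
  have img: "wo.h ` sphere 0 1 = (\<lambda>x. X x \<bullet> x) ` sphere 0 1"
  proof -
    have "wo.h ` sphere 0 1 = (\<lambda>x. X x \<bullet> x) ` of_wo ` sphere 0 1"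
      unfolding image_image by (intro image_cong) (auto simp: h)
    then show ?thesis by (simp add: of_wo_sphere)
  qed
  have S: "wo.S x = det (matrix (\<lambda>v. W (of_wo x) v + (of_wo x \<bullet> v) *\<^sub>R of_wo x))" if "norm x = 1" for x
  proof -
    have "(\<lambda>v. norm x *\<^sub>R to_wo (W (of_wo x) (of_wo v)) + (sgn x \<bullet> v) *\<^sub>R sgn x)
      = (\<lambda>v. to_wo ((\<lambda>v. W (of_wo x) v + (of_wo x \<bullet> v) *\<^sub>R of_wo x) (of_wo v)))"
      using that by (simp add: sgn linear_add[OF linear_to_wo] linear_scale[OF linear_to_wo] of_wo_inner)
    then show ?thesis unfolding wo.S_def
      using det_wo[of "\<lambda>v. W (of_wo x) v + (of_wo x \<bullet> v) *\<^sub>R of_wo x"] by simp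
  qed
  interpret wo: gauss_curvature_eq "to_wo ` C" "\<lambda>z. to_wo (X (of_wo z))" "\<lambda>z v. to_wo (W (of_wo z) (of_wo v))" g g' c
  proof unfold_locales
    fix x :: "real^'m wo" assume x: "norm x = 1"
    then have n: "norm (of_wo x) = 1" by simp
    show "(g has_real_derivative g' (wo.h x)) (at (wo.h x))" "g (wo.h x) > 0" "g' (wo.h x) \<ge> 0"
      using assms(1-3)[OF n] by (simp_all add: h[OF x])
    show "wo.S x = g (wo.h x) * exp ((norm (to_wo (X (of_wo x))))\<^sup>2 / 2) / c"
      using assms(5)[OF n] by (simp add: h[OF x] S[OF x])
  qed (use assms(4) img in simp)
  obtain r where r: "r > 0" "frontier (to_wo ` C) = (\<lambda>x. r *\<^sub>R x) ` sphere 0 1"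
    using wo.frontier_is_sphere by blast
  have "frontier C = X ` of_wo ` sphere 0 1" by (simp only: frontier_C of_wo_sphere)
  also have "\<dots> = of_wo ` frontier (to_wo ` C)" by (simp only: wo.frontier_C image_image to_of_wo)
  also have "\<dots> = (\<lambda>x. r *\<^sub>R x) ` of_wo ` sphere 0 1"
    unfolding r(2) image_image by (simp add: linear_scale[OF linear_of_wo])
  finally have "frontier C = (\<lambda>x. r *\<^sub>R x) ` sphere 0 1" unfolding of_wo_sphere .
  then show ?thesis using r(1) by blast
qed

section \<open>Tangent directions and smooth level sets\<close>

text \<open>The Bouligand tangent cone. A derivative within \<open>M\<close> is determined on these
  directions, while \<open>frechet_derivative\<close> picks one of possibly many linear
  maps.\<close>

definition tangent_dir :: "'a::real_normed_vector set \<Rightarrow> 'a \<Rightarrow> 'a \<Rightarrow> bool" where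
  "tangent_dir M y v \<longleftrightarrow> (\<forall>e>0. \<exists>t w. 0 < t \<and> t < e \<and> norm (w - v) < e \<and> y + t *\<^sub>R w \<in> M)"

text \<open>On a short segment through \<open>y + t *\<^sub>R v\<close> in direction
  \<open>G\<close> the function \<open>F\<close> changes sign, so the intermediate value theorem
  yields a point of \<open>M\<close> close to the tangent line.\<close>

lemma tangent_dir_level_set:
  fixes F :: "'a::real_inner \<Rightarrow> real"
  assumes U: "open U" "y \<in> U" and F: "continuous_on U F" "(F has_derivative (\<lambda>v. G \<bullet> v)) (at y)"
    and y: "F y = 0" and M: "{z \<in> U. F z = 0} \<subseteq> M" and G: "G \<noteq> 0" "G \<bullet> v = 0"
  shows "tangent_dir M y v"
  unfolding tangent_dir_def
proof (intro allI impI)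
  fix e :: real assume e: "e > 0"
  \<comment> \<open>Half the tolerance, so that a displacement by at most
    \<open>d *\<^sub>R G\<close> changes the direction by less than \<open>e\<close>.\<close>
  define d where "d = e / (2 * norm G)"
  have d: "d > 0" "d * norm G < e" using e G by (auto simp: d_def)
  obtain r where r: "r > 0" "ball y r \<subseteq> U" using U open_contains_ball by metis
  have at0: "(F has_derivative (\<lambda>v. G \<bullet> v)) (at (y + 0 *\<^sub>R w))" for w using F(2) by simp
  have p: "0 < G \<bullet> (v + d *\<^sub>R G)" "G \<bullet> (v - d *\<^sub>R G) < 0" using d G by (auto simp: inner_add_right inner_diff_right)
  obtain d1 where d1: "d1 > 0" "\<And>t. 0 < t \<Longrightarrow> t < d1 \<Longrightarrow> 0 < F (y + t *\<^sub>R (v + d *\<^sub>R G))"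
    using DERIV_pos_inc_right[OF has_real_derivative_along_line[OF at0] p(1)] y by auto
  obtain d2 where d2: "d2 > 0" "\<And>t. 0 < t \<Longrightarrow> t < d2 \<Longrightarrow> F (y + t *\<^sub>R (v - d *\<^sub>R G)) < 0"
    using DERIV_neg_dec_right[OF has_real_derivative_along_line[OF at0] p(2)] y by auto
  define m where "m = norm v + e + 1"
  have m: "m > 0" using e by (simp add: m_def add_nonneg_pos)
  \<comment> \<open>Below \<open>t0\<close> the end points have the required signs, the step is
    smaller than \<open>e\<close>, and the segment stays in the ball of radius
    \<open>r\<close>.\<close>
  define t0 where "t0 = min (min d1 d2) (min e (r / m))"
  have "0 < t0" "t0 \<le> d1" "t0 \<le> d2" "t0 \<le> e" "t0 \<le> r / m"
    using d1(1) d2(1) e r m by (auto simp: t0_def)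
  then obtain t where t: "0 < t" "t < d1" "t < d2" "t < e" "t < r / m"
    using dense[of 0 t0] by (meson less_le_trans)
  have inU: "y + t *\<^sub>R (v + s *\<^sub>R G) \<in> U" if "\<bar>s\<bar> \<le> d" for s
  proof (rule subsetD[OF r(2)])
    have "norm (v + s *\<^sub>R G) \<le> norm v + \<bar>s\<bar> * norm G" by (metis norm_scaleR norm_triangle_ineq)
    also have "\<dots> \<le> norm v + d * norm G" using that by (simp add: mult_right_mono)
    also have "\<dots> < m" using d by (simp add: m_def)
    finally have "t * norm (v + s *\<^sub>R G) < t * m" using t by simp
    also have "\<dots> < r" using t m by (simp add: field_simps)
    finally show "y + t *\<^sub>R (v + s *\<^sub>R G) \<in> ball y r" using t by (simp add: dist_norm)
  qed
  have "\<exists>s\<ge>-d. s \<le> d \<and> F (y + t *\<^sub>R (v + s *\<^sub>R G)) = 0"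
  proof (rule IVT')
    show "continuous_on {-d..d} (\<lambda>s. F (y + t *\<^sub>R (v + s *\<^sub>R G)))"
      by (rule continuous_on_compose2[OF F(1)]) (auto intro!: continuous_intros inU)
    show "F (y + t *\<^sub>R (v + - d *\<^sub>R G)) \<le> 0" using d2(2)[of t] t by simp
    show "0 \<le> F (y + t *\<^sub>R (v + d *\<^sub>R G))" using d1(2)[of t] t by simp
  qed (use d in simp)
  then obtain s where "- d \<le> s" "s \<le> d" and s0: "F (y + t *\<^sub>R (v + s *\<^sub>R G)) = 0" by auto
  then have s: "\<bar>s\<bar> \<le> d" "F (y + t *\<^sub>R (v + s *\<^sub>R G)) = 0" by auto
  have "y + t *\<^sub>R (v + s *\<^sub>R G) \<in> M" using M inU[OF s(1)] s(2) by auto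
  moreover have "norm (v + s *\<^sub>R G - v) < e"
    using s(1) d by simp (meson le_less_trans mult_right_mono norm_ge_zero)
  ultimately show "\<exists>t w. 0 < t \<and> t < e \<and> norm (w - v) < e \<and> y + t *\<^sub>R w \<in> M" using t by blast
qed

text \<open>The difference of two derivatives is of smaller order than \<open>norm (z - y)\<close>
  along \<open>M\<close>; points of \<open>M\<close> approaching in direction \<open>v\<close> force
  it to vanish at \<open>v\<close>.\<close>

lemma tangent_dir_derivative_unique:
  assumes f: "(f has_derivative f1) (at y within M)" "(f has_derivative f2) (at y within M)"
    and v: "tangent_dir M y v"
  shows "f1 v = f2 v"
proof (rule ccontr)
  assume ne: "f1 v \<noteq> f2 v"
  define d where "d v = f1 v - f2 v" for v
  have "((\<lambda>x. f x - f x) has_derivative d) (at y within M)"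
    unfolding d_def[abs_def] using f by (rule has_derivative_diff)
  then have bl: "bounded_linear d"
    and lim: "\<And>e. e > 0 \<Longrightarrow> \<exists>\<delta>>0. \<forall>z\<in>M. norm (z - y) < \<delta> \<longrightarrow> norm (d (z - y)) \<le> e * norm (z - y)"
    by (auto simp: has_derivative_within_alt)
  interpret d: bounded_linear d by fact
  obtain K where K: "K > 0" "\<And>w. norm (d w) \<le> norm w * K" using d.pos_bounded by metis
  define q where "q = norm (d v)"
  have q: "q > 0" using ne by (simp add: q_def d_def)
  define m where "m = norm v + 1"
  have m: "m > 0" by (simp add: m_def add_nonneg_pos)
  obtain \<delta> where \<delta>: "\<delta> > 0" "\<And>z. z \<in> M \<Longrightarrow> norm (z - y) < \<delta> \<Longrightarrow> norm (d (z - y)) \<le> q / (2 * m) * norm (z - y)"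
    using lim[of "q / (2 * m)"] q m by auto
  \<comment> \<open>The three bounds give \<open>norm w < m\<close>, an error below
    \<open>q / 4\<close> in replacing \<open>w\<close> by \<open>v\<close>, and a point within
    \<open>\<delta>\<close> of \<open>y\<close>; together they yield
    \<open>q < q / 2 + q / 4\<close>.\<close>
  define e where "e = min (min 1 (q / (4 * K))) (\<delta> / m)"
  have e: "e > 0" using q K \<delta> m by (simp add: e_def)
  obtain t w where tw: "0 < t" "t < e" "norm (w - v) < e" "y + t *\<^sub>R w \<in> M"
    using v e by (auto simp: tangent_dir_def)
  have "norm w \<le> norm v + norm (w - v)" by (metis norm_triangle_sub)
  then have w: "norm w < m" using tw(3) by (simp add: m_def e_def)
  have "t * norm w \<le> t * m" using w tw by simp
  also have "\<dots> < \<delta>" using tw(2) m by (simp add: e_def pos_less_divide_eq)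
  finally have "norm (d (t *\<^sub>R w)) \<le> q / (2 * m) * norm (t *\<^sub>R w)"
    using \<delta>(2)[OF tw(4)] tw(1) by simp
  then have "t * norm (d w) \<le> t * (q / (2 * m) * norm w)" using tw(1) by (simp add: d.scaleR mult_ac)
  then have "norm (d w) \<le> q / (2 * m) * norm w" using tw(1) by (simp only: mult_le_cancel_left_pos)
  also have "\<dots> \<le> q / (2 * m) * m" using w q m by (intro mult_left_mono) auto
  also have "\<dots> = q / 2" using m by simp
  finally have 1: "norm (d w) \<le> q / 2" .
  have "norm (d (w - v)) \<le> norm (w - v) * K" by (rule K(2))
  also have "\<dots> < q / (4 * K) * K" using tw(3) K(1) by (intro mult_strict_right_mono) (auto simp: e_def)
  also have "\<dots> = q / 4" using K by simp
  finally have 2: "norm (d (w - v)) < q / 4" .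
  have "q \<le> norm (d w) + norm (d (w - v))"
    unfolding q_def d.diff by (metis norm_triangle_sub norm_minus_commute add.commute)
  then show False using 1 2 q by simp
qed

lemma frechet_derivative_tangent_eq:
  assumes "(f has_derivative f') (at y within M)" "tangent_dir M y v"
  shows "frechet_derivative f (at y within M) v = f' v"
proof -
  have "(f has_derivative frechet_derivative f (at y within M)) (at y within M)"
    using assms(1) differentiableI frechet_derivative_works by blast
  then show ?thesis using tangent_dir_derivative_unique assms by blast
qed

lemma has_derivative_within_local_cong:
  assumes "(f has_derivative f') (at y within M)" "open U" "y \<in> M \<inter> U" "\<And>x. x \<in> M \<inter> U \<Longrightarrow> f x = g x"
  shows "(g has_derivative f') (at y within M)"
proof (rule has_derivative_transform_eventually[OF assms(1)])
  show "\<forall>\<^sub>F x in at y within M. f x = g x"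
    unfolding eventually_at_topological using assms(2-4) by blast
qed (use assms in auto)

lemma tangent_dir_support:
  fixes u :: "'a::real_inner"
  assumes v: "tangent_dir M y v" and u: "\<And>z. z \<in> M \<Longrightarrow> (z - y) \<bullet> u \<le> 0"
  shows "v \<bullet> u \<le> 0"
proof (rule ccontr)
  assume "\<not> v \<bullet> u \<le> 0"
  then have pos: "v \<bullet> u > 0" by simp
  then have nu: "norm u > 0" by auto
  obtain t w where tw: "0 < t" "norm (w - v) < v \<bullet> u / norm u" "y + t *\<^sub>R w \<in> M"
    using v divide_pos_pos[OF pos nu] unfolding tangent_dir_def by metis
  have "t * (w \<bullet> u) \<le> 0" using u[OF tw(3)] by simp
  then have "w \<bullet> u \<le> 0" using tw(1) by (simp add: mult_le_0_iff)
  moreover have "\<bar>(w - v) \<bullet> u\<bar> < v \<bullet> u"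
    using Cauchy_Schwarz_ineq2[of "w - v" u] tw(2) nu by (simp add: pos_less_divide_eq)
  ultimately show False by (simp add: inner_diff_left)
qed

lemma tangent_dir_sphere:
  fixes x v :: "'a::real_inner"
  assumes "norm x = 1" "v \<bullet> x = 0"
  shows "tangent_dir (sphere 0 1) x v"
proof (rule tangent_dir_level_set[of UNIV x "\<lambda>z. z \<bullet> z - 1" "2 *\<^sub>R x"])
  show "((\<lambda>z. z \<bullet> z - 1) has_derivative (\<lambda>v. (2 *\<^sub>R x) \<bullet> v)) (at x)"
    by (auto intro!: derivative_eq_intros simp: inner_commute)
  show "continuous_on UNIV (\<lambda>z::'a. z \<bullet> z - 1)" by (intro continuous_intros)
qed (use assms in \<open>auto simp: norm_eq_1 inner_commute\<close>)

text \<open>\<open>smooth_on\<close> speaks of partial derivatives along \<open>Basis\<close>; two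
  orders of them are assembled into a gradient and its total derivative.\<close>

lemma smooth_on_gradient:
  fixes F :: "'a::euclidean_space \<Rightarrow> real"
  assumes U: "open U" and F: "smooth_on F U"
  obtains G G' where "\<And>z. z \<in> U \<Longrightarrow> (F has_derivative (\<lambda>v. G z \<bullet> v)) (at z)"
    "\<And>z. z \<in> U \<Longrightarrow> (G has_derivative G' z) (at z)" "\<And>v. continuous_on U (\<lambda>z. G' z v)"
proof -
  define DF where "DF b = (\<lambda>x. frechet_derivative F (at x) b)" for b
  define DDF where "DDF b c = (\<lambda>x. frechet_derivative (DF b) (at x) c)" for b c
  have C: "Ck_on (Suc (Suc 0)) F U" using F by (simp add: smooth_on_def del: Ck_on.simps)
  have d1: "F differentiable_on U" and d2: "\<And>b. b \<in> Basis \<Longrightarrow> DF b differentiable_on U"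
    and d3: "\<And>b c. b \<in> Basis \<Longrightarrow> c \<in> Basis \<Longrightarrow> continuous_on U (DDF b c)"
    using C by (auto simp: DF_def DDF_def)
  have F': "(F has_derivative frechet_derivative F (at z)) (at z)" if "z \<in> U" for z
    using d1 that U by (metis at_within_open differentiable_on_def frechet_derivative_works)
  have DF': "(DF b has_derivative frechet_derivative (DF b) (at z)) (at z)" if "z \<in> U" "b \<in> Basis" for z b
    using d2[OF that(2)] that(1) U by (metis at_within_open differentiable_on_def frechet_derivative_works)
  define G where "G z = (\<Sum>b\<in>Basis. DF b z *\<^sub>R b)" for z
  define G' where "G' z v = (\<Sum>b\<in>Basis. frechet_derivative (DF b) (at z) v *\<^sub>R b)" for z v
  show ?thesis
  proof
    fix z assume z: "z \<in> U"
    have "frechet_derivative F (at z) v = G z \<bullet> v" for v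
    proof -
      have lin: "linear (frechet_derivative F (at z))" using F'[OF z] has_derivative_linear by blast
      have "frechet_derivative F (at z) v = frechet_derivative F (at z) (\<Sum>b\<in>Basis. (v \<bullet> b) *\<^sub>R b)"
        by (simp add: euclidean_representation)
      also have "\<dots> = (\<Sum>b\<in>Basis. (v \<bullet> b) * DF b z)"
        by (simp add: linear_sum[OF lin] linear_scale[OF lin] DF_def)
      finally show ?thesis by (simp add: G_def inner_sum_left inner_commute[of v] mult.commute)
    qed
    then have "frechet_derivative F (at z) = (\<lambda>v. G z \<bullet> v)" by (rule ext)
    then show "(F has_derivative (\<lambda>v. G z \<bullet> v)) (at z)" using F'[OF z] by simp
    show "(G has_derivative G' z) (at z)"
      unfolding G_def[abs_def] G'_def[abs_def]
      by (intro has_derivative_sum has_derivative_scaleR_left DF' z)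
  next
    fix v
    have "continuous_on U (\<lambda>z. \<Sum>b\<in>Basis. (\<Sum>c\<in>Basis. (v \<bullet> c) *\<^sub>R DDF b c z) *\<^sub>R b)"
      by (intro continuous_intros d3)
    moreover have "(\<Sum>b\<in>Basis. (\<Sum>c\<in>Basis. (v \<bullet> c) *\<^sub>R DDF b c z) *\<^sub>R b) = G' z v" if "z \<in> U" for z
      unfolding G'_def
    proof (intro sum.cong refl arg_cong2[where f = scaleR])
      fix b :: 'a assume b: "b \<in> Basis"
      have lin: "linear (frechet_derivative (DF b) (at z))" using DF'[OF that b] has_derivative_linear by blast
      have "frechet_derivative (DF b) (at z) v = frechet_derivative (DF b) (at z) (\<Sum>c\<in>Basis. (v \<bullet> c) *\<^sub>R c)"
        by (simp add: euclidean_representation)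
      then show "(\<Sum>c\<in>Basis. (v \<bullet> c) *\<^sub>R DDF b c z) = frechet_derivative (DF b) (at z) v"
        by (simp add: linear_sum[OF lin] linear_scale[OF lin] DDF_def)
    qed
    ultimately show "continuous_on U (\<lambda>z. G' z v)" by (subst continuous_on_cong[OF refl, symmetric]) auto
  qed
qed

lemma continuous_on_det:
  fixes A :: "'a::topological_space \<Rightarrow> real^'n^'n"
  assumes "\<And>i j. continuous_on U (\<lambda>z. A z $ i $ j)"
  shows "continuous_on U (\<lambda>z. det (A z))"
  unfolding det_def
  by (intro continuous_on_sum continuous_on_mult continuous_on_const continuous_on_prod assms)

text \<open>Cramer's rule writes the solution as a quotient of determinants whose entries are
  continuous.\<close>

lemma continuous_on_linear_solution:
  fixes A :: "'a::topological_space \<Rightarrow> real^'n \<Rightarrow> real^'n"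
  assumes lin: "\<And>z. z \<in> U \<Longrightarrow> linear (A z)" and inj: "\<And>z v. z \<in> U \<Longrightarrow> A z v = 0 \<Longrightarrow> v = 0"
    and A: "\<And>v. continuous_on U (\<lambda>z. A z v)" and b: "continuous_on U b"
    and w: "\<And>z. z \<in> U \<Longrightarrow> A z (w z) = b z"
  shows "continuous_on U w"
proof -
  let ?A = "\<lambda>z. matrix (A z)"
  have detA: "det (?A z) \<noteq> 0" if "z \<in> U" for z
    using lin[OF that] inj[OF that] by (simp add: det_nz_iff_inj linear_injective_0)
  have eq: "w z = (\<chi> k. det (\<chi> i j. if j = k then b z $ i else ?A z $ i $ j) / det (?A z))" if "z \<in> U" for z
    using cramer[OF detA[OF that], of "w z" "b z"] matrix_works[of "A z" "w z"] lin[OF that] w[OF that] by simp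
  have ent: "continuous_on U (\<lambda>z. ?A z $ i $ j)" for i j
    unfolding matrix_def using A by (auto intro!: continuous_intros)
  have "continuous_on U (\<lambda>z. (\<chi> k. det (\<chi> i j. if j = k then b z $ i else ?A z $ i $ j) / det (?A z)))"
  proof (rule continuous_on_vec_lambda)
    fix k
    have "continuous_on U (\<lambda>z. det (\<chi> i j. if j = k then b z $ i else ?A z $ i $ j))"
    proof (rule continuous_on_det)
      fix i j show "continuous_on U (\<lambda>z. (\<chi> i j. if j = k then b z $ i else ?A z $ i $ j) $ i $ j)"
        using b ent by (cases "j = k") (auto intro!: continuous_intros)
    qed
    then show "continuous_on U (\<lambda>z. det (\<chi> i j. if j = k then b z $ i else ?A z $ i $ j) / det (?A z))"
      using detA by (intro continuous_on_divide[OF _ continuous_on_det[OF ent]]) auto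
  qed
  then show ?thesis using eq by (subst continuous_on_cong[OF refl]) auto
qed

section \<open>The Gauss map of a strictly convex hypersurface\<close>

lemma supporting_normal_exists:
  fixes C :: "'a::euclidean_space set"
  assumes "convex C" "interior C \<noteq> {}" "y \<in> frontier C"
  obtains u where "norm u = 1" "\<And>z. z \<in> closure C \<Longrightarrow> (z - y) \<bullet> u \<le> 0"
proof -
  have "y \<in> closure C" "y \<notin> rel_interior C"
    using assms by (auto simp: frontier_def rel_interior_nonempty_interior)
  then obtain a where a: "a \<noteq> 0" "\<And>z. z \<in> closure C \<Longrightarrow> a \<bullet> y \<le> a \<bullet> z"
    using supporting_hyperplane_relative_frontier[OF assms(1)] by metis
  show ?thesis
  proof
    \<comment> \<open>The supporting functional \<open>a\<close> is smallest at \<open>y\<close>,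
      hence an inner normal; the sign is reversed.\<close>
    show "norm (- sgn a) = 1" using a(1) by (simp add: norm_sgn)
    fix z assume "z \<in> closure C"
    from a(2)[OF this] show "(z - y) \<bullet> (- sgn a) \<le> 0"
      using a(1) by (simp add: sgn_div_norm inner_diff_left inner_diff_right inner_commute divide_simps)
  qed
qed

locale convex_hypersurface =
  fixes M C :: "(real^'m) set"
  assumes dim2: "CARD('m) \<ge> 2" and body: "convex_body C" and frontier: "M = frontier C"
    and smooth: "smooth_hypersurface M" and curved: "\<And>y. y \<in> M \<Longrightarrow> gauss_curvature M y > 0"
begin

lemma C_facts: "compact C" "convex C" "interior C \<noteq> {}" "closed C" "bounded C"
  using body by (auto simp: convex_body_def compact_imp_closed compact_imp_bounded)

lemma compact_M: "compact M"
  unfolding frontier using C_facts by (intro compact_frontier)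

lemma M_subset: "M \<subseteq> C"
  unfolding frontier using C_facts(4) by (simp add: frontier_subset_closed)

lemma C_cases: "z \<in> C \<Longrightarrow> z \<in> interior C \<or> z \<in> M"
  unfolding frontier frontier_def using closure_subset by auto

text \<open>From an interior point the ray in direction \<open>u\<close> reaches the frontier at a
  strictly greater height, so a bound tested on \<open>M\<close> holds on all of
  \<open>C\<close>.\<close>

lemma extend_support:
  assumes u: "norm u = 1" "\<And>z. z \<in> M \<Longrightarrow> z \<bullet> u \<le> k" and z: "z \<in> C"
  shows "z \<bullet> u \<le> k" and "z \<in> interior C \<Longrightarrow> z \<bullet> u < k"
proof -
  have strict: "z \<bullet> u < k" if zi: "z \<in> interior C"
  proof -
    obtain d where d: "d > 0" "z + d *\<^sub>R u \<in> frontier C"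
      by (rule ray_to_frontier[of C z u]) (use C_facts zi u that in auto)
    then have "(z + d *\<^sub>R u) \<bullet> u \<le> k" using u(2) frontier by blast
    then show ?thesis using d u by (simp add: inner_add_left norm_eq_1)
  qed
  then show "z \<in> interior C \<Longrightarrow> z \<bullet> u < k" .
  show "z \<bullet> u \<le> k" using strict u(2) C_cases[OF z] by fastforce
qed

lemma chart:
  assumes "y \<in> M"
  obtains U F G G' where "open U" "y \<in> U" "\<And>z. z \<in> U \<Longrightarrow> (F has_derivative (\<lambda>v. G z \<bullet> v)) (at z)"
    "\<And>z. z \<in> U \<Longrightarrow> (G has_derivative G' z) (at z)" "\<And>v. continuous_on U (\<lambda>z. G' z v)"
    "M \<inter> U = {z \<in> U. F z = (0::real)}" "\<And>z. z \<in> M \<inter> U \<Longrightarrow> G z \<noteq> 0"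
proof -
  obtain U and F :: "real^'m \<Rightarrow> real" where U: "open U" "y \<in> U" "smooth_on F U"
    "M \<inter> U = {z \<in> U. F z = 0}" "\<forall>z \<in> M \<inter> U. frechet_derivative F (at z) \<noteq> (\<lambda>v. 0)"
    using bspec[OF smooth[unfolded smooth_hypersurface_def] assms] by (elim exE conjE)
  obtain G G' where G: "\<And>z. z \<in> U \<Longrightarrow> (F has_derivative (\<lambda>v. G z \<bullet> v)) (at z)"
    "\<And>z. z \<in> U \<Longrightarrow> (G has_derivative G' z) (at z)" "\<And>v. continuous_on U (\<lambda>z. G' z v)"
    by (rule smooth_on_gradient[OF U(1,3)]) (rule that; assumption)
  show ?thesis
  proof (rule that[OF U(1,2) G U(4)])
    fix z assume z: "z \<in> M \<inter> U"
    then have "frechet_derivative F (at z) = (\<lambda>v. G z \<bullet> v)" using frechet_derivative_at[OF G(1)] by auto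
    then show "G z \<noteq> 0" using bspec[OF U(5) z] by (auto simp: fun_eq_iff)
  qed
qed

text \<open>A fixed interior point; the side on which it lies tells the outer normal from the inner
  one.\<close>

definition center where "center = (SOME a. a \<in> interior C)"

lemma center: "center \<in> interior C"
  unfolding center_def using C_facts(3) by (simp add: some_in_eq)

section \<open>Outer normals and a local extension of the Gauss map\<close>

definition is_normal where "is_normal y u \<longleftrightarrow> norm u = 1 \<and> (\<forall>z\<in>M. (z - y) \<bullet> u \<le> 0)"

lemma is_normal_center: "is_normal y u \<Longrightarrow> (center - y) \<bullet> u < 0"
  using extend_support(2)[of u "y \<bullet> u" center] center interior_subset[of C]
  by (auto simp: is_normal_def inner_diff_left)

text \<open>Every vector orthogonal to \<open>g\<close> is a tangent direction together with its
  negative, so it is orthogonal to \<open>u\<close>. Hence \<open>u\<close> is parallel to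
  \<open>g\<close>, and \<open>center\<close> fixes the sign.\<close>

lemma normal_from_gradient:
  assumes U: "open U" "y \<in> U" and F: "continuous_on U F" "(F has_derivative (\<lambda>v. g \<bullet> v)) (at y)"
    and M: "M \<inter> U = {z \<in> U. F z = (0::real)}" and y: "y \<in> M" and g: "g \<noteq> 0" and u: "is_normal y u"
  shows "u = (- sgn ((center - y) \<bullet> g)) *\<^sub>R sgn g"
proof -
  define s where "s = sgn g"
  have s: "norm s = 1" "s \<bullet> s = 1" using g by (simp_all add: s_def norm_sgn norm_eq_1[symmetric])
  have Fy: "F y = 0" using M y U by auto
  have tang: "v \<bullet> u = 0" if "g \<bullet> v = 0" for v
  proof -
    have "tangent_dir M y w" if "g \<bullet> w = 0" for w
      by (rule tangent_dir_level_set[OF U F Fy _ g that]) (use M in auto)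
    from tangent_dir_support[OF this[of v]] tangent_dir_support[OF this[of "-v"]] u that
    show ?thesis by (force simp: is_normal_def)
  qed
  define k where "k = u \<bullet> s"
  define w where "w = u - k *\<^sub>R s"
  have ws: "w \<bullet> s = 0" using s by (simp add: w_def k_def inner_diff_left)
  then have "g \<bullet> w = 0" using g by (simp add: s_def sgn_div_norm inner_commute)
  then have "w \<bullet> u = 0" by (rule tang)
  then have "w \<bullet> w = 0" using ws by (simp add: w_def inner_diff_right)
  then have uk: "u = k *\<^sub>R s" by (simp add: w_def)
  then have "\<bar>k\<bar> = 1" using u s by (simp add: is_normal_def)
  moreover have "k * ((center - y) \<bullet> s) < 0" using is_normal_center[OF u] uk by simp
  moreover have "sgn ((center - y) \<bullet> s) = sgn ((center - y) \<bullet> g)"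
  proof -
    have "(center - y) \<bullet> s = inverse (norm g) * ((center - y) \<bullet> g)" by (simp add: s_def sgn_div_norm[of g])
    moreover have "sgn (inverse (norm g)) = 1" using g by (intro sgn_pos) simp
    ultimately show ?thesis by (simp only: sgn_mult mult_1)
  qed
  ultimately have "k = - sgn ((center - y) \<bullet> g)"
    by (cases "k > 0") (auto simp: abs_if mult_less_0_iff sgn_if split: if_splits)
  then show ?thesis using uk by (simp add: s_def)
qed

text \<open>A supporting hyperplane gives existence and the gradient formula gives uniqueness, so
  the definite description in \<open>gauss_map\<close> denotes the normal.\<close>

lemma is_normal_gauss_map:
  assumes y: "y \<in> M"
  shows "is_normal y (gauss_map M y)" and "is_normal y u \<Longrightarrow> gauss_map M y = u"
proof -
  obtain U F G G' where ch: "open U" "y \<in> U" "\<And>z. z \<in> U \<Longrightarrow> (F has_derivative (\<lambda>v. G z \<bullet> v)) (at z)"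
    "\<And>z. z \<in> U \<Longrightarrow> (G has_derivative G' z) (at z)" "\<And>v. continuous_on U (\<lambda>z. G' z v)"
    "M \<inter> U = {z \<in> U. F z = (0::real)}" "\<And>z. z \<in> M \<inter> U \<Longrightarrow> G z \<noteq> 0"
    by (rule chart[OF y]) (rule that; assumption)
  have "continuous_on U F"
    by (intro continuous_at_imp_continuous_on ballI has_derivative_continuous[OF ch(3)])
  then have unique: "u = (- sgn ((center - y) \<bullet> G y)) *\<^sub>R sgn (G y)" if "is_normal y u" for u
    using normal_from_gradient[OF ch(1,2) _ ch(3)[OF ch(2)] ch(6) y _ that] ch(2,7) y by auto
  obtain u0 where u0: "is_normal y u0"
  proof (rule supporting_normal_exists[OF C_facts(2,3), of y])
    show "y \<in> frontier C" using y frontier by simp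
    fix u assume "norm u = 1" "\<And>z. z \<in> closure C \<Longrightarrow> (z - y) \<bullet> u \<le> 0"
    then show thesis using that M_subset C_facts(4) by (force simp: is_normal_def closure_closed)
  qed
  have "gauss_map M y = (THE u. is_normal y u)" by (simp add: gauss_map_def is_normal_def)
  moreover have "\<exists>!u. is_normal y u" using u0 unique by metis
  ultimately show "is_normal y (gauss_map M y)" "is_normal y u \<Longrightarrow> gauss_map M y = u"
    by (auto intro: theI' the1_equality)
qed

lemma norm_gauss_map: "y \<in> M \<Longrightarrow> norm (gauss_map M y) = 1"
  using is_normal_gauss_map(1) by (simp add: is_normal_def)

lemma gauss_map_support: "y \<in> M \<Longrightarrow> z \<in> C \<Longrightarrow> z \<bullet> gauss_map M y \<le> y \<bullet> gauss_map M y"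
  using is_normal_gauss_map(1)[of y] extend_support(1)[of "gauss_map M y" "y \<bullet> gauss_map M y" z]
  by (auto simp: is_normal_def inner_diff_left)

text \<open>The normalised gradient extends the Gauss map to an open set, where ordinary derivatives
  are available.\<close>

lemma local_gauss_map:
  assumes y0: "y0 \<in> M"
  obtains U F G nu nu' where "open U" "y0 \<in> U"
    "\<And>z. z \<in> U \<Longrightarrow> (F has_derivative (\<lambda>v. G z \<bullet> v)) (at z)" "continuous_on U G"
    "M \<inter> U = {z \<in> U. F z = (0::real)}"
    "\<And>z. z \<in> U \<Longrightarrow> norm (nu z) = (1::real)" "\<And>z. z \<in> U \<Longrightarrow> (nu has_derivative nu' z) (at z)"
    "\<And>v. continuous_on U (\<lambda>z. nu' z v)"
    "\<And>z. z \<in> M \<inter> U \<Longrightarrow> gauss_map M z = nu z"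
    "\<And>z. z \<in> U \<Longrightarrow> \<exists>k. k \<noteq> 0 \<and> G z = k *\<^sub>R nu z"
proof -
  obtain U F G G' where ch: "open U" "y0 \<in> U" "\<And>z. z \<in> U \<Longrightarrow> (F has_derivative (\<lambda>v. G z \<bullet> v)) (at z)"
    "\<And>z. z \<in> U \<Longrightarrow> (G has_derivative G' z) (at z)" "\<And>v. continuous_on U (\<lambda>z. G' z v)"
    "M \<inter> U = {z \<in> U. F z = (0::real)}" "\<And>z. z \<in> M \<inter> U \<Longrightarrow> G z \<noteq> 0"
    by (rule chart[OF y0]) (rule that; assumption)
  have contG: "continuous_on U G"
    by (intro continuous_at_imp_continuous_on ballI has_derivative_continuous[OF ch(4)])
  have contF: "continuous_on U F"
    by (intro continuous_at_imp_continuous_on ballI has_derivative_continuous[OF ch(3)])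
  define s where "s = (center - y0) \<bullet> G y0"
  define f where "f z = ((center - z) \<bullet> G z) * s" for z
  \<comment> \<open>On \<open>V\<close> the pairing of \<open>center - z\<close> with the gradient
    keeps the sign it has at \<open>y0\<close>; this fixes the orientation and keeps the gradient
    nonzero.\<close>
  define V where "V = {z \<in> U. f z > 0}"
  define nu where "nu z = (- sgn s) *\<^sub>R sgn (G z)" for z
  define nu' where "nu' z v = (- sgn s) *\<^sub>R ((G' z v - (sgn (G z) \<bullet> G' z v) *\<^sub>R sgn (G z)) /\<^sub>R norm (G z))" for z v
  have "continuous_on U f" unfolding f_def using contG by (intro continuous_intros)
  then have "open (U \<inter> f -` {0<..})" using ch(1) by (intro continuous_open_preimage) auto
  then have openV: "open V" by (simp add: V_def vimage_def Int_def)
  have VU: "V \<subseteq> U" by (auto simp: V_def)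
  have normal_eq: "gauss_map M z = (- sgn ((center - z) \<bullet> G z)) *\<^sub>R sgn (G z)" if "z \<in> M \<inter> U" for z
    using normal_from_gradient[OF ch(1) _ contF ch(3) ch(6)] that ch(7)[OF that] is_normal_gauss_map(1)[of z] by auto
  have "s \<noteq> 0"
  proof
    assume "s = 0"
    then have "gauss_map M y0 = 0" using normal_eq[of y0] y0 ch(2) by (simp add: s_def)
    then show False using norm_gauss_map[OF y0] by simp
  qed
  then have y0V: "y0 \<in> V" using ch(2) by (simp add: V_def f_def s_def) (metis not_real_square_gt_zero s_def)
  have G0: "G z \<noteq> 0" if "z \<in> V" for z using that by (auto simp: V_def f_def)
  have sg: "sgn ((center - z) \<bullet> G z) = sgn s" if "z \<in> V" for z
    using that by (auto simp: V_def f_def zero_less_mult_iff)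
  have abs_s: "\<bar>sgn s\<bar> = 1" using \<open>s \<noteq> 0\<close> by (simp add: sgn_if)
  show ?thesis
  proof (rule that[of V F G nu nu'])
    show "open V" "y0 \<in> V" by fact+
    show "(F has_derivative (\<lambda>v. G z \<bullet> v)) (at z)" if "z \<in> V" for z using ch(3) that VU by blast
    show "continuous_on V G" using contG VU by (rule continuous_on_subset)
    show "M \<inter> V = {z \<in> V. F z = 0}" using ch(6) VU by blast
    show "norm (nu z) = 1" if "z \<in> V" for z using G0[OF that] abs_s by (simp add: nu_def norm_sgn)
    show "(nu has_derivative nu' z) (at z)" if "z \<in> V" for z
    proof -
      have "((\<lambda>z. sgn (G z)) has_derivative (\<lambda>v. (G' z v - (sgn (G z) \<bullet> G' z v) *\<^sub>R sgn (G z)) /\<^sub>R norm (G z))) (at z)"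
        by (rule has_derivative_compose[OF ch(4) has_derivative_sgn]) (use that VU G0 in auto)
      then show ?thesis unfolding nu_def[abs_def] nu'_def[abs_def] by (rule has_derivative_scaleR_right)
    qed
    show "continuous_on V (\<lambda>z. nu' z v)" for v
    proof -
      have c1: "continuous_on V G" "continuous_on V (\<lambda>z. G' z v)"
        using contG ch(5) VU by (auto intro: continuous_on_subset)
      show ?thesis unfolding nu'_def sgn_div_norm using c1 G0 by (intro continuous_intros) auto
    qed
    show "gauss_map M z = nu z" if "z \<in> M \<inter> V" for z using normal_eq[of z] sg[of z] that VU by (auto simp: nu_def)
    show "\<exists>k. k \<noteq> 0 \<and> G z = k *\<^sub>R nu z" if "z \<in> V" for z
    proof (intro exI conjI)
      show "- sgn s * norm (G z) \<noteq> 0" using \<open>s \<noteq> 0\<close> G0[OF that] by (simp add: sgn_zero_iff)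
      have "(- sgn s * norm (G z)) *\<^sub>R nu z = (sgn s * sgn s) *\<^sub>R (norm (G z) *\<^sub>R sgn (G z))"
        by (simp add: nu_def)
      also have "sgn s * sgn s = 1" using \<open>s \<noteq> 0\<close> by (simp add: sgn_if)
      finally show "G z = (- sgn s * norm (G z)) *\<^sub>R nu z"
        using G0[OF that] by (simp add: sgn_div_norm[of "G z"])
    qed
  qed
qed

lemma gauss_map_tangent_dir:
  assumes y: "y \<in> M" and v: "v \<bullet> gauss_map M y = 0"
  shows "tangent_dir M y v"
proof -
  obtain U F G nu nu' where ch: "open U" "y \<in> U"
    "\<And>z. z \<in> U \<Longrightarrow> (F has_derivative (\<lambda>v. G z \<bullet> v)) (at z)" "continuous_on U G"
    "M \<inter> U = {z \<in> U. F z = (0::real)}"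
    "\<And>z. z \<in> U \<Longrightarrow> norm (nu z) = (1::real)" "\<And>z. z \<in> U \<Longrightarrow> (nu has_derivative nu' z) (at z)"
    "\<And>v. continuous_on U (\<lambda>z. nu' z v)"
    "\<And>z. z \<in> M \<inter> U \<Longrightarrow> gauss_map M z = nu z"
    "\<And>z. z \<in> U \<Longrightarrow> \<exists>k. k \<noteq> 0 \<and> G z = k *\<^sub>R nu z"
    by (rule local_gauss_map[OF y]) (rule that; assumption)
  have contF: "continuous_on U F"
    by (intro continuous_at_imp_continuous_on ballI has_derivative_continuous[OF ch(3)])
  obtain k where k: "k \<noteq> 0" "G y = k *\<^sub>R nu y" using ch(10)[OF ch(2)] by blast
  have nu: "nu y = gauss_map M y" using ch(9)[of y] ch(2) y by simp
  show ?thesis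
  proof (rule tangent_dir_level_set[OF ch(1,2) contF ch(3)[OF ch(2)]])
    show "F y = 0" "{z \<in> U. F z = 0} \<subseteq> M" using ch(2,5) y by auto
    show "G y \<noteq> 0" using k norm_gauss_map[OF y] nu by auto
    show "G y \<bullet> v = 0" using k nu v by (simp add: inner_commute)
  qed
qed

text \<open>On tangent vectors any derivative \<open>d\<close> agrees with the one inside
  \<open>gauss_curvature\<close>, so a tangent vector in its kernel would make the curvature
  determinant zero.\<close>

lemma curvature_injective:
  assumes y: "y \<in> M" and d: "(gauss_map M has_derivative d) (at y within M)"
    and v: "v \<bullet> gauss_map M y = 0" and dv: "d v = 0"
  shows "v = 0"
proof (rule ccontr)
  assume v0: "v \<noteq> 0"
  let ?u = "gauss_map M y" and ?D = "frechet_derivative (gauss_map M) (at y within M)"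
  have D: "(gauss_map M has_derivative ?D) (at y within M)"
    using d differentiableI frechet_derivative_works by blast
  interpret D: linear ?D using D has_derivative_linear by blast
  have Dv: "?D v = 0"
    using tangent_dir_derivative_unique[OF D d gauss_map_tangent_dir[OF y v]] dv by simp
  define A where "A w = ?D (tangent_proj ?u w) + (w \<bullet> ?u) *\<^sub>R ?u" for w
  have lin: "linear A"
    unfolding A_def tangent_proj_def
    by (intro linearI) (simp_all add: D.add D.diff D.scale inner_add_left algebra_simps)
  have "A v = 0" using v Dv by (simp add: A_def tangent_proj_def)
  then have "\<not> inj A" using lin v0 by (auto simp: linear_injective_0)
  then have "det (matrix A) = 0" using lin det_nz_iff_inj by blast
  then show False using curved[OF y] by (simp add: gauss_curvature_def tangent_det_def A_def[abs_def])
qed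

section \<open>The inverse Gauss map and its derivative\<close>

definition inv_gauss where "inv_gauss = inv_into M (gauss_map M)"

definition X where "X z = inv_gauss (sgn z)"

definition W where "W z = frechet_derivative X (at z)"

lemma gauss_map_has_derivative:
  assumes y: "y \<in> M"
  shows "\<exists>d. (gauss_map M has_derivative d) (at y within M)"
proof -
  obtain U F G nu nu' where ch: "open U" "y \<in> U"
    "\<And>z. z \<in> U \<Longrightarrow> (F has_derivative (\<lambda>v. G z \<bullet> v)) (at z)" "continuous_on U G"
    "M \<inter> U = {z \<in> U. F z = (0::real)}"
    "\<And>z. z \<in> U \<Longrightarrow> norm (nu z) = (1::real)" "\<And>z. z \<in> U \<Longrightarrow> (nu has_derivative nu' z) (at z)"
    "\<And>v. continuous_on U (\<lambda>z. nu' z v)"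
    "\<And>z. z \<in> M \<inter> U \<Longrightarrow> gauss_map M z = nu z"
    "\<And>z. z \<in> U \<Longrightarrow> \<exists>k. k \<noteq> 0 \<and> G z = k *\<^sub>R nu z"
    by (rule local_gauss_map[OF y]) (rule that; assumption)
  have "(gauss_map M has_derivative nu' y) (at y within M)"
    by (rule has_derivative_within_local_cong[OF has_derivative_at_withinI[OF ch(7)[OF ch(2)]] ch(1)])
      (use y ch(2,9) in auto)
  then show ?thesis by blast
qed

lemma gauss_map_cont: "continuous_on M (gauss_map M)"
  unfolding continuous_on_eq_continuous_within
  using gauss_map_has_derivative has_derivative_continuous by blast

text \<open>Two points with the same normal span a segment in the frontier on which the Gauss map is
  constant; its derivative would kill the direction of the segment, against positive
  curvature.\<close>

lemma gauss_map_inj: "inj_on (gauss_map M) M"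
proof (rule inj_onI, rule ccontr)
  fix y1 y2 assume y: "y1 \<in> M" "y2 \<in> M" and eq: "gauss_map M y1 = gauss_map M y2" and ne: "y1 \<noteq> y2"
  define u where "u = gauss_map M y1"
  have u: "norm u = 1" by (simp add: u_def norm_gauss_map y)
  have le: "z \<bullet> u \<le> y1 \<bullet> u" if "z \<in> C" for z using gauss_map_support[OF y(1) that] by (simp add: u_def)
  have y12: "y2 \<bullet> u = y1 \<bullet> u"
  proof (rule antisym)
    show "y2 \<bullet> u \<le> y1 \<bullet> u" using le y M_subset by blast
    show "y1 \<bullet> u \<le> y2 \<bullet> u" using gauss_map_support[OF y(2), of y1] y M_subset eq by (auto simp: u_def)
  qed
  define v where "v = y2 - y1"
  have v: "v \<noteq> 0" "v \<bullet> u = 0" using ne y12 by (auto simp: v_def inner_diff_left)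
  have seg: "y1 + t *\<^sub>R v \<in> M \<and> gauss_map M (y1 + t *\<^sub>R v) = u" if "0 \<le> t" "t \<le> 1" for t
  proof -
    have "y1 + t *\<^sub>R v = (1 - t) *\<^sub>R y1 + t *\<^sub>R y2" by (simp add: v_def algebra_simps)
    then have inC: "y1 + t *\<^sub>R v \<in> C"
      using convexD[OF C_facts(2), of y1 y2 "1 - t" t] y M_subset that by auto
    have val: "(y1 + t *\<^sub>R v) \<bullet> u = y1 \<bullet> u" using v by (simp add: inner_add_left)
    have "y1 + t *\<^sub>R v \<notin> interior C"
    proof
      assume "y1 + t *\<^sub>R v \<in> interior C"
      from extend_support(2)[OF u _ inC this, of "y1 \<bullet> u"] le M_subset val show False by force
    qed
    then have inM: "y1 + t *\<^sub>R v \<in> M" using C_cases[OF inC] by blast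
    moreover have "is_normal (y1 + t *\<^sub>R v) u"
      using u le M_subset val by (auto simp: is_normal_def inner_diff_left)
    ultimately show ?thesis using is_normal_gauss_map(2) by blast
  qed
  obtain d where d: "(gauss_map M has_derivative d) (at y1 within M)"
    using gauss_map_has_derivative[OF y(1)] by blast
  have path: "((\<lambda>t. y1 + t *\<^sub>R v) has_derivative (\<lambda>s. s *\<^sub>R v)) (at 0 within {0..1})"
    by (auto intro!: derivative_eq_intros)
  have "(gauss_map M has_derivative d) (at (y1 + 0 *\<^sub>R v) within (\<lambda>t. y1 + t *\<^sub>R v) ` {0..1})"
    using d by (simp, rule has_derivative_subset) (use seg in auto)
  from has_derivative_in_compose[OF path this]
  have "((\<lambda>t. gauss_map M (y1 + t *\<^sub>R v)) has_derivative (\<lambda>s. d (s *\<^sub>R v))) (at 0 within {0..1})" .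
  then have "((\<lambda>t. u) has_derivative (\<lambda>s. d (s *\<^sub>R v))) (at 0 within {0..1::real})"
    by (rule has_derivative_transform[rotated 2]) (use seg in auto)
  moreover have "((\<lambda>t. u) has_derivative (\<lambda>s. 0)) (at 0 within {0..1::real})" by simp
  \<comment> \<open>The path is differentiated at an end point of its interval, where only the
    one-sided direction 1 is at hand; it already determines the derivative.\<close>
  moreover have "tangent_dir {0..1::real} 0 1"
    unfolding tangent_dir_def
  proof (intro allI impI)
    fix e :: real assume "e > 0"
    then show "\<exists>t w. 0 < t \<and> t < e \<and> norm (w - 1) < e \<and> 0 + t *\<^sub>R w \<in> {0..1::real}"
      by (intro exI[of _ "min e 1 / 2"] exI[of _ 1]) auto
  qed
  ultimately have "d (1 *\<^sub>R v) = 0" by (rule tangent_dir_derivative_unique)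
  then have "v = 0" using curvature_injective[OF y(1) d] v by (simp add: u_def)
  then show False using v by simp
qed

text \<open>A highest point of the compact \<open>M\<close> in direction \<open>x\<close> has normal
  \<open>x\<close>.\<close>

lemma gauss_map_image: "gauss_map M ` M = sphere 0 1"
proof
  show "gauss_map M ` M \<subseteq> sphere 0 1" using norm_gauss_map by auto
  show "sphere 0 1 \<subseteq> gauss_map M ` M"
  proof
    fix x :: "real^'m" assume "x \<in> sphere 0 1"
    then have x: "norm x = 1" by simp
    have "M \<noteq> {}"
      using C_facts unfolding frontier by (metis frontier_eq_empty interior_empty not_bounded_UNIV)
    moreover have "continuous_on M (\<lambda>z. z \<bullet> x)" by (intro continuous_intros)
    ultimately obtain y where y: "y \<in> M" "\<And>z. z \<in> M \<Longrightarrow> z \<bullet> x \<le> y \<bullet> x"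
      using continuous_attains_sup[OF compact_M, of "\<lambda>z. z \<bullet> x"] by auto
    then have "is_normal y x" using x by (auto simp: is_normal_def inner_diff_left)
    then show "x \<in> gauss_map M ` M" using is_normal_gauss_map(2) y(1) by force
  qed
qed

lemma inv_gauss: "norm x = 1 \<Longrightarrow> inv_gauss x \<in> M" "norm x = 1 \<Longrightarrow> gauss_map M (inv_gauss x) = x"
  "y \<in> M \<Longrightarrow> inv_gauss (gauss_map M y) = y"
proof -
  show "norm x = 1 \<Longrightarrow> inv_gauss x \<in> M" "norm x = 1 \<Longrightarrow> gauss_map M (inv_gauss x) = x"
    using gauss_map_image by (auto simp: inv_gauss_def inv_into_into f_inv_into_f)
  show "y \<in> M \<Longrightarrow> inv_gauss (gauss_map M y) = y"
    using gauss_map_inj by (simp add: inv_gauss_def inv_into_f_f)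
qed

lemma inv_gauss_cont: "continuous_on (sphere 0 1) inv_gauss"
  using continuous_on_inv[OF gauss_map_cont compact_M, of inv_gauss] inv_gauss(3) gauss_map_image by simp

lemma X_on_M: "z \<noteq> 0 \<Longrightarrow> X z \<in> M" "z \<noteq> 0 \<Longrightarrow> gauss_map M (X z) = sgn z"
  using inv_gauss[of "sgn z"] by (auto simp: X_def norm_sgn)

lemma X_cont: "continuous_on (-{0}) X"
  unfolding X_def[abs_def]
proof (rule continuous_on_compose2[OF inv_gauss_cont])
  show "continuous_on (-{0::real^'m}) sgn" by (auto intro!: continuous_intros simp: sgn_div_norm[abs_def])
qed (auto simp: norm_sgn split: if_splits)

text \<open>The map \<open>(1 + F) nu\<close> restricts to the Gauss map on \<open>M\<close> and, unlike \<open>nu\<close>, has an invertible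
  derivative \<open>T\<close> there.\<close>

lemma X_deriv_local:
  assumes z0: "z0 \<noteq> 0"
  obtains U T where "open U" "X z0 \<in> U" "\<And>y. y \<in> M \<inter> U \<Longrightarrow> linear (T y)"
    "\<And>y v. y \<in> M \<inter> U \<Longrightarrow> T y v = 0 \<Longrightarrow> v = 0" "\<And>v. continuous_on (M \<inter> U) (\<lambda>y. T y v)"
    "\<And>z. z \<noteq> 0 \<Longrightarrow> X z \<in> U \<Longrightarrow> (X has_derivative W z) (at z)"
    "\<And>z v. z \<noteq> 0 \<Longrightarrow> X z \<in> U \<Longrightarrow> T (X z) (W z v) = (v - (sgn z \<bullet> v) *\<^sub>R sgn z) /\<^sub>R norm z"
proof -
  obtain U F G nu nu' where ch: "open U" "X z0 \<in> U"
    "\<And>z. z \<in> U \<Longrightarrow> (F has_derivative (\<lambda>v. G z \<bullet> v)) (at z)" "continuous_on U G"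
    "M \<inter> U = {z \<in> U. F z = (0::real)}"
    "\<And>z. z \<in> U \<Longrightarrow> norm (nu z) = (1::real)" "\<And>z. z \<in> U \<Longrightarrow> (nu has_derivative nu' z) (at z)"
    "\<And>v. continuous_on U (\<lambda>z. nu' z v)"
    "\<And>z. z \<in> M \<inter> U \<Longrightarrow> gauss_map M z = nu z"
    "\<And>z. z \<in> U \<Longrightarrow> \<exists>k. k \<noteq> 0 \<and> G z = k *\<^sub>R nu z"
    by (rule local_gauss_map[OF X_on_M(1)[OF z0]]) (rule that; assumption)
  define T where "T y v = nu' y v + (G y \<bullet> v) *\<^sub>R nu y" for y v
  have linT: "linear (T y)" if "y \<in> U" for y
  proof -
    have "linear (nu' y)" using ch(7)[OF that] has_derivative_linear by blast
    then show ?thesis unfolding T_def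
      by (intro linearI) (simp_all add: linear_add linear_scale algebra_simps)
  qed
  have contnu: "continuous_on U nu"
    by (intro continuous_at_imp_continuous_on ballI has_derivative_continuous[OF ch(7)])
  have perp: "nu y \<bullet> nu' y v = 0" if y: "y \<in> U" for y v
  proof -
    have "((\<lambda>z. nu z \<bullet> nu z) has_derivative (\<lambda>v. nu y \<bullet> nu' y v + nu' y v \<bullet> nu y)) (at y)"
      using ch(7)[OF y] by (rule has_derivative_inner) (rule ch(7)[OF y])
    moreover have "((\<lambda>z. nu z \<bullet> nu z) has_derivative (\<lambda>v. 0)) (at y)"
      by (rule has_derivative_transform_within_open[OF has_derivative_const[of 1] ch(1) y])
        (use ch(6) in \<open>auto simp: norm_eq_1\<close>)
    ultimately have "(\<lambda>v. nu y \<bullet> nu' y v + nu' y v \<bullet> nu y) = (\<lambda>v. 0)" by (rule has_derivative_unique)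
    from fun_cong[OF this, of v] show ?thesis by (simp add: inner_commute)
  qed
  have derT: "(gauss_map M has_derivative T y) (at y within M)" if y: "y \<in> M \<inter> U" for y
  proof -
    have Fy: "F y = 0" using ch(5) y by blast
    have "((\<lambda>z. nu z + F z *\<^sub>R nu z) has_derivative (\<lambda>v. nu' y v + (F y *\<^sub>R nu' y v + (G y \<bullet> v) *\<^sub>R nu y))) (at y)"
      using y by (intro has_derivative_add has_derivative_scaleR ch(3,7)) auto
    then have "((\<lambda>z. nu z + F z *\<^sub>R nu z) has_derivative T y) (at y within M)"
      using Fy by (simp add: T_def[abs_def] has_derivative_at_withinI)
    then show ?thesis
      by (rule has_derivative_within_local_cong[OF _ ch(1) y]) (use ch(5,9) in auto)
  qed
  \<comment> \<open>Since \<open>nu\<close> has unit length, its derivative is orthogonal to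
    \<open>nu y\<close>; the normal part of \<open>T y v = 0\<close> therefore says that
    \<open>v\<close> is tangent, and the curvature condition applies.\<close>
  have injT: "v = 0" if y: "y \<in> M \<inter> U" and v: "T y v = 0" for y v
  proof -
    obtain k where k: "k \<noteq> 0" "G y = k *\<^sub>R nu y" using ch(10)[of y] y by blast
    have "nu y \<bullet> T y v = 0" using v by simp
    then have "G y \<bullet> v = 0" using perp[of y v] ch(6)[of y] y by (simp add: T_def inner_add_right norm_eq_1)
    then have "v \<bullet> gauss_map M y = 0" using k ch(9)[OF y] by (simp add: inner_commute)
    then show ?thesis using curvature_injective[OF _ derT[OF y] _ v] y by blast
  qed
  have main: "(X has_derivative W z) (at z) \<and> (\<forall>v. T (X z) (W z v) = (v - (sgn z \<bullet> v) *\<^sub>R sgn z) /\<^sub>R norm z)"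
    if z: "z \<noteq> 0" "X z \<in> U" for z
  proof -
    let ?y = "X z"
    have y: "?y \<in> M \<inter> U" using z X_on_M by blast
    have lin: "linear (T ?y)" using linT z by blast
    have "inj (T ?y)" using injT[OF y] lin by (simp add: linear_injective_0)
    then obtain T' where T': "linear T'" "\<And>v. T' (T ?y v) = v" "\<And>v. T ?y (T' v) = v"
      using linear_injective_isomorphism[OF lin] by blast
    have gy: "gauss_map M ?y = sgn z" by (rule X_on_M(2)[OF z(1)])
    have "(inv_gauss has_derivative T') (at (gauss_map M ?y) within gauss_map M ` M)"
    proof (rule has_derivative_inverse_within[OF derT[OF y]])
      show "continuous (at (gauss_map M ?y) within gauss_map M ` M) inv_gauss"
        using inv_gauss_cont z(1) unfolding gauss_map_image gy
        by (simp add: continuous_on_eq_continuous_within norm_sgn)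
    qed (use y T' inv_gauss(3) in \<open>auto simp: fun_eq_iff\<close>)
    then have "(inv_gauss has_derivative T') (at (sgn z) within sphere 0 1)" by (simp add: gy gauss_map_image)
    then have inv: "(inv_gauss has_derivative T') (at (sgn z) within sgn ` (-{0}))"
      by (rule has_derivative_subset) (auto simp: norm_sgn split: if_splits)
    have "(sgn has_derivative (\<lambda>v. (v - (sgn z \<bullet> v) *\<^sub>R sgn z) /\<^sub>R norm z)) (at z within -{0})"
      using has_derivative_sgn[OF z(1)] by (rule has_derivative_at_withinI)
    from has_derivative_in_compose[OF this inv]
    have "(X has_derivative (\<lambda>v. T' ((v - (sgn z \<bullet> v) *\<^sub>R sgn z) /\<^sub>R norm z))) (at z within -{0})"
      by (simp add: X_def[abs_def])
    then have XD: "(X has_derivative (\<lambda>v. T' ((v - (sgn z \<bullet> v) *\<^sub>R sgn z) /\<^sub>R norm z))) (at z)"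
    proof -
      have "at z within -{0} = at z" using z(1) by (intro at_within_open) auto
      then show ?thesis using \<open>(X has_derivative _) (at z within -{0})\<close> by simp
    qed
    then have "W z = (\<lambda>v. T' ((v - (sgn z \<bullet> v) *\<^sub>R sgn z) /\<^sub>R norm z))"
      unfolding W_def by (rule frechet_derivative_at[symmetric])
    then show ?thesis using XD T'(3) by simp
  qed
  show ?thesis
  proof (rule that[of U T])
    show "continuous_on (M \<inter> U) (\<lambda>y. T y v)" for v
      unfolding T_def using ch(4,8) contnu
      by (intro continuous_intros) (auto intro: continuous_on_subset)
  qed (use ch linT injT main in auto)
qed

lemma X_deriv: "z \<noteq> 0 \<Longrightarrow> (X has_derivative W z) (at z)"
  by (rule X_deriv_local) auto

text \<open>Near each point \<open>W z v\<close> solves a linear system with the invertible,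
  continuous coefficients \<open>T (X z)\<close>.\<close>

lemma W_cont: "continuous_on (-{0}) (\<lambda>z. W z v)"
proof (intro continuous_at_imp_continuous_on ballI)
  fix z0 :: "real^'m" assume "z0 \<in> -{0}"
  then have z0: "z0 \<noteq> 0" by simp
  obtain U T where UT: "open U" "X z0 \<in> U" "\<And>y. y \<in> M \<inter> U \<Longrightarrow> linear (T y)"
    "\<And>y v. y \<in> M \<inter> U \<Longrightarrow> T y v = 0 \<Longrightarrow> v = 0" "\<And>v. continuous_on (M \<inter> U) (\<lambda>y. T y v)"
    "\<And>z. z \<noteq> 0 \<Longrightarrow> X z \<in> U \<Longrightarrow> (X has_derivative W z) (at z)"
    "\<And>z v. z \<noteq> 0 \<Longrightarrow> X z \<in> U \<Longrightarrow> T (X z) (W z v) = (v - (sgn z \<bullet> v) *\<^sub>R sgn z) /\<^sub>R norm z"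
    by (rule X_deriv_local[OF z0]) (rule that; assumption)
  define V where "V = -{0} \<inter> X -` U"
  have V: "open V" "z0 \<in> V"
    unfolding V_def using X_cont UT(1,2) z0 by (auto intro!: continuous_open_preimage)
  have XV: "X z \<in> M \<inter> U" "z \<noteq> 0" if "z \<in> V" for z using that X_on_M by (auto simp: V_def)
  have cXV: "continuous_on V X" using X_cont by (rule continuous_on_subset) (auto simp: V_def)
  have "continuous_on V (\<lambda>z. W z v)"
  proof (rule continuous_on_linear_solution[where A = "\<lambda>z. T (X z)"])
    show "continuous_on V (\<lambda>z. T (X z) w)" for w
      using XV(1) by (intro continuous_on_compose2[OF UT(5) cXV]) auto
    show "continuous_on V (\<lambda>z. (v - (sgn z \<bullet> v) *\<^sub>R sgn z) /\<^sub>R norm z)"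
      unfolding sgn_div_norm using XV(2) by (intro continuous_intros) auto
    show "T (X z) (W z v) = (v - (sgn z \<bullet> v) *\<^sub>R sgn z) /\<^sub>R norm z" if "z \<in> V" for z
      using UT(7) XV[OF that] by blast
  qed (use UT(3,4) XV in auto)
  then show "isCont (\<lambda>z. W z v) z0" using V by (simp add: continuous_on_eq_continuous_at)
qed

sublocale gauss_inverse C X W
proof
  show "CARD('m) \<ge> 2" "compact C" "convex C" "interior C \<noteq> {}" using dim2 C_facts by auto
  show "X z \<in> C" if "z \<noteq> 0" for z using X_on_M(1)[OF that] M_subset by blast
  show "y \<bullet> z \<le> X z \<bullet> z" if "z \<noteq> 0" "y \<in> C" for z y
  proof -
    have "y \<bullet> sgn z \<le> X z \<bullet> sgn z" using gauss_map_support[OF X_on_M(1) that(2)] X_on_M(2) that(1) by metis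
    then show ?thesis using that(1) by (simp add: sgn_div_norm divide_right_mono)
  qed
  show "X (t *\<^sub>R z) = X z" if "t > 0" "z \<noteq> 0" for t z using that by (simp add: X_def sgn_scaleR)
  show "x = y" if "norm x = 1" "norm y = 1" "X x = X y" for x y
  proof -
    have "x \<noteq> 0" "y \<noteq> 0" using that by auto
    then have "sgn x = sgn y" using X_on_M(2) that(3) by metis
    then show ?thesis using that(1,2) by (simp add: sgn_div_norm)
  qed
  show "frontier C = X ` sphere 0 1"
  proof -
    have "y \<in> X ` sphere 0 1" if "y \<in> M" for y
      using inv_gauss(3)[OF that] norm_gauss_map[OF that]
      by (intro image_eqI[of _ _ "gauss_map M y"]) (auto simp: X_def sgn_div_norm)
    moreover have "X ` sphere 0 1 \<subseteq> M" by (rule image_subsetI, rule X_on_M(1)) auto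
    ultimately show ?thesis using frontier by blast
  qed
  show "(X has_derivative W z) (at z)" if "z \<noteq> 0" for z using that by (rule X_deriv)
  show "continuous_on (- {0}) (\<lambda>z. W z v)" for v by (rule W_cont)
  show "v = 0" if x: "norm x = 1" and v: "W x v = 0" "x \<bullet> v = 0" for x v
  proof -
    have x0: "x \<noteq> 0" using x by auto
    obtain U T where UT: "open U" "X x \<in> U" "\<And>y. y \<in> M \<inter> U \<Longrightarrow> linear (T y)"
      "\<And>y v. y \<in> M \<inter> U \<Longrightarrow> T y v = 0 \<Longrightarrow> v = 0" "\<And>v. continuous_on (M \<inter> U) (\<lambda>y. T y v)"
      "\<And>z. z \<noteq> 0 \<Longrightarrow> X z \<in> U \<Longrightarrow> (X has_derivative W z) (at z)"
      "\<And>z v. z \<noteq> 0 \<Longrightarrow> X z \<in> U \<Longrightarrow> T (X z) (W z v) = (v - (sgn z \<bullet> v) *\<^sub>R sgn z) /\<^sub>R norm z"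
      by (rule X_deriv_local[OF x0]) (rule that; assumption)
    \<comment> \<open>For tangent \<open>v\<close> the linear system at \<open>x\<close> has
      right-hand side \<open>v\<close>, so \<open>W x v = 0\<close> forces
      \<open>v = 0\<close>.\<close>
    have "T (X x) 0 = 0" using UT(2,3) X_on_M(1)[OF x0] by (simp add: linear_0)
    then show ?thesis using UT(7)[OF x0 UT(2), of v] x v by (simp add: sgn_div_norm)
  qed
qed

section \<open>Support function and curvature\<close>

lemma support_fn_eq: "norm x = 1 \<Longrightarrow> support_fn M x = X x \<bullet> x"
  by (simp add: support_fn_def X_def inv_gauss_def sgn_div_norm)

lemma hom_grad_support_fn:
  assumes x: "norm x = 1"
  shows "hom_grad (support_fn M) x = X x"
proof -
  have x0: "x \<noteq> 0" using x by auto
  have eq: "X y \<bullet> y = norm y * support_fn M (sgn y)" if "y \<in> -{0}" for y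
    using that by (simp add: support_fn_eq norm_sgn X_sgn) (simp add: sgn_div_norm)
  have "((\<lambda>y. norm y * support_fn M (sgn y)) has_derivative (\<lambda>v. X x \<bullet> v)) (at x)"
    by (rule has_derivative_transform_within_open[OF H_deriv[OF x0], of "-{0}"]) (use x0 eq in auto)
  then have G: "GDERIV (\<lambda>y. norm y * support_fn M (sgn y)) x :> X x"
    by (simp add: gderiv_def inner_commute)
  show ?thesis unfolding hom_grad_def
  proof (rule the_equality[of _ "X x"])
    show "GDERIV (\<lambda>y. norm y * support_fn M (sgn y)) x :> X x" by (rule G)
    fix g assume "GDERIV (\<lambda>y. norm y * support_fn M (sgn y)) x :> g"
    then have "(\<lambda>v. v \<bullet> g) = (\<lambda>v. v \<bullet> X x)" using G unfolding gderiv_def by (rule has_derivative_unique)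
    then show "g = X x" by (metis inner_commute vector_eq_rdot)
  qed
qed

lemma sphere_grad_support_fn:
  assumes x: "norm x = 1"
  shows "sphere_grad (support_fn M) x = X x - (X x \<bullet> x) *\<^sub>R x"
proof -
  have x0: "x \<noteq> 0" and xx: "x \<bullet> x = 1" using x by (auto simp: norm_eq_1)
  have der: "(support_fn M has_derivative (\<lambda>v. X x \<bullet> v)) (at x within sphere 0 1)"
    by (rule has_derivative_transform[OF _ _ has_derivative_at_withinI[OF H_deriv[OF x0]]])
      (use x in \<open>auto simp: support_fn_eq\<close>)
  have fd: "frechet_derivative (support_fn M) (at x within sphere 0 1) v = X x \<bullet> v" if "v \<bullet> x = 0" for v
    by (rule frechet_derivative_tangent_eq[OF der tangent_dir_sphere[OF x that]])
  show ?thesis unfolding sphere_grad_def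
  proof (rule the_equality)
    show "(X x - (X x \<bullet> x) *\<^sub>R x) \<bullet> x = 0 \<and> (\<forall>v. v \<bullet> x = 0 \<longrightarrow>
      (X x - (X x \<bullet> x) *\<^sub>R x) \<bullet> v = frechet_derivative (support_fn M) (at x within sphere 0 1) v)"
    proof (intro conjI allI impI)
      show "(X x - (X x \<bullet> x) *\<^sub>R x) \<bullet> x = 0" using xx by (simp add: inner_diff_left)
      fix v assume v: "v \<bullet> x = 0"
      then have "x \<bullet> v = 0" by (simp add: inner_commute)
      then show "(X x - (X x \<bullet> x) *\<^sub>R x) \<bullet> v = frechet_derivative (support_fn M) (at x within sphere 0 1) v"
        by (simp add: inner_diff_left fd[OF v])
    qed
    fix g assume g: "g \<bullet> x = 0 \<and> (\<forall>v. v \<bullet> x = 0 \<longrightarrow> g \<bullet> v = frechet_derivative (support_fn M) (at x within sphere 0 1) v)"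
    \<comment> \<open>The difference of the two candidates is itself tangent; testing with it shows
      that it vanishes.\<close>
    define w where "w = g - (X x - (X x \<bullet> x) *\<^sub>R x)"
    have wx: "w \<bullet> x = 0" using g xx by (simp add: w_def inner_diff_left)
    then have "g \<bullet> w = X x \<bullet> w" using g fd by simp
    moreover have "w \<bullet> u = g \<bullet> u - X x \<bullet> u + (X x \<bullet> x) * (u \<bullet> x)" for u
      by (simp add: w_def inner_diff_left inner_commute[of u x])
    ultimately have "w \<bullet> w = 0" using wx by simp
    then show "g = X x - (X x \<bullet> x) *\<^sub>R x" by (simp add: w_def)
  qed
qed

text \<open>The spherical gradient is \<open>X\<close> minus its normal part; when it is
  differentiated, the term along \<open>x\<close> is projected away. Hence \<open>W x\<close> is
  \<open>\<nabla>\<^sup>2h + g h\<close> on tangent vectors.\<close>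

lemma sphere_hess_support_fn:
  assumes x: "norm x = 1" and v: "v \<bullet> x = 0"
  shows "sphere_hess (support_fn M) x v = W x v - (X x \<bullet> x) *\<^sub>R v"
proof -
  have x0: "x \<noteq> 0" and xx: "x \<bullet> x = 1" using x by (auto simp: norm_eq_1)
  have "((\<lambda>y. X y - (X y \<bullet> y) *\<^sub>R y) has_derivative
      (\<lambda>v. W x v - ((X x \<bullet> x) *\<^sub>R v + (X x \<bullet> v) *\<^sub>R x))) (at x)"
    by (intro has_derivative_diff has_derivative_scaleR X_deriv x0 H_deriv has_derivative_ident)
  then have der: "(sphere_grad (support_fn M) has_derivative
      (\<lambda>v. W x v - ((X x \<bullet> x) *\<^sub>R v + (X x \<bullet> v) *\<^sub>R x))) (at x within sphere 0 1)"
    by (rule has_derivative_transform[OF _ _ has_derivative_at_withinI, rotated 2])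
      (use x in \<open>auto simp: sphere_grad_support_fn\<close>)
  show ?thesis
    unfolding sphere_hess_def frechet_derivative_tangent_eq[OF der tangent_dir_sphere[OF x v]]
    using W_perp[OF x0, of v] v xx
    by (simp add: tangent_proj_def inner_diff_left inner_add_left algebra_simps)
qed

lemma curvature_fn_eq:
  assumes x: "norm x = 1"
  shows "curvature_fn M x = 1 / det (matrix (\<lambda>v. W x v + (x \<bullet> v) *\<^sub>R x))"
proof -
  have x0: "x \<noteq> 0" and xx: "x \<bullet> x = 1" using x by (auto simp: norm_eq_1)
  have "sphere_hess (support_fn M) x (tangent_proj x v) + support_fn M x *\<^sub>R tangent_proj x v + (v \<bullet> x) *\<^sub>R x
     = W x v + (x \<bullet> v) *\<^sub>R x" for v
  proof -
    have "tangent_proj x v \<bullet> x = 0" using xx by (simp add: tangent_proj_def inner_diff_left)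
    moreover have "W x (tangent_proj x v) = W x v"
      using W_radial[OF x0] by (simp add: tangent_proj_def linear_diff[OF W_lin[OF x0]] linear_scale[OF W_lin[OF x0]])
    ultimately show ?thesis
      using sphere_hess_support_fn[OF x, of "tangent_proj x v"] by (simp add: support_fn_eq[OF x] inner_commute)
  qed
  then show ?thesis by (simp add: curvature_fn_def tangent_det_def)
qed

lemma sphere_if_isotropic:
  assumes g: "\<And>x. norm x = 1 \<Longrightarrow> (g has_real_derivative g' (support_fn M x)) (at (support_fn M x))"
    "\<And>x. norm x = 1 \<Longrightarrow> g (support_fn M x) > 0"
    "\<And>x. norm x = 1 \<Longrightarrow> g' (support_fn M x) \<ge> 0"
    "continuous_on (support_fn M ` sphere 0 1) g'"
    and eq: "\<And>x. norm x = 1 \<Longrightarrow>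
      g (support_fn M x) * exp (1/2 * (norm (hom_grad (support_fn M) x))\<^sup>2) * curvature_fn M x = c"
  shows "\<exists>r>0. M = (\<lambda>x. r *\<^sub>R x) ` sphere 0 1"
  unfolding frontier
proof (rule isotropic_curvature_sphere)
  have img: "(\<lambda>x. X x \<bullet> x) ` sphere 0 1 = support_fn M ` sphere 0 1"
    by (intro image_cong) (auto simp: support_fn_eq)
  show "continuous_on ((\<lambda>x. X x \<bullet> x) ` sphere 0 1) g'" unfolding img by (rule g(4))
  fix x :: "real^'m" assume x: "norm x = 1"
  then have x0: "x \<noteq> 0" by auto
  show "(g has_real_derivative g' (X x \<bullet> x)) (at (X x \<bullet> x))" "g (X x \<bullet> x) > 0" "g' (X x \<bullet> x) \<ge> 0"
    using g(1-3)[OF x] by (simp_all add: support_fn_eq[OF x])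
  have pos: "0 < det (matrix (\<lambda>v. W x v + (x \<bullet> v) *\<^sub>R x))"
    using S_pos[OF x0] S_sgn[OF x0] x by (simp add: sgn_div_norm)
  have e: "g (X x \<bullet> x) * exp ((norm (X x))\<^sup>2 / 2) / det (matrix (\<lambda>v. W x v + (x \<bullet> v) *\<^sub>R x)) = c"
    using eq[OF x] by (simp add: support_fn_eq[OF x] hom_grad_support_fn[OF x] curvature_fn_eq[OF x])
  \<comment> \<open>All factors of the curvature equation are positive, so it can be solved for the
    reciprocal curvature.\<close>
  have "c \<noteq> 0" using e pos g(2)[OF x] by (auto simp: support_fn_eq[OF x])
  then show "det (matrix (\<lambda>v. W x v + (x \<bullet> v) *\<^sub>R x)) = g (X x \<bullet> x) * exp ((norm (X x))\<^sup>2 / 2) / c"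
    using e pos by (simp add: field_simps)
qed

end

lemma convex_hypersurfaceI:
  fixes M :: "(real^'m::finite) set"
  assumes "CARD('m) \<ge> 2" "closed_smooth_strictly_convex M"
  obtains C where "convex_hypersurface M C"
  using assms unfolding closed_smooth_strictly_convex_def convex_hypersurface_def by blast

theorem corollary1p3:
  assumes "CARD('m::finite) \<ge> 2"
  shows "(\<forall>(p::real) (M :: (real ^ 'm) set) (c::real).
            p > 1 \<longrightarrow> closed_smooth_strictly_convex M \<longrightarrow>
            (\<forall>x \<in> sphere 0 1. support_fn M x > 0) \<longrightarrow>
            (\<forall>x \<in> sphere 0 1. support_fn M x powr (p - 1)
                * exp (1/2 * (norm (hom_grad (support_fn M) x))\<^sup>2) * curvature_fn M x = c) \<longrightarrow>
            (\<exists>r>0. M = (\<lambda>x. r *\<^sub>R x) ` sphere 0 1))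
       \<and> (\<forall>(M :: (real ^ 'm) set) (c::real).
            closed_smooth_strictly_convex M \<longrightarrow>
            (\<forall>x \<in> sphere 0 1.
                exp (1/2 * (norm (hom_grad (support_fn M) x))\<^sup>2) * curvature_fn M x = c) \<longrightarrow>
            (\<exists>r>0. M = (\<lambda>x. r *\<^sub>R x) ` sphere 0 1))"
proof (intro conjI allI impI)
  fix p c :: real and M :: "(real ^ 'm) set"
  assume p: "p > 1" and M: "closed_smooth_strictly_convex M"
    and pos: "\<forall>x \<in> sphere 0 1. support_fn M x > 0"
    and eq: "\<forall>x \<in> sphere 0 1. support_fn M x powr (p - 1)
                * exp (1/2 * (norm (hom_grad (support_fn M) x))\<^sup>2) * curvature_fn M x = c"
  obtain C where "convex_hypersurface M C" using convex_hypersurfaceI[OF assms M] .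
  then interpret convex_hypersurface M C .
  have h: "support_fn M x > 0" if "norm x = 1" for x using pos that by simp
  \<comment> \<open>Positivity of \<open>h\<close> keeps its values where the power is
    differentiable; together with \<open>p > 1\<close> it makes the derivative nonnegative.\<close>
  show "\<exists>r>0. M = (\<lambda>x. r *\<^sub>R x) ` sphere 0 1"
  proof (rule sphere_if_isotropic[where g = "\<lambda>t. t powr (p - 1)" and g' = "\<lambda>t. (p - 1) * t powr (p - 1 - 1)"])
    show "continuous_on (support_fn M ` sphere 0 1) (\<lambda>t. (p - 1) * t powr (p - 1 - 1))"
      using h by (intro continuous_intros) force
    show "((\<lambda>t. t powr (p - 1)) has_real_derivative (p - 1) * support_fn M x powr (p - 1 - 1)) (at (support_fn M x))"
      if "norm x = 1" for x
      using has_real_derivative_powr[OF h[OF that]] .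
  qed (use p h[THEN less_imp_neq] eq in auto)
next
  fix c :: real and M :: "(real ^ 'm) set"
  assume M: "closed_smooth_strictly_convex M"
    and eq: "\<forall>x \<in> sphere 0 1. exp (1/2 * (norm (hom_grad (support_fn M) x))\<^sup>2) * curvature_fn M x = c"
  obtain C where "convex_hypersurface M C" using convex_hypersurfaceI[OF assms M] .
  then interpret convex_hypersurface M C .
  \<comment> \<open>For \<open>p = 1\<close> the factor is the constant 1, so no sign of
    \<open>h\<close> enters.\<close>
  show "\<exists>r>0. M = (\<lambda>x. r *\<^sub>R x) ` sphere 0 1"
    by (rule sphere_if_isotropic[where g = "\<lambda>_. 1" and g' = "\<lambda>_. 0"]) (use eq in auto)
qed

end
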